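(* In the continuous-weight model, let $\bar{\boldsymbol\theta}^*=\bar{\boldsymbol\theta}^*_n$ satisfy $q_n\le\bar\alpha_i^*+\bar\beta_j^*\le Q_n$ for all $i\ne j$ with $0<q_n\le Q_n$, and let $A\sim\mathbb{P}_{\bar{\boldsymbol\theta}^*}$. If $Q_n/q_n=o\bigl(n^{1/50}/(\log n)^{1/25}\bigr)$, then for every fixed $k\ge1$, as $n\to\infty$, the vector of the first $k$ coordinates of $\hat{\boldsymbol\theta}-\bar{\boldsymbol\theta}^*$ is asymptotically multivariate normal with mean zero and covariance matrix equal to the upper-left $k\times k$ block $S_{[k]}$ of $S$; i.e. $S_{[k]}^{-1/2}(\hat{\boldsymbol\theta}-\bar{\boldsymbol\theta}^* )_{1:k}\to N(0,I_k)$ in distribution.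
   Context: Continuous-weight model: parameters $\bar{\boldsymbol\theta}=(\bar\alpha_1,\dots,\bar\alpha_n,\bar\beta_1,\dots,\bar\beta_{n-1})^\top$, $\bar\beta_n:=0$, $\bar\alpha_i+\bar\beta_j>0$ for $i\ne j$. Under $\mathbb{P}_{\bar{\boldsymbol\theta}}$, $A=(a_{i,j})$ has $a_{i,i}=0$ and independent entries $a_{i,j}$ ($i\ne j$) with density $(\bar\alpha_i+\bar\beta_j)e^{-(\bar\alpha_i+\bar\beta_j)a}$, $a\ge0$. $d_i=\sum_{j\ne i}a_{i,j}$, $b_j=\sum_{i\ne j}a_{i,j}$. The MLE $\hat{\boldsymbol\theta}$ (with $\hat\beta_n=0$) solves $d_i=\sum_{k\ne i}(\hat\alpha_i+\hat\beta_k)^{-1}$ ($i\le n$), $b_j=\sum_{k\ne j}(\hat\alpha_k+\hat\beta_j)^{-1}$ ($j\le n-1$). Fisher information at $\bar{\boldsymbol\theta}^*$: with $u(x)=1/x^2$, $v_{i,i}=\sum_{k\ne i}u(\bar\alpha_i^*+\bar\beta_k^* )$ ($i\le n$), $v_{n+j,n+j}=\sum_{k\ne j}u(\bar\alpha_k^*+\bar\beta_j^* )$ ($j\le n-1$), $v_{i,n+j}=v_{n+j,i}=u(\bar\alpha_i^*+\bar\beta_j^* )$ for $i\ne j$, other off-diagonal entries zero. $v_{2n,i}:=v_{i,i}-\sum_{j\le2n-1,j\ne i}v_{i,j}$, $v_{2n,2n}:=\sum_{i=1}^{2n-1}v_{2n,i}$. $S=(s_{i,j})$: $s_{i,j}=\delta_{i,j}/v_{i,i}+1/v_{2n,2n}$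 if $i,j\in\{1,\dots,n\}$ or $i,j\in\{n+1,\dots,2n-1\}$, else $s_{i,j}=-1/v_{2n,2n}$. *)

theory Defs
  imports "HOL-Probability.Probability" "HOL-Library.Landau_Symbols"
begin

text \<open>Vertices are 1..n. Parameters are functions nat => real:
  alpha i (1 <= i <= n), beta j (1 <= j <= n), with beta n = 0.\<close>

definition offdiag :: "nat \<Rightarrow> (nat \<times> nat) set" where
  "offdiag n = {(i, j). i \<in> {1..n} \<and> j \<in> {1..n} \<and> i \<noteq> j}"

text \<open>Law of the weight matrix A under P_theta: independent exponential entries a_{i,j}, i \<noteq> j,
  with rate alpha_i + beta_j (diagonal entries are 0 and omitted).\<close>
definition cw_model :: "nat \<Rightarrow> (nat \<Rightarrow> real) \<Rightarrow> (nat \<Rightarrow> real) \<Rightarrow> (nat \<times> nat \<Rightarrow> real) measure" where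
  "cw_model n \<alpha> \<beta> =
     PiM (offdiag n) (\<lambda>(i, j). density lborel (exponential_density (\<alpha> i + \<beta> j)))"

definition out_deg :: "nat \<Rightarrow> (nat \<times> nat \<Rightarrow> real) \<Rightarrow> nat \<Rightarrow> real" where
  "out_deg n A i = (\<Sum>j\<in>{1..n} - {i}. A (i, j))"

definition in_deg :: "nat \<Rightarrow> (nat \<times> nat \<Rightarrow> real) \<Rightarrow> nat \<Rightarrow> real" where
  "in_deg n A j = (\<Sum>i\<in>{1..n} - {j}. A (i, j))"

text \<open>(alpha, beta) solves the likelihood equations and lies in the parameter space.\<close>
definition is_mle :: "nat \<Rightarrow> (nat \<times> nat \<Rightarrow> real) \<Rightarrow> (nat \<Rightarrow> real) \<Rightarrow> (nat \<Rightarrow> real) \<Rightarrow> bool" where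
  "is_mle n A \<alpha> \<beta> \<longleftrightarrow>
     \<beta> n = 0 \<and>
     (\<forall>i\<in>{1..n}. \<forall>j\<in>{1..n}. i \<noteq> j \<longrightarrow> \<alpha> i + \<beta> j > 0) \<and>
     (\<forall>i\<in>{1..n}. out_deg n A i = (\<Sum>k\<in>{1..n} - {i}. 1 / (\<alpha> i + \<beta> k))) \<and>
     (\<forall>j\<in>{1..n-1}. in_deg n A j = (\<Sum>k\<in>{1..n} - {j}. 1 / (\<alpha> k + \<beta> j)))"

text \<open>The MLE (a chosen solution of the likelihood equations; an arbitrary fixed value if none exists).\<close>
definition mle :: "nat \<Rightarrow> (nat \<times> nat \<Rightarrow> real) \<Rightarrow> (nat \<Rightarrow> real) \<times> (nat \<Rightarrow> real)" where
  "mle n A = (SOME p. is_mle n A (fst p) (snd p))"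

text \<open>The parameter vector theta = (alpha_1..alpha_n, beta_1..beta_{n-1}), coordinates indexed 1..2n-1.\<close>
definition theta_coord :: "nat \<Rightarrow> (nat \<Rightarrow> real) \<Rightarrow> (nat \<Rightarrow> real) \<Rightarrow> nat \<Rightarrow> real" where
  "theta_coord n \<alpha> \<beta> l = (if l \<le> n then \<alpha> l else \<beta> (l - n))"

definition fisher_v :: "nat \<Rightarrow> (nat \<Rightarrow> real) \<Rightarrow> (nat \<Rightarrow> real) \<Rightarrow> nat \<Rightarrow> nat \<Rightarrow> real" where
  "fisher_v n \<alpha> \<beta> l m =
     (if l = m then
        (if l \<le> n then (\<Sum>k\<in>{1..n} - {l}. 1 / (\<alpha> l + \<beta> k)^2)
         else (\<Sum>k\<in>{1..n} - {l - n}. 1 / (\<alpha> k + \<beta> (l - n))^2))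
      else if l \<le> n \<and> n < m \<and> l \<noteq> m - n then 1 / (\<alpha> l + \<beta> (m - n))^2
      else if m \<le> n \<and> n < l \<and> m \<noteq> l - n then 1 / (\<alpha> m + \<beta> (l - n))^2
      else 0)"

definition fisher_v_last :: "nat \<Rightarrow> (nat \<Rightarrow> real) \<Rightarrow> (nat \<Rightarrow> real) \<Rightarrow> nat \<Rightarrow> real" where
  "fisher_v_last n \<alpha> \<beta> l =
     fisher_v n \<alpha> \<beta> l l - (\<Sum>j\<in>{1..2*n-1} - {l}. fisher_v n \<alpha> \<beta> l j)"

definition fisher_v_lastlast :: "nat \<Rightarrow> (nat \<Rightarrow> real) \<Rightarrow> (nat \<Rightarrow> real) \<Rightarrow> real" where
  "fisher_v_lastlast n \<alpha> \<beta> = (\<Sum>l\<in>{1..2*n-1}. fisher_v_last n \<alpha> \<beta> l)"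

text \<open>The approximate inverse S of the Fisher information, entries s_{l,m}, 1 <= l, m <= 2n-1.\<close>
definition S_mat :: "nat \<Rightarrow> (nat \<Rightarrow> real) \<Rightarrow> (nat \<Rightarrow> real) \<Rightarrow> nat \<Rightarrow> nat \<Rightarrow> real" where
  "S_mat n \<alpha> \<beta> l m =
     (if (l \<le> n \<and> m \<le> n) \<or> (n < l \<and> n < m)
      then (if l = m then 1 / fisher_v n \<alpha> \<beta> l l else 0) + 1 / fisher_v_lastlast n \<alpha> \<beta>
      else - 1 / fisher_v_lastlast n \<alpha> \<beta>)"

text \<open>Inverse square root of a symmetric positive definite k x k matrix (indices 0..k-1):
  the unique symmetric positive definite M with M M S = I.\<close>
definition inv_sqrt_mat :: "nat \<Rightarrow> (nat \<Rightarrow> nat \<Rightarrow> real) \<Rightarrow> nat \<Rightarrow> nat \<Rightarrow> real" where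
  "inv_sqrt_mat k S = (THE M.
     (\<forall>i j. (k \<le> i \<or> k \<le> j) \<longrightarrow> M i j = 0) \<and>
     (\<forall>i<k. \<forall>j<k. M i j = M j i) \<and>
     (\<forall>x. (\<exists>i<k. x i \<noteq> 0) \<longrightarrow> (\<Sum>i<k. \<Sum>j<k. x i * M i j * x j) > 0) \<and>
     (\<forall>i<k. \<forall>j<k. (\<Sum>l<k. \<Sum>m<k. M i l * M l m * S m j) = (if i = j then 1 else 0)))"

definition conv_in_distr :: "(nat \<Rightarrow> 'a measure) \<Rightarrow> (nat \<Rightarrow> 'a \<Rightarrow> 'b::topological_space) \<Rightarrow> 'b measure \<Rightarrow> bool" where
  "conv_in_distr M X L \<longleftrightarrow>
     (\<forall>f :: 'b \<Rightarrow> real. continuous_on UNIV f \<longrightarrow> bounded (range f) \<longrightarrow>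
        (\<lambda>n. \<integral>\<omega>. f (X n \<omega>) \<partial>M n) \<longlonglongrightarrow> (\<integral>x. f x \<partial>L))"

definition std_normal_vec :: "nat \<Rightarrow> (nat \<Rightarrow> real) measure" where
  "std_normal_vec k = PiM {..<k} (\<lambda>_. density lborel std_normal_density)"

end

theory Submission
  imports Defs "HOL-Real_Asymp.Real_Asymp"
begin

text \<open>Write \<open>d\<^sub>i - E d\<^sub>i\<close> and \<open>b\<^sub>k - E b\<^sub>k\<close> for the centred degrees and \<open>v\<^sub>i\<close>, \<open>c\<^sub>k\<close> for their variances.
  If the weights of weighted averages of the \<open>z\<^sub>k\<close> are bounded below, then two such averages differ by at most a
  fixed fraction (less than one) of the oscillation of the \<open>z\<^sub>k\<close>. Hence, if all weighted row and column sums of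
  \<open>x\<^sub>i + z\<^sub>k\<close> are small, then so are all \<open>x\<^sub>i + z\<^sub>k\<close>. Applied to the exact likelihood equations, with weights
  \<open>1 / ((\<alpha>\<^sub>i + \<beta>\<^sub>k) (\<alpha>'\<^sub>i + \<beta>'\<^sub>k))\<close> where the primed parameters are the estimates, this gives consistency;
  applied to the linearised equations, with weights \<open>1 / (\<alpha>\<^sub>i + \<beta>\<^sub>k)\<^sup>2\<close>, it gives
  \<open>\<alpha>'\<^sub>i - \<alpha>\<^sub>i = - (d\<^sub>i - E d\<^sub>i) / v\<^sub>i - (b\<^sub>n - E b\<^sub>n) / c\<^sub>n\<close> up to an error of smaller order than
  \<open>1 / sqrt v\<^sub>i\<close>, on an event whose probability tends to one by Chernoff bounds.
  The leading term is a linear combination of independent exponentials with asymptotic covariance \<open>S\<close>, so after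
  multiplication by the inverse square root of \<open>S\<close> its characteristic function converges to the Gaussian one.
  Convergence of characteristic functions and tightness yield convergence in distribution, because on a box every
  bounded continuous function is uniformly close to a trigonometric polynomial with nearly the same global bound.\<close>

section \<open>Linearisation of the likelihood equations\<close>

text \<open>The estimates occur in the weights of the exact equations and nothing bounds them
  beforehand. An upper bound for all fitted rates, and bounds for the row and column sums of the
  weights, are extracted from the likelihood equations alone; a lower bound for single fitted rates
  only follows from consistency. Two passes are made because stability is applied to data of
  different size. A single degree deviates by about sqrt n. Once the leading terms are subtracted,
  what is left is a quadratic remainder and weighted averages of the quotients (b_k - E b_k) / c_k,
  whose variance is bounded by powers of Q/q and 1/q without any power of n. Stability gains a
  factor 1/n and loses only powers of Q and q, so the Fisher matrix is never inverted. The equations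
  see only the sums x_i + z_k. The normalisation \<beta>_n = 0 turns x_i + z_n into the error of
  \<alpha>_i; this is why b_n enters every leading term and why the block of S is diagonal plus a
  constant.\<close>

lemma weighted_average_ge:
  fixes p z :: "'a \<Rightarrow> real"
  assumes "finite W" "K \<subseteq> W" and p: "\<And>k. k \<in> W \<Longrightarrow> 0 \<le> p k" "\<And>k. k \<in> K \<Longrightarrow> \<theta> \<le> p k"
    and one: "(\<Sum>k\<in>W. p k) = 1" and m: "\<And>k. k \<in> W \<Longrightarrow> m \<le> z k"
  shows "\<theta> * (\<Sum>k\<in>K. z k) + m * (1 - \<theta> * card K) \<le> (\<Sum>k\<in>W. p k * z k)"
proof -
  have fin: "finite K" using assms(1,2) finite_subset by blast
  \<comment> \<open>Removing \<theta> from the weight of each k in K leaves nonnegative weights of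
    total mass 1 - \<theta> * card K, whose share of the average is at least m times that
    mass.\<close>
  have "0 \<le> (\<Sum>k\<in>W. (p k - (if k \<in> K then \<theta> else 0)) * (z k - m))"
    using p m assms(2) by (intro sum_nonneg mult_nonneg_nonneg) auto
  also have "\<dots> = (\<Sum>k\<in>W. p k * z k) - m * (\<Sum>k\<in>W. p k)
      - (\<Sum>k\<in>W. if k \<in> K then \<theta> * (z k - m) else 0)"
    unfolding sum_distrib_left sum_subtractf[symmetric]
    by (intro sum.cong) (auto simp: algebra_simps)
  also have "(\<Sum>k\<in>W. if k \<in> K then \<theta> * (z k - m) else 0) = (\<Sum>k\<in>K. \<theta> * (z k - m))"
    using assms(1,2) by (simp add: sum.If_cases Int_absorb1)
  also have "\<dots> = \<theta> * (\<Sum>k\<in>K. z k) - \<theta> * m * card K"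
    by (simp add: sum_distrib_left right_diff_distrib sum_subtractf algebra_simps)
  finally show ?thesis using one by (simp add: algebra_simps)
qed

text \<open>Divided by its total, row i says that x i is, up to a small error, minus an average of
  the z k with all weights at least l / U. Rows i and j both contain the card V - 2 columns other
  than i and j, so the two averages share the mass (card V - 2) * l / U and can differ only through
  the rest: Doeblin's contraction argument.\<close>

lemma weighted_row_difference:
  fixes x z :: "'a \<Rightarrow> real" and w :: "'a \<Rightarrow> 'a \<Rightarrow> real" and l U t :: real
  assumes V: "finite V" "3 \<le> card V" and l: "0 < l"
    and w: "\<And>i k. i \<in> V \<Longrightarrow> k \<in> V \<Longrightarrow> i \<noteq> k \<Longrightarrow> l \<le> w i k"
    and U: "\<And>i. i \<in> V \<Longrightarrow> (\<Sum>k\<in>V - {i}. w i k) \<le> U"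
    and t: "\<And>i. i \<in> V \<Longrightarrow> \<bar>\<Sum>k\<in>V - {i}. w i k * (x i + z k)\<bar> \<le> t"
    and z: "\<And>k. k \<in> V \<Longrightarrow> m \<le> z k \<and> z k \<le> M"
    and ij: "i \<in> V" "j \<in> V"
  shows "x i - x j \<le> (1 - (card V - 2) * l / U) * (M - m) + 2 * (t / ((card V - 2) * l))"
    and "k \<in> V \<Longrightarrow> \<bar>x i + z k\<bar> \<le> t / ((card V - 2) * l) + (M - m)"
    and "(card V - 2) * l \<le> U"
proof -
  define W where "W i = (\<Sum>k\<in>V - {i}. w i k)" for i
  have W_ge: "(card V - 2) * l \<le> W a" if "a \<in> V" for a
  proof -
    have "(\<Sum>k\<in>V - {a}. l) \<le> W a"
      unfolding W_def using w that by (intro sum_mono) auto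
    moreover have "card (V - {a}) = card V - 1" using V that by simp
    moreover have "(card V - 2) * l \<le> (card V - 1) * l"
      using l by (intro mult_right_mono) auto
    ultimately show ?thesis by (simp only: sum_constant)
  qed
  have N: "0 < (card V - 2) * l" using V l by simp
  have W_pos: "0 < W a" if "a \<in> V" for a using W_ge[OF that] N by linarith
  have W_le: "W a \<le> U" if "a \<in> V" for a using U that by (simp add: W_def)
  show NU: "(card V - 2) * l \<le> U" using W_ge W_le ij by fastforce
  have U0: "0 < U" using NU N by linarith
  define p where "p a k = w a k / W a" for a k
  have p_ge: "l / U \<le> p a k" if "a \<in> V" "k \<in> V" "a \<noteq> k" for a k
    unfolding p_def using that w[OF that] W_pos[of a] W_le[of a] l
    by (intro frac_le) auto
  have p0: "0 \<le> p a k" if "a \<in> V" "k \<in> V" "a \<noteq> k" for a k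
    using p_ge[OF that] l U0 by (smt (verit) divide_pos_pos)
  have p1: "(\<Sum>k\<in>V - {a}. p a k) = 1" if "a \<in> V" for a
    unfolding p_def sum_divide_distrib[symmetric] W_def[symmetric]
    using W_pos[OF that] by simp
  define e where "e a = (\<Sum>k\<in>V - {a}. w a k * (x a + z k)) / W a" for a
  have e: "\<bar>e a\<bar> \<le> t / ((card V - 2) * l)" if "a \<in> V" for a
  proof -
    have "\<bar>e a\<bar> = \<bar>\<Sum>k\<in>V - {a}. w a k * (x a + z k)\<bar> / W a"
      using W_pos[OF that] by (simp add: e_def)
    also have "\<dots> \<le> t / ((card V - 2) * l)"
      by (rule frac_le[OF order_trans[OF abs_ge_zero t[OF that]] t[OF that] N W_ge[OF that]])
    finally show ?thesis .
  qed
  have e_eq: "e a = x a + (\<Sum>k\<in>V - {a}. p a k * z k)" if "a \<in> V" for a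
  proof -
    have "e a = (\<Sum>k\<in>V - {a}. p a k * (x a + z k))"
      by (simp add: e_def p_def sum_divide_distrib)
    also have "\<dots> = x a * (\<Sum>k\<in>V - {a}. p a k) + (\<Sum>k\<in>V - {a}. p a k * z k)"
      by (simp add: sum_distrib_left distrib_left sum.distrib mult.commute)
    finally show ?thesis using p1[OF that] by simp
  qed
  have mM: "m \<le> M" using z ij by fastforce
  show "\<bar>x i + z k\<bar> \<le> t / ((card V - 2) * l) + (M - m)" if k: "k \<in> V"
  proof -
    \<comment> \<open>With K empty, the averaging lemma just says that an average is at least the
      minimum; applied to - z it gives the bound by the maximum.\<close>
    have "m \<le> (\<Sum>k\<in>V - {i}. p i k * z k)"
      using weighted_average_ge[of "V - {i}" "{}" "p i" 0 m z] V p0 p1 z ij by auto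
    moreover have "- M \<le> (\<Sum>k\<in>V - {i}. p i k * (- z k))"
      using weighted_average_ge[of "V - {i}" "{}" "p i" 0 "- M" "\<lambda>k. - z k"] V p0 p1 z ij by auto
    moreover have "(\<Sum>k\<in>V - {i}. p i k * (- z k)) = - (\<Sum>k\<in>V - {i}. p i k * z k)"
      by (simp add: sum_negf)
    ultimately show ?thesis using e[OF ij(1)] z[OF k] e_eq[OF ij(1)]
      by (smt (verit, best))
  qed
  show "x i - x j \<le> (1 - (card V - 2) * l / U) * (M - m) + 2 * (t / ((card V - 2) * l))"
  proof (cases "i = j")
    case True
    have "0 \<le> t" using t[OF ij(1)] by linarith
    then have "0 \<le> t / ((card V - 2) * l)" using N by (rule divide_nonneg_pos)
    moreover have "0 \<le> (1 - (card V - 2) * l / U) * (M - m)"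
      using NU U0 mM by (intro mult_nonneg_nonneg) (auto simp: field_simps)
    ultimately show ?thesis using True by simp
  next
    case False
    define K where "K = V - {i, j}"
    have "card K = card V - 2" unfolding K_def using False ij V by (simp add: card_Diff_subset)
    then have K: "real (card K) = real (card V - 2)" by simp
    have 1: "l / U * (\<Sum>k\<in>K. z k) + m * (1 - l / U * card K) \<le> (\<Sum>k\<in>V - {i}. p i k * z k)"
      using V p0 p1 z ij p_ge by (intro weighted_average_ge) (auto simp: K_def)
    have 2: "l / U * (\<Sum>k\<in>K. - z k) + (- M) * (1 - l / U * card K) \<le> (\<Sum>k\<in>V - {j}. p j k * (- z k))"
      using V p0 p1 z ij p_ge by (intro weighted_average_ge) (auto simp: K_def)
    have "x i - x j = e i - e j + ((\<Sum>k\<in>V - {j}. p j k * z k) - (\<Sum>k\<in>V - {i}. p i k * z k))"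
      using e_eq ij by simp
    also have "\<dots> \<le> 2 * (t / ((card V - 2) * l)) + (M - m) * (1 - l / U * card K)"
    proof -
      \<comment> \<open>Here s is the contribution of the shared columns, which cancels, and
        \<kappa> is the mass left over in each of the two rows.\<close>
      have "B - A \<le> (M - m) * \<kappa>" if "s + m * \<kappa> \<le> A" "- s + (- M) * \<kappa> \<le> - B" for s \<kappa> A B
        using that by (simp add: algebra_simps)
      from this[OF 1, of "\<Sum>k\<in>V - {j}. p j k * z k"] 2
      have "(\<Sum>k\<in>V - {j}. p j k * z k) - (\<Sum>k\<in>V - {i}. p i k * z k) \<le> (M - m) * (1 - l / U * card K)"
        by (simp add: sum_negf)
      moreover have "e i - e j \<le> 2 * (t / ((card V - 2) * l))"
      proof -
        have "r - s \<le> 2 * \<eta>" if "\<bar>r\<bar> \<le> \<eta>" "\<bar>s\<bar> \<le> \<eta>" for r s \<eta> :: real using that by linarith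
        then show ?thesis using e ij by blast
      qed
      ultimately show ?thesis by (intro add_mono)
    qed
    finally show ?thesis unfolding K by (simp add: algebra_simps)
  qed
qed

text \<open>Rows bound the oscillation of x by a contracted oscillation of z; columns, as rows of
  the transposed weights, do the converse. With a = (card V - 2) * l and \<eta> = t / a, adding the
  two inequalities bounds the sum of the oscillations by 4 * \<eta> * U / a. Passing from the
  oscillation of z to x i + z k costs one more \<eta>, which is at most \<eta> * U / a; hence the
  factor 5.\<close>

lemma weighted_bipartite_stability:
  fixes x z :: "'a \<Rightarrow> real" and w :: "'a \<Rightarrow> 'a \<Rightarrow> real" and l U t :: real
  assumes V: "finite V" "3 \<le> card V" and l: "0 < l"
    and w: "\<And>i k. i \<in> V \<Longrightarrow> k \<in> V \<Longrightarrow> i \<noteq> k \<Longrightarrow> l \<le> w i k"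
    and row: "\<And>i. i \<in> V \<Longrightarrow> (\<Sum>k\<in>V - {i}. w i k) \<le> U"
    and col: "\<And>k. k \<in> V \<Longrightarrow> (\<Sum>i\<in>V - {k}. w i k) \<le> U"
    and row_t: "\<And>i. i \<in> V \<Longrightarrow> \<bar>\<Sum>k\<in>V - {i}. w i k * (x i + z k)\<bar> \<le> t"
    and col_t: "\<And>k. k \<in> V \<Longrightarrow> \<bar>\<Sum>i\<in>V - {k}. w i k * (x i + z k)\<bar> \<le> t"
    and ij: "i \<in> V" "k \<in> V"
  shows "\<bar>x i + z k\<bar> \<le> 5 * t * U / ((card V - 2) * l)^2"
proof -
  define a where "a = (card V - 2) * l"
  have a: "0 < a" using V l by (simp add: a_def)
  define \<eta> where "\<eta> = t / a"
  have ne: "V \<noteq> {}" using ij by auto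
  define mx Mx mz Mz where "mx = Min (x ` V)" and "Mx = Max (x ` V)" and "mz = Min (z ` V)" and "Mz = Max (z ` V)"
  have bx: "mx \<le> x v \<and> x v \<le> Mx" if "v \<in> V" for v using V that by (simp add: mx_def Mx_def)
  have bz: "mz \<le> z v \<and> z v \<le> Mz" if "v \<in> V" for v using V that by (simp add: mz_def Mz_def)
  note R = weighted_row_difference[of V l w U x z t mz Mz, OF V l w row row_t bz, folded a_def]
  note C = weighted_row_difference[of V l "\<lambda>k i. w i k" U z x t mx Mx, OF V l _ col _ bx, folded a_def]
  have C': "\<And>k. k \<in> V \<Longrightarrow> \<bar>\<Sum>i\<in>V - {k}. w i k * (z k + x i)\<bar> \<le> t"
    using col_t by (simp add: add.commute)
  have aU: "a \<le> U" using R(3) ij by blast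
  have U: "0 < U" using a aU by linarith
  have "Mx \<in> x ` V" "mx \<in> x ` V" using V ne by (auto simp: Mx_def mx_def)
  then obtain i1 i2 where i: "i1 \<in> V" "i2 \<in> V" "x i1 = Mx" "x i2 = mx" by auto
  have "Mz \<in> z ` V" "mz \<in> z ` V" using V ne by (auto simp: Mz_def mz_def)
  then obtain k1 k2 where k: "k1 \<in> V" "k2 \<in> V" "z k1 = Mz" "z k2 = mz" by auto
  have 1: "Mx - mx \<le> (1 - a / U) * (Mz - mz) + 2 * \<eta>"
    using R(1)[of i1 i2] i by (simp add: \<eta>_def)
  have 2: "Mz - mz \<le> (1 - a / U) * (Mx - mx) + 2 * \<eta>"
    using C(1)[of k1 k2] k w C' by (simp add: \<eta>_def)
  have "a / U * ((Mx - mx) + (Mz - mz)) \<le> 4 * \<eta>"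
    using 1 2 unfolding left_diff_distrib distrib_left by simp
  moreover have "a / U * (Mz - mz) \<le> a / U * ((Mx - mx) + (Mz - mz))"
    using a U i bx[OF i(1)] bx[OF i(2)] by (intro mult_left_mono) auto
  ultimately have "a / U * (Mz - mz) \<le> 4 * \<eta>" by linarith
  then have 3: "Mz - mz \<le> 4 * \<eta> * U / a" using a U by (simp add: field_simps)
  have "0 \<le> t" using row_t[OF ij(1)] by linarith
  then have "0 \<le> \<eta>" using a by (simp add: \<eta>_def)
  then have 4: "\<eta> \<le> \<eta> * U / a" using a aU by (simp add: pos_le_divide_eq mult_left_mono)
  define r where "r = \<eta> * U / a"
  have "\<eta> \<le> r" "Mz - mz \<le> 4 * r" using 3 4 by (simp_all add: r_def)
  then have "\<eta> + (Mz - mz) \<le> 5 * (\<eta> * U / a)" unfolding r_def[symmetric] by linarith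
  moreover have "\<bar>x i + z k\<bar> \<le> \<eta> + (Mz - mz)" using R(2)[of i i k] ij by (simp add: \<eta>_def)
  moreover have "5 * (\<eta> * U / a) = 5 * t * U / a^2" by (simp add: \<eta>_def power2_eq_square)
  ultimately show ?thesis unfolding a_def[symmetric] by linarith
qed


text \<open>As a m is maximal, 1 / (a m + b k) is no larger than any entry of column k, hence at
  most U / (card V - 1). The terms of row m with a m + b k > 2 * (card V - 1) / L add up to at most
  L / 2, so the remaining ones carry at least L / 2, and by \<open>LU\<close> a single one of them
  cannot.\<close>

lemma two_small_entries_in_max_row:
  fixes a b :: "'a \<Rightarrow> real" and L U :: real
  assumes V: "finite V" "2 \<le> card V" and L: "0 < L" and LU: "2 * U < (card V - 1) * L"
    and pos: "\<And>i k. i \<in> V \<Longrightarrow> k \<in> V \<Longrightarrow> i \<noteq> k \<Longrightarrow> 0 < a i + b k"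
    and col: "\<And>k. k \<in> V \<Longrightarrow> (\<Sum>i\<in>V - {k}. 1 / (a i + b k)) \<le> U"
    and m: "m \<in> V" "\<And>i. i \<in> V \<Longrightarrow> a i \<le> a m"
    and row: "L \<le> (\<Sum>k\<in>V - {m}. 1 / (a m + b k))"
  shows "2 \<le> card {k \<in> V. k \<noteq> m \<and> a m + b k \<le> 2 * real (card V - 1) / L}"
proof -
  define N where "N = real (card V - 1)"
  have N: "0 < N" using V by (simp add: N_def)
  have card1: "real (card (V - {k})) = N" if "k \<in> V" for k
    using that V by (simp add: N_def)
  \<comment> \<open>This includes k = m, on which \<open>pos\<close> is silent: any other row i has
    a i + b k > 0 and a i <= a m.\<close>
  have pm: "0 < a m + b k" if k: "k \<in> V" for k
  proof -
    have "V - {k} \<noteq> {}" using card1[OF k] N by force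
    then obtain i where "i \<in> V" "i \<noteq> k" by auto
    then show ?thesis using pos[of i k] m(2)[of i] k by fastforce
  qed
  have term_le: "1 / (a m + b k) \<le> U / N" if k: "k \<in> V" for k
  proof -
    have "(\<Sum>i\<in>V - {k}. 1 / (a m + b k)) \<le> (\<Sum>i\<in>V - {k}. 1 / (a i + b k))"
      using pos m k by (intro sum_mono frac_le) auto
    then have "N * (1 / (a m + b k)) \<le> U" using col[OF k] card1[OF k] by simp
    then show ?thesis using N by (simp add: field_simps)
  qed
  have U: "0 < U / N" using term_le[OF m(1)] pm[OF m(1)] by (smt (verit) divide_pos_pos)
  define K where "K = {k \<in> V. k \<noteq> m \<and> a m + b k \<le> 2 * N / L}"
  have K: "K \<subseteq> V - {m}" "finite K" using V by (auto simp: K_def)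
  have "L \<le> (\<Sum>k\<in>V - {m}. (if k \<in> K then U / N else 0) + L / (2 * N))"
  proof (rule order_trans[OF row sum_mono])
    fix k assume k: "k \<in> V - {m}"
    show "1 / (a m + b k) \<le> (if k \<in> K then U / N else 0) + L / (2 * N)"
    proof (cases "k \<in> K")
      case True
      then show ?thesis using term_le[of k] k L N by (simp add: add_increasing2)
    next
      case False
      then have "2 * N / L < a m + b k" using k by (auto simp: K_def)
      then have "1 / (a m + b k) \<le> 1 / (2 * N / L)"
        using N L by (intro frac_le) auto
      then show ?thesis using False by simp
    qed
  qed
  also have "\<dots> = (\<Sum>k\<in>V - {m}. if k \<in> K then U / N else 0) + N * (L / (2 * N))"
    using card1[OF m(1)] by (simp add: sum.distrib)
  also have "(\<Sum>k\<in>V - {m}. if k \<in> K then U / N else 0) = card K * (U / N)"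
    using K V by (simp add: sum.If_cases Int_absorb1)
  also have "N * (L / (2 * N)) = L / 2" using N by simp
  finally have "L / 2 \<le> card K * (U / N)" by linarith
  moreover have "U / N < L / 2" using LU N unfolding N_def[symmetric] by (simp add: field_simps)
  ultimately have "1 * (U / N) < card K * (U / N)" by linarith
  then have "1 < real (card K)" using U by (simp only: mult_less_cancel_right_pos)
  then show ?thesis by (simp add: K_def N_def)
qed

text \<open>The largest \<open>a m + b m'\<close> is bounded because, by the previous lemma, there are \<open>i \<noteq> k\<close> with
  \<open>a m + b k\<close> and \<open>a i + b m'\<close> small, while \<open>a i + b k\<close> is positive.\<close>

lemma reciprocal_sums_upper_bound:
  fixes a b :: "'a \<Rightarrow> real" and L U :: real
  assumes V: "finite V" "2 \<le> card V" and L: "0 < L" and LU: "2 * U < (card V - 1) * L"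
    and pos: "\<And>i k. i \<in> V \<Longrightarrow> k \<in> V \<Longrightarrow> i \<noteq> k \<Longrightarrow> 0 < a i + b k"
    and row: "\<And>i. i \<in> V \<Longrightarrow> L \<le> (\<Sum>k\<in>V - {i}. 1 / (a i + b k)) \<and> (\<Sum>k\<in>V - {i}. 1 / (a i + b k)) \<le> U"
    and col: "\<And>k. k \<in> V \<Longrightarrow> L \<le> (\<Sum>i\<in>V - {k}. 1 / (a i + b k)) \<and> (\<Sum>i\<in>V - {k}. 1 / (a i + b k)) \<le> U"
    and ik: "i \<in> V" "k \<in> V"
  shows "a i + b k \<le> 4 * real (card V - 1) / L"
proof -
  have "Max (a ` V) \<in> a ` V" "Max (b ` V) \<in> b ` V" using V ik by (auto intro!: Max_in)
  then obtain m m' where m: "m \<in> V" "a m = Max (a ` V)" "m' \<in> V" "b m' = Max (b ` V)"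
    by auto
  have ma: "a j \<le> a m" and mb: "b j \<le> b m'" if "j \<in> V" for j
    using m that V by auto
  define D where "D = 2 * real (card V - 1) / L"
  have 1: "2 \<le> card {k \<in> V. k \<noteq> m \<and> a m + b k \<le> D}"
    unfolding D_def using V L LU pos m(1) ma row col by (intro two_small_entries_in_max_row) auto
  have 2: "2 \<le> card {k \<in> V. k \<noteq> m' \<and> b m' + a k \<le> D}"
    unfolding D_def using V L LU pos m(3) mb row col
    by (intro two_small_entries_in_max_row[where U = U]) (auto simp: add.commute)
  have nonempty: "S \<noteq> {}" if "2 \<le> card S" for S :: "'a set" using that by auto
  from nonempty[OF 2] obtain i' where i': "i' \<in> V" "b m' + a i' \<le> D" by blast
  \<comment> \<open>Two small entries are counted because i' is already chosen, and k' must differ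
    from it for a i' + b k' to be known positive.\<close>
  have not_single: "\<not> S \<subseteq> {i'}" if "2 \<le> card S" for S
    using that card_mono[of "{i'}" S] by auto
  from not_single[OF 1] obtain k' where k': "k' \<in> V" "k' \<noteq> i'" "a m + b k' \<le> D" by auto
  have "0 < a i' + b k'" using pos i' k' by auto
  then have "a m + b m' \<le> 2 * D" using i' k' by linarith
  then show ?thesis using ma[OF ik(1)] mb[OF ik(2)] by (simp add: D_def)
qed

text \<open>The deterministic core: \<delta> and \<epsilon> are arbitrary perturbations of the row
  and column sums. In the second use of stability, X and Z are the errors with their leading terms
  removed. Weighted by u, the leading term of row i sums to \<delta> i and cancels the - \<delta> i
  of the exact equation; what survives is the quadratic remainder R and the average of the
  \<epsilon> k / c k, which t2 bounds. Columns behave alike.\<close>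

lemma mle_linearization:
  fixes \<alpha> \<beta> a b \<delta> \<epsilon> v c :: "'a \<Rightarrow> real" and q Q t1 t2 W :: real
  assumes V: "finite V" "3 \<le> card V" and q: "0 < q" "q \<le> Q"
    and y: "\<And>i k. i \<in> V \<Longrightarrow> k \<in> V \<Longrightarrow> i \<noteq> k \<Longrightarrow> q \<le> \<alpha> i + \<beta> k \<and> \<alpha> i + \<beta> k \<le> Q"
    and pos: "\<And>i k. i \<in> V \<Longrightarrow> k \<in> V \<Longrightarrow> i \<noteq> k \<Longrightarrow> 0 < a i + b k"
    and row: "\<And>i. i \<in> V \<Longrightarrow> (\<Sum>k\<in>V - {i}. 1 / (a i + b k)) = (\<Sum>k\<in>V - {i}. 1 / (\<alpha> i + \<beta> k)) + \<delta> i"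
    and col: "\<And>k. k \<in> V \<Longrightarrow> (\<Sum>i\<in>V - {k}. 1 / (a i + b k)) = (\<Sum>i\<in>V - {k}. 1 / (\<alpha> i + \<beta> k)) + \<epsilon> k"
    and v: "\<And>i. i \<in> V \<Longrightarrow> v i = (\<Sum>k\<in>V - {i}. 1 / (\<alpha> i + \<beta> k)^2)"
    and c: "\<And>k. k \<in> V \<Longrightarrow> c k = (\<Sum>i\<in>V - {k}. 1 / (\<alpha> i + \<beta> k)^2)"
    and t1: "\<And>i. i \<in> V \<Longrightarrow> \<bar>\<delta> i\<bar> \<le> t1" "\<And>i. i \<in> V \<Longrightarrow> \<bar>\<epsilon> i\<bar> \<le> t1" "t1 \<le> (card V - 1) / (2 * Q)"
    and t2: "\<And>i. i \<in> V \<Longrightarrow> \<bar>\<Sum>k\<in>V - {i}. 1 / (\<alpha> i + \<beta> k)^2 * (\<epsilon> k / c k)\<bar> \<le> t2"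
      "\<And>k. k \<in> V \<Longrightarrow> \<bar>\<Sum>i\<in>V - {k}. 1 / (\<alpha> i + \<beta> k)^2 * (\<delta> i / v i)\<bar> \<le> t2"
    and N: "8 * Q < (card V - 1) * q"
    and W: "W = 5 * t1 * (2 * real (card V) / q^2) / ((card V - 2) * (1 / (8 * Q^2)))^2" "W \<le> q / 2"
    and ij: "i \<in> V" "j \<in> V" "b j = \<beta> j"
  shows "\<bar>a i - \<alpha> i + \<delta> i / v i + \<epsilon> j / c j\<bar>
    \<le> 5 * (2 * real (card V) * W^2 / q^3 + t2) * (card V / q^2) / ((card V - 2) * (1 / Q^2))^2"
proof -
  define M where "M = real (card V - 1)"
  have M: "0 < M" "M \<le> card V" using V by (auto simp: M_def)
  have card1: "real (card (V - {k})) = M" if "k \<in> V" for k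
    using that V by (simp add: M_def)
  have Q: "0 < Q" using q by simp
  have inv_bounds: "1 / Q \<le> 1 / (\<alpha> i + \<beta> k) \<and> 1 / (\<alpha> i + \<beta> k) \<le> 1 / q"
    if "i \<in> V" "k \<in> V" "i \<noteq> k" for i k
    using y[OF that] q by (auto intro!: frac_le)
  have row_b: "M / Q \<le> (\<Sum>k\<in>V - {i}. 1 / (\<alpha> i + \<beta> k)) \<and> (\<Sum>k\<in>V - {i}. 1 / (\<alpha> i + \<beta> k)) \<le> M / q"
    if "i \<in> V" for i
    using sum_bounded_below[of "V - {i}" "1 / Q" "\<lambda>k. 1 / (\<alpha> i + \<beta> k)"]
      sum_bounded_above[of "V - {i}" "\<lambda>k. 1 / (\<alpha> i + \<beta> k)" "1 / q"] inv_bounds that card1[OF that] by auto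
  have col_b: "M / Q \<le> (\<Sum>i\<in>V - {k}. 1 / (\<alpha> i + \<beta> k)) \<and> (\<Sum>i\<in>V - {k}. 1 / (\<alpha> i + \<beta> k)) \<le> M / q"
    if "k \<in> V" for k
    using sum_bounded_below[of "V - {k}" "1 / Q" "\<lambda>i. 1 / (\<alpha> i + \<beta> k)"]
      sum_bounded_above[of "V - {k}" "\<lambda>i. 1 / (\<alpha> i + \<beta> k)" "1 / q"] inv_bounds that card1[OF that] by auto
  have t1': "t1 \<le> M / (2 * Q)" using t1(3) by (simp add: M_def)
  have MQ: "M / (2 * Q) \<le> M / q" "M / Q = M / (2 * Q) + M / (2 * Q)"
    using M q by (auto intro!: frac_le simp: field_simps)
  \<comment> \<open>By \<open>t1'\<close> the perturbation at most halves the lower bound M / Q and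
    at most doubles the upper bound M / q. With these values 2 * U < M * L is hypothesis
    \<open>N\<close>.\<close>
  define L where "L = M / (2 * Q)"
  define U where "U = 2 * M / q"
  have U2: "U = M / q + M / q" by (simp add: U_def)
  have row': "L \<le> (\<Sum>k\<in>V - {i}. 1 / (a i + b k)) \<and> (\<Sum>k\<in>V - {i}. 1 / (a i + b k)) \<le> U" if "i \<in> V" for i
    using row_b[OF that] t1(1)[OF that] t1' MQ unfolding row[OF that] L_def U2 by linarith
  have col': "L \<le> (\<Sum>i\<in>V - {k}. 1 / (a i + b k)) \<and> (\<Sum>i\<in>V - {k}. 1 / (a i + b k)) \<le> U" if "k \<in> V" for k
    using col_b[OF that] t1(2)[OF that] t1' MQ unfolding col[OF that] L_def U2 by linarith
  have LU: "2 * U < M * L"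
  proof -
    have "8 * Q * M < M * q * M" using N M(1) unfolding M_def[symmetric] by (rule mult_strict_right_mono)
    then show ?thesis unfolding L_def U_def using q Q by (simp add: field_simps power2_eq_square)
  qed
  have L0: "0 < L" using M Q by (simp add: L_def)
  have ub: "a i + b k \<le> 8 * Q" if "i \<in> V" "k \<in> V" for i k
  proof -
    have "a i + b k \<le> 4 * real (card V - 1) / L"
      using V L0 LU pos row' col' that unfolding M_def
      by (intro reciprocal_sums_upper_bound[where U = U]) auto
    also have "\<dots> = 8 * Q" using M unfolding M_def[symmetric] L_def by simp
    finally show ?thesis .
  qed
  define w where "w i k = 1 / ((\<alpha> i + \<beta> k) * (a i + b k))" for i k
  define x where "x i = a i - \<alpha> i" for i
  define z where "z k = b k - \<beta> k" for k
  have w_eq: "w i k * (x i + z k) = 1 / (\<alpha> i + \<beta> k) - 1 / (a i + b k)"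
    if "i \<in> V" "k \<in> V" "i \<noteq> k" for i k
    using y[OF that] pos[OF that] q unfolding w_def x_def z_def
    by (simp add: divide_simps)
  have w_l: "1 / (8 * Q^2) \<le> w i k" if "i \<in> V" "k \<in> V" "i \<noteq> k" for i k
  proof -
    have "(\<alpha> i + \<beta> k) * (a i + b k) \<le> Q * (8 * Q)"
      using y[OF that] pos[OF that] ub[OF that(1,2)] q by (intro mult_mono) auto
    then show ?thesis unfolding w_def using y[OF that] pos[OF that] q
      by (intro frac_le) (auto simp: power2_eq_square)
  qed
  \<comment> \<open>Single fitted rates may still be close to 0, so the row and column sums of w are
    bounded through the perturbed equations rather than entry by entry.\<close>
  have w_le: "w i k \<le> 1 / q * (1 / (a i + b k))" if "i \<in> V" "k \<in> V" "i \<noteq> k" for i k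
  proof -
    have "q * (a i + b k) \<le> (\<alpha> i + \<beta> k) * (a i + b k)"
      using y[OF that] pos[OF that] by (intro mult_right_mono) auto
    then show ?thesis unfolding w_def using y[OF that] pos[OF that] q
      by (simp add: frac_le)
  qed
  have U': "1 / q * U \<le> 2 * real (card V) / q^2"
    using M q by (simp add: U_def power2_eq_square divide_right_mono)
  have w_row: "(\<Sum>k\<in>V - {i}. w i k) \<le> 2 * real (card V) / q^2" if i: "i \<in> V" for i
  proof -
    have "(\<Sum>k\<in>V - {i}. w i k) \<le> (\<Sum>k\<in>V - {i}. 1 / q * (1 / (a i + b k)))"
      using w_le i by (intro sum_mono) auto
    also have "\<dots> \<le> 1 / q * U"
      unfolding sum_distrib_left[symmetric] using row'[OF i] q by (intro mult_left_mono) auto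
    finally show ?thesis using U' by linarith
  qed
  have w_col: "(\<Sum>i\<in>V - {k}. w i k) \<le> 2 * real (card V) / q^2" if k: "k \<in> V" for k
  proof -
    have "(\<Sum>i\<in>V - {k}. w i k) \<le> (\<Sum>i\<in>V - {k}. 1 / q * (1 / (a i + b k)))"
      using w_le k by (intro sum_mono) auto
    also have "\<dots> \<le> 1 / q * U"
      unfolding sum_distrib_left[symmetric] using col'[OF k] q by (intro mult_left_mono) auto
    finally show ?thesis using U' by linarith
  qed
  have w_rt: "(\<Sum>k\<in>V - {i}. w i k * (x i + z k)) = - \<delta> i" if i: "i \<in> V" for i
  proof -
    have "(\<Sum>k\<in>V - {i}. w i k * (x i + z k)) = (\<Sum>k\<in>V - {i}. 1 / (\<alpha> i + \<beta> k) - 1 / (a i + b k))"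
      using i by (intro sum.cong) (auto simp: w_eq)
    then show ?thesis using row[OF i] by (simp add: sum_subtractf)
  qed
  have w_ct: "(\<Sum>i\<in>V - {k}. w i k * (x i + z k)) = - \<epsilon> k" if k: "k \<in> V" for k
  proof -
    have "(\<Sum>i\<in>V - {k}. w i k * (x i + z k)) = (\<Sum>i\<in>V - {k}. 1 / (\<alpha> i + \<beta> k) - 1 / (a i + b k))"
      using k by (intro sum.cong) (auto simp: w_eq)
    then show ?thesis using col[OF k] by (simp add: sum_subtractf)
  qed
  have xz: "\<bar>x i + z k\<bar> \<le> W" if "i \<in> V" "k \<in> V" for i k
    unfolding W(1)
  proof (rule weighted_bipartite_stability[where w = w])
    show "0 < 1 / (8 * Q^2)" using Q by simp
  qed (use V w_l w_row w_col w_rt w_ct t1 that in auto)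
  define u where "u i k = 1 / (\<alpha> i + \<beta> k)^2" for i k
  define R where "R i k = u i k * (x i + z k) - w i k * (x i + z k)" for i k
  have R: "\<bar>R i k\<bar> \<le> 2 * W^2 / q^3" if "i \<in> V" "k \<in> V" "i \<noteq> k" for i k
  proof -
    \<comment> \<open>Consistency with precision W <= q / 2 is what keeps the fitted rates away from
      0 and makes the remainder quadratic.\<close>
    have h: "q / 2 \<le> a i + b k"
      using xz[OF that(1,2)] W(2) y[OF that] unfolding x_def z_def by linarith
    have "\<bar>R i k\<bar> = \<bar>(x i + z k)^2 / ((\<alpha> i + \<beta> k)^2 * (a i + b k))\<bar>"
    proof -
      have "1 / y^2 * (h - y) - 1 / (y * h) * (h - y) = (h - y)^2 / (y^2 * h)"
        if "0 < y" "0 < h" for y h :: real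
        using that by (simp add: field_simps power2_eq_square)
      from this[of "\<alpha> i + \<beta> k" "a i + b k"]
      show ?thesis using y[OF that] pos[OF that] q
        by (simp add: R_def u_def w_def x_def z_def add_diff_add)
    qed
    also have "\<dots> = (x i + z k)^2 / ((\<alpha> i + \<beta> k)^2 * (a i + b k))"
      using pos[OF that] by simp
    also have "\<dots> \<le> W^2 / (q^2 * (q / 2))"
    proof (rule frac_le)
      show "(x i + z k)^2 \<le> W^2"
        using xz[OF that(1,2)] by (metis abs_le_square_iff abs_of_nonneg order_trans abs_ge_zero)
      show "q^2 * (q / 2) \<le> (\<alpha> i + \<beta> k)^2 * (a i + b k)"
        using h y[OF that] q by (intro mult_mono power_mono) auto
    qed (use q in auto)
    also have "\<dots> = 2 * W^2 / q^3" by (simp add: power3_eq_cube power2_eq_square)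
    finally show ?thesis .
  qed
  have u_b: "1 / Q^2 \<le> u i k \<and> u i k \<le> 1 / q^2" if "i \<in> V" "k \<in> V" "i \<noteq> k" for i k
    unfolding u_def using y[OF that] q by (auto intro!: frac_le power_mono)
  have RS: "\<bar>\<Sum>k\<in>S. f k\<bar> \<le> 2 * real (card V) * W^2 / q^3"
    if "\<And>k. k \<in> S \<Longrightarrow> \<bar>f k\<bar> \<le> 2 * W^2 / q^3" "real (card S) = M" for f :: "'a \<Rightarrow> real" and S
  proof -
    have "\<bar>\<Sum>k\<in>S. f k\<bar> \<le> (\<Sum>k\<in>S. 2 * W^2 / q^3)"
      by (rule order_trans[OF sum_abs sum_mono]) (rule that)
    also have "\<dots> = M * (2 * W^2 / q^3)" using that(2) by simp
    also have "\<dots> \<le> card V * (2 * W^2 / q^3)"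
      using M q by (intro mult_right_mono) auto
    finally show ?thesis by (simp add: mult_ac)
  qed
  define X where "X i = x i + \<delta> i / v i" for i
  define Z where "Z k = z k + \<epsilon> k / c k" for k
  have ne: "V - {k} \<noteq> {}" if "k \<in> V" for k using card1[OF that] M by force
  have v0: "v i \<noteq> 0" if i: "i \<in> V" for i
  proof -
    have "0 < (\<Sum>k\<in>V - {i}. 1 / (\<alpha> i + \<beta> k)^2)"
      using V ne[OF i] y i q by (intro sum_pos) (fastforce simp: zero_less_power)+
    then show ?thesis using v[OF i] by simp
  qed
  have c0: "c k \<noteq> 0" if k: "k \<in> V" for k
  proof -
    have "0 < (\<Sum>i\<in>V - {k}. 1 / (\<alpha> i + \<beta> k)^2)"
      using V ne[OF k] y k q by (intro sum_pos) (fastforce simp: zero_less_power)+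
    then show ?thesis using c[OF k] by simp
  qed
  have X_row: "\<bar>\<Sum>k\<in>V - {i}. u i k * (X i + Z k)\<bar> \<le> 2 * real (card V) * W^2 / q^3 + t2" if i: "i \<in> V" for i
  proof -
    have "(\<Sum>k\<in>V - {i}. u i k * (X i + Z k)) =
        (\<Sum>k\<in>V - {i}. R i k) + (\<Sum>k\<in>V - {i}. w i k * (x i + z k))
        + (\<Sum>k\<in>V - {i}. u i k) * (\<delta> i / v i) + (\<Sum>k\<in>V - {i}. u i k * (\<epsilon> k / c k))"
      unfolding sum_distrib_right sum.distrib[symmetric]
      by (intro sum.cong) (auto simp: R_def X_def Z_def algebra_simps)
    also have "(\<Sum>k\<in>V - {i}. u i k) * (\<delta> i / v i) = \<delta> i"
      using v[OF i] v0[OF i] by (simp add: u_def)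
    also have "\<bar>(\<Sum>k\<in>V - {i}. R i k) + (\<Sum>k\<in>V - {i}. w i k * (x i + z k)) + \<delta> i
        + (\<Sum>k\<in>V - {i}. u i k * (\<epsilon> k / c k))\<bar>
      \<le> \<bar>\<Sum>k\<in>V - {i}. R i k\<bar> + \<bar>\<Sum>k\<in>V - {i}. u i k * (\<epsilon> k / c k)\<bar>"
      unfolding w_rt[OF i] by linarith
    also have "\<dots> \<le> 2 * real (card V) * W^2 / q^3 + t2"
      using i t2(1)[OF i] card1[OF i] by (intro add_mono RS) (auto simp: u_def intro!: R)
    finally show ?thesis .
  qed
  have X_col: "\<bar>\<Sum>i\<in>V - {k}. u i k * (X i + Z k)\<bar> \<le> 2 * real (card V) * W^2 / q^3 + t2" if k: "k \<in> V" for k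
  proof -
    have "(\<Sum>i\<in>V - {k}. u i k * (X i + Z k)) =
        (\<Sum>i\<in>V - {k}. R i k) + (\<Sum>i\<in>V - {k}. w i k * (x i + z k))
        + (\<Sum>i\<in>V - {k}. u i k) * (\<epsilon> k / c k) + (\<Sum>i\<in>V - {k}. u i k * (\<delta> i / v i))"
      unfolding sum_distrib_right sum.distrib[symmetric]
      by (intro sum.cong) (auto simp: R_def X_def Z_def algebra_simps)
    also have "(\<Sum>i\<in>V - {k}. u i k) * (\<epsilon> k / c k) = \<epsilon> k"
      using c[OF k] c0[OF k] by (simp add: u_def)
    also have "\<bar>(\<Sum>i\<in>V - {k}. R i k) + (\<Sum>i\<in>V - {k}. w i k * (x i + z k)) + \<epsilon> k
        + (\<Sum>i\<in>V - {k}. u i k * (\<delta> i / v i))\<bar>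
      \<le> \<bar>\<Sum>i\<in>V - {k}. R i k\<bar> + \<bar>\<Sum>i\<in>V - {k}. u i k * (\<delta> i / v i)\<bar>"
      unfolding w_ct[OF k] by linarith
    also have "\<dots> \<le> 2 * real (card V) * W^2 / q^3 + t2"
      using k t2(2)[OF k] card1[OF k] by (intro add_mono RS) (auto simp: u_def intro!: R)
    finally show ?thesis .
  qed
  have u_row: "(\<Sum>k\<in>S. f k) \<le> card V / q^2"
    if "\<And>k. k \<in> S \<Longrightarrow> f k \<le> 1 / q^2" "real (card S) = M" for f :: "'a \<Rightarrow> real" and S
  proof -
    have "(\<Sum>k\<in>S. f k) \<le> M * (1 / q^2)" using sum_bounded_above[of S f "1 / q^2"] that by auto
    also have "\<dots> \<le> card V * (1 / q^2)" using M by (intro mult_right_mono) auto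
    finally show ?thesis by simp
  qed
  have "\<bar>X i + Z j\<bar> \<le> 5 * (2 * real (card V) * W^2 / q^3 + t2) * (card V / q^2) / ((card V - 2) * (1 / Q^2))^2"
  proof (rule weighted_bipartite_stability[where w = u])
    show "0 < 1 / Q^2" using Q by simp
    show "(\<Sum>k\<in>V - {i}. u i k) \<le> card V / q^2" if "i \<in> V" for i
      using that u_b card1[OF that] by (intro u_row) auto
    show "(\<Sum>i\<in>V - {k}. u i k) \<le> card V / q^2" if "k \<in> V" for k
      using that u_b card1[OF that] by (intro u_row) auto
  qed (use V u_b X_row X_col ij in auto)
  \<comment> \<open>Since b j = \<beta> j, we have z j = 0, and X i + Z j involves the error of a i
    alone.\<close>
  then show ?thesis using ij(3) by (simp add: X_def Z_def x_def z_def)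
qed

section \<open>Inverse square roots of matrices\<close>

text \<open>Entries outside the block are set to 0, as in the support condition of
  \<open>inv_sqrt_mat\<close>, so that matrix identities become equalities of functions.\<close>

definition sq_mult :: "nat \<Rightarrow> (nat \<Rightarrow> nat \<Rightarrow> real) \<Rightarrow> (nat \<Rightarrow> nat \<Rightarrow> real) \<Rightarrow> nat \<Rightarrow> nat \<Rightarrow> real" where
  "sq_mult k A B = (\<lambda>i j. if i < k \<and> j < k then \<Sum>l<k. A i l * B l j else 0)"

definition sq_id :: "nat \<Rightarrow> nat \<Rightarrow> nat \<Rightarrow> real" where
  "sq_id k = (\<lambda>i j. if i < k \<and> i = j then 1 else 0)"

definition square_supported :: "nat \<Rightarrow> (nat \<Rightarrow> nat \<Rightarrow> real) \<Rightarrow> bool" where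
  "square_supported k A \<longleftrightarrow> (\<forall>i j. k \<le> i \<or> k \<le> j \<longrightarrow> A i j = 0)"

text \<open>A bound on the operator norm for the maximum norm: it is submultiplicative and can be
  read off from the entries.\<close>

definition row_sums_le :: "nat \<Rightarrow> (nat \<Rightarrow> nat \<Rightarrow> real) \<Rightarrow> real \<Rightarrow> bool" where
  "row_sums_le k A y \<longleftrightarrow> (\<forall>i<k. (\<Sum>j<k. \<bar>A i j\<bar>) \<le> y)"

section \<open>Matrix algebra on a block and square roots near the identity\<close>

lemma sq_mult_assoc: "sq_mult k (sq_mult k A B) C = sq_mult k A (sq_mult k B C)"
proof (intro ext)
  fix i j
  have "(\<Sum>l<k. (\<Sum>m<k. A i m * B m l) * C l j) = (\<Sum>m<k. A i m * (\<Sum>l<k. B m l * C l j))"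
    unfolding sum_distrib_right sum_distrib_left by (subst sum.swap) (simp add: mult_ac)
  then show "sq_mult k (sq_mult k A B) C i j = sq_mult k A (sq_mult k B C) i j" by (simp add: sq_mult_def)
qed

lemma sq_mult_id:
  assumes "square_supported k A"
  shows "sq_mult k (sq_id k) A = A" "sq_mult k A (sq_id k) = A"
proof -
  have "(\<Sum>l<k. sq_id k i l * A l j) = (\<Sum>l<k. if l = i then A l j else 0)" if "i < k" for i j
    using that by (intro sum.cong) (auto simp: sq_id_def)
  then show "sq_mult k (sq_id k) A = A"
    using assms by (intro ext) (auto simp: sq_mult_def square_supported_def)
  have "(\<Sum>l<k. A i l * sq_id k l j) = (\<Sum>l<k. if l = j then A i l else 0)" for i j
    by (intro sum.cong) (auto simp: sq_id_def)
  then show "sq_mult k A (sq_id k) = A"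
    using assms by (intro ext) (auto simp: sq_mult_def square_supported_def)
qed

lemma row_sums_le_mult:
  assumes "row_sums_le k A a" "row_sums_le k B b"
  shows "row_sums_le k (sq_mult k A B) (a * b)"
  unfolding row_sums_le_def
proof (intro allI impI)
  fix i assume i: "i < k"
  have b: "0 \<le> b" using assms(2) i unfolding row_sums_le_def
    by (meson abs_ge_zero order_trans sum_nonneg)
  have "(\<Sum>j<k. \<bar>sq_mult k A B i j\<bar>) \<le> (\<Sum>j<k. \<Sum>l<k. \<bar>A i l\<bar> * \<bar>B l j\<bar>)"
    using i by (intro sum_mono) (auto simp: sq_mult_def abs_mult[symmetric] intro!: sum_abs)
  also have "\<dots> = (\<Sum>l<k. \<bar>A i l\<bar> * (\<Sum>j<k. \<bar>B l j\<bar>))"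
    by (subst sum.swap) (simp add: sum_distrib_left)
  also have "\<dots> \<le> (\<Sum>l<k. \<bar>A i l\<bar> * b)"
    using assms(2) by (intro sum_mono mult_left_mono) (auto simp: row_sums_le_def)
  also have "\<dots> \<le> a * b"
    unfolding sum_distrib_right[symmetric] using assms(1) i b
    by (intro mult_right_mono) (auto simp: row_sums_le_def)
  finally show "(\<Sum>j<k. \<bar>sq_mult k A B i j\<bar>) \<le> a * b" .
qed

text \<open>The square root of \<open>I - B\<close> is \<open>I - Y\<close>, where \<open>Y\<close> is a fixed point of
  \<open>Y \<mapsto> (B + Y\<^sup>2) / 2\<close>, which is a contraction for the row sum norm when \<open>B\<close> has norm below one.\<close>

lemma matrix_square_root_fixed_point:
  assumes B: "row_sums_le k B \<rho>" "0 \<le> \<rho>" "\<rho> < 1" "square_supported k B" "\<And>i j. B i j = B j i"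
  obtains Y y where "square_supported k Y" "\<And>i j. Y i j = Y j i" "row_sums_le k Y y" "y < 1"
    "\<And>i j. Y i j = (B i j + sq_mult k Y Y i j) / 2"
proof -
  \<comment> \<open>The smaller root of y = (\<rho> + y^2) / 2: the iteration maps the ball of
    radius y into itself, and y < 1.\<close>
  define y where "y = 1 - sqrt (1 - \<rho>)"
  have y: "0 \<le> y" "y < 1" using B(2,3) by (auto simp: y_def)
  have "(1 - y)^2 = 1 - \<rho>" using B(3) by (simp add: y_def)
  then have yy: "(\<rho> + y * y) / 2 = y" by (simp add: power2_eq_square algebra_simps)
  define Z where "Z = rec_nat (\<lambda>_ _. 0) (\<lambda>_ Y i j. (B i j + sq_mult k Y Y i j) / 2)"
  have Z0: "Z 0 = (\<lambda>_ _. 0)" and ZS: "Z (Suc n) = (\<lambda>i j. (B i j + sq_mult k (Z n) (Z n) i j) / 2)" for n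
    by (simp_all add: Z_def)
  have Zs: "square_supported k (Z n)" for n
  proof (cases n)
    case (Suc m)
    then show ?thesis using B(4) by (auto simp: ZS square_supported_def sq_mult_def)
  qed (simp add: Z0 square_supported_def)
  have Zt: "Z n i j = Z n j i" for n i j
  proof (induction n arbitrary: i j)
    case (Suc n)
    have "sq_mult k (Z n) (Z n) i j = sq_mult k (Z n) (Z n) j i"
      by (simp add: sq_mult_def) (metis (no_types, lifting) Suc.IH mult.commute sum.cong)
    then show ?case using B(5) by (simp add: ZS)
  qed (simp add: Z0)
  have half: "row_sums_le k (\<lambda>i j. (A i j + A' i j) / 2) ((a + a') / 2)"
    if "row_sums_le k A a" "row_sums_le k A' a'" for A A' a a'
    unfolding row_sums_le_def
  proof (intro allI impI)
    fix i assume i: "i < k"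
    have "(\<Sum>j<k. \<bar>(A i j + A' i j) / 2\<bar>) \<le> (\<Sum>j<k. (\<bar>A i j\<bar> + \<bar>A' i j\<bar>) / 2)"
      by (intro sum_mono) auto
    also have "\<dots> = ((\<Sum>j<k. \<bar>A i j\<bar>) + (\<Sum>j<k. \<bar>A' i j\<bar>)) / 2"
      by (simp add: sum_divide_distrib[symmetric] sum.distrib)
    also have "\<dots> \<le> (a + a') / 2"
      using that i unfolding row_sums_le_def by (intro divide_right_mono add_mono) auto
    finally show "(\<Sum>j<k. \<bar>(A i j + A' i j) / 2\<bar>) \<le> (a + a') / 2" .
  qed
  have Zy: "row_sums_le k (Z n) y" for n
  proof (induction n)
    case (Suc n)
    show ?case using half[OF B(1) row_sums_le_mult[OF Suc Suc]] by (simp add: ZS yy)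
  qed (use y in \<open>simp add: Z0 row_sums_le_def\<close>)
  define D where "D n = (\<lambda>i j. Z (Suc n) i j - Z n i j)" for n
  have Dy: "row_sums_le k (D n) (y ^ n)" for n
  proof (induction n)
    case 0
    have "D 0 = (\<lambda>i j. B i j / 2)" by (intro ext) (simp add: D_def ZS Z0 sq_mult_def)
    moreover have "(\<Sum>j<k. \<bar>B i j / 2\<bar>) \<le> 1" if "i < k" for i
    proof -
      have "(\<Sum>j<k. \<bar>B i j / 2\<bar>) = (\<Sum>j<k. \<bar>B i j\<bar>) / 2"
        by (simp add: sum_divide_distrib)
      moreover have "(\<Sum>j<k. \<bar>B i j\<bar>) \<le> \<rho>" using B(1) that by (simp add: row_sums_le_def)
      ultimately show ?thesis using B(3) by linarith
    qed
    ultimately show ?case by (auto simp: row_sums_le_def)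
  next
    case (Suc n)
    \<comment> \<open>The difference of two squares is split without commuting factors. Both
      iterates lie in the ball of radius y, so each step shrinks the difference by the factor
      y.\<close>
    have eq: "D (Suc n) = (\<lambda>i j. (sq_mult k (Z (Suc n)) (D n) i j + sq_mult k (D n) (Z n) i j) / 2)"
    proof (intro ext)
      fix i j
      have "(\<Sum>l<k. Z (Suc n) i l * Z (Suc n) l j) - (\<Sum>l<k. Z n i l * Z n l j) =
        (\<Sum>l<k. Z (Suc n) i l * D n l j) + (\<Sum>l<k. D n i l * Z n l j)"
        unfolding sum_subtractf[symmetric] sum.distrib[symmetric]
        by (intro sum.cong) (auto simp: D_def algebra_simps)
      then have "sq_mult k (Z (Suc n)) (Z (Suc n)) i j - sq_mult k (Z n) (Z n) i j =
        sq_mult k (Z (Suc n)) (D n) i j + sq_mult k (D n) (Z n) i j" by (simp add: sq_mult_def)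
      moreover have "D (Suc n) i j = (sq_mult k (Z (Suc n)) (Z (Suc n)) i j - sq_mult k (Z n) (Z n) i j) / 2"
        unfolding D_def ZS[of "Suc n"] by (subst (3) ZS) (simp add: diff_divide_distrib add_divide_distrib)
      ultimately show "D (Suc n) i j = (sq_mult k (Z (Suc n)) (D n) i j + sq_mult k (D n) (Z n) i j) / 2"
        by simp
    qed
    show ?case unfolding eq
      using half[OF row_sums_le_mult[OF Zy Suc] row_sums_le_mult[OF Suc Zy], of "Suc n" n] by (simp add: mult.commute)
  qed
  have D_le: "\<bar>D n i j\<bar> \<le> y ^ n" for n i j
  proof (cases "i < k \<and> j < k")
    case True
    then have "\<bar>D n i j\<bar> \<le> (\<Sum>j<k. \<bar>D n i j\<bar>)" by (intro member_le_sum) auto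
    then show ?thesis using Dy[of n] True by (force simp: row_sums_le_def)
  next
    case False
    then show ?thesis using Zs y unfolding D_def square_supported_def by (auto simp: not_less)
  qed
  have "\<exists>l. (\<lambda>n. Z n i j) \<longlonglongrightarrow> l" for i j
  proof -
    have "summable (\<lambda>n. D n i j)"
      by (rule summable_comparison_test'[of "\<lambda>n. y ^ n" 0]) (use y D_le in \<open>auto intro: summable_geometric\<close>)
    then obtain l where "(\<lambda>n. \<Sum>m<n. D m i j) \<longlonglongrightarrow> l" using summable_LIMSEQ by blast
    moreover have "(\<Sum>m<n. D m i j) = Z n i j" for n
      unfolding D_def by (subst sum_lessThan_telescope) (simp add: Z0)
    ultimately show ?thesis by auto
  qed
  then obtain Y where Y: "\<And>i j. (\<lambda>n. Z n i j) \<longlonglongrightarrow> Y i j" by metis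
  show ?thesis
  proof (rule that[of Y y])
    show "square_supported k Y"
      unfolding square_supported_def
    proof (intro allI impI)
      fix i j assume "k \<le> i \<or> k \<le> j"
      then have "Z n i j = 0" for n using Zs unfolding square_supported_def by blast
      then show "Y i j = 0" using Y[of i j] by (simp add: LIMSEQ_const_iff)
    qed
    show "Y i j = Y j i" for i j
    proof (rule LIMSEQ_unique[OF Y[of i j]])
      show "(\<lambda>n. Z n i j) \<longlonglongrightarrow> Y j i" by (subst Zt) (rule Y)
    qed
    show "row_sums_le k Y y" unfolding row_sums_le_def
    proof (intro allI impI)
      fix i assume "i < k"
      then show "(\<Sum>j<k. \<bar>Y i j\<bar>) \<le> y" using Zy
        by (intro LIMSEQ_le_const2[of "\<lambda>n. \<Sum>j<k. \<bar>Z n i j\<bar>"] tendsto_sum tendsto_rabs Y)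
          (auto simp: row_sums_le_def)
    qed
    show "Y i j = (B i j + sq_mult k Y Y i j) / 2" for i j
    proof (rule LIMSEQ_unique)
      show "(\<lambda>n. Z (Suc n) i j) \<longlonglongrightarrow> Y i j" using Y by (rule LIMSEQ_Suc)
      have "(\<lambda>n. sq_mult k (Z n) (Z n) i j) \<longlonglongrightarrow> sq_mult k Y Y i j"
        by (cases "i < k \<and> j < k") (auto simp: sq_mult_def intro!: tendsto_sum tendsto_mult Y)
      then show "(\<lambda>n. Z (Suc n) i j) \<longlonglongrightarrow> (B i j + sq_mult k Y Y i j) / 2"
        unfolding ZS by (intro tendsto_intros) auto
    qed
  qed (use y in auto)
qed

section \<open>Uniqueness of positive definite square roots and the value of
  \<open>inv_sqrt_mat\<close>\<close>

definition pos_def :: "nat \<Rightarrow> (nat \<Rightarrow> nat \<Rightarrow> real) \<Rightarrow> bool" where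
  "pos_def k M \<longleftrightarrow> (\<forall>x. (\<exists>i<k. x i \<noteq> 0) \<longrightarrow> (\<Sum>i<k. \<Sum>j<k. x i * M i j * x j) > 0)"

text \<open>With D = M - N, equality of the squares reads M D + D N = 0. Multiplying by the
  transpose of D and taking the trace gives the quadratic forms of M at the columns of D plus those
  of N at the rows of D; a nonzero column makes this positive.\<close>

lemma pos_def_square_root_unique:
  assumes M: "square_supported k M" "\<And>i j. M i j = M j i" "pos_def k M"
    and N: "square_supported k N" "\<And>i j. N i j = N j i" "pos_def k N"
    and eq: "sq_mult k M M = sq_mult k N N"
  shows "M = N"
proof (rule ccontr)
  assume "M \<noteq> N"
  define D where "D = (\<lambda>i j. M i j - N i j)"
  obtain i0 j0 where 0: "D i0 j0 \<noteq> 0" using \<open>M \<noteq> N\<close> by (auto simp: D_def fun_eq_iff)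
  then have lt: "i0 < k" "j0 < k" using M(1) N(1) unfolding D_def square_supported_def
    by (metis diff_self not_less)+
  have nonneg: "0 \<le> (\<Sum>i<k. \<Sum>j<k. x i * P i j * x j)" if "pos_def k P" for P x
  proof (cases "\<exists>i<k. x i \<noteq> 0")
    case True
    then show ?thesis using that unfolding pos_def_def by (meson less_imp_le)
  qed simp
  have comm: "(\<Sum>l<k. M i l * D l j) + (\<Sum>l<k. D i l * N l j) = 0" if "i < k" "j < k" for i j
  proof -
    have "(\<Sum>l<k. M i l * D l j) + (\<Sum>l<k. D i l * N l j) = sq_mult k M M i j - sq_mult k N N i j"
      using that unfolding sq_mult_def by (simp add: D_def algebra_simps sum.distrib sum_subtractf)
    then show ?thesis using eq by simp
  qed
  have "0 = (\<Sum>i<k. \<Sum>j<k. D i j * ((\<Sum>l<k. M i l * D l j) + (\<Sum>l<k. D i l * N l j)))"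
    using comm by simp
  also have "\<dots> = (\<Sum>i<k. \<Sum>j<k. \<Sum>l<k. D i j * M i l * D l j) + (\<Sum>i<k. \<Sum>j<k. \<Sum>l<k. D i j * N j l * D i l)"
    unfolding sum.distrib[symmetric] distrib_left sum_distrib_left
    by (intro sum.cong) (auto simp: mult_ac N(2))
  also have "(\<Sum>i<k. \<Sum>j<k. \<Sum>l<k. D i j * M i l * D l j) = (\<Sum>j<k. \<Sum>i<k. \<Sum>l<k. D i j * M i l * D l j)"
    by (rule sum.swap)
  also have "0 < \<dots> + (\<Sum>i<k. \<Sum>j<k. \<Sum>l<k. D i j * N j l * D i l)"
  proof (rule add_pos_nonneg)
    show "0 < (\<Sum>j<k. \<Sum>i<k. \<Sum>l<k. D i j * M i l * D l j)"
    proof (rule sum_pos2[of _ j0])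
      show "0 < (\<Sum>i<k. \<Sum>l<k. D i j0 * M i l * D l j0)"
        using M(3)[unfolded pos_def_def, rule_format, of "\<lambda>i. D i j0"] 0 lt by blast
    qed (use lt nonneg[OF M(3)] in auto)
    show "0 \<le> (\<Sum>i<k. \<Sum>j<k. \<Sum>l<k. D i j * N j l * D i l)"
      by (intro sum_nonneg nonneg[OF N(3)])
  qed
  finally show False by simp
qed

text \<open>The right inverse P cancels S, so every matrix meeting the description in
  \<open>inv_sqrt_mat\<close> has square P, and positive definite square roots are unique.\<close>

lemma inv_sqrt_mat_eqI:
  assumes M: "square_supported k M" "\<And>i j. M i j = M j i" "pos_def k M" "sq_mult k (sq_mult k M M) S = sq_id k"
    and P: "sq_mult k S P = sq_id k" "square_supported k P"
  shows "inv_sqrt_mat k S = M"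
  unfolding inv_sqrt_mat_def
proof (rule the_equality)
  have eq: "(\<Sum>l<k. \<Sum>m<k. N i l * N l m * S m j) = sq_mult k (sq_mult k N N) S i j" if "i < k" "j < k" for N i j
    unfolding sq_mult_assoc using that by (simp add: sq_mult_def sum_distrib_left mult.assoc)
  show "(\<forall>i j. k \<le> i \<or> k \<le> j \<longrightarrow> M i j = 0) \<and> (\<forall>i<k. \<forall>j<k. M i j = M j i) \<and>
    (\<forall>x. (\<exists>i<k. x i \<noteq> 0) \<longrightarrow> 0 < (\<Sum>i<k. \<Sum>j<k. x i * M i j * x j)) \<and>
    (\<forall>i<k. \<forall>j<k. (\<Sum>l<k. \<Sum>m<k. M i l * M l m * S m j) = (if i = j then 1 else 0))"
    using M eq unfolding square_supported_def pos_def_def by (auto simp: sq_id_def)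
  fix N
  assume N: "(\<forall>i j. k \<le> i \<or> k \<le> j \<longrightarrow> N i j = 0) \<and> (\<forall>i<k. \<forall>j<k. N i j = N j i) \<and>
    (\<forall>x. (\<exists>i<k. x i \<noteq> 0) \<longrightarrow> 0 < (\<Sum>i<k. \<Sum>j<k. x i * N i j * x j)) \<and>
    (\<forall>i<k. \<forall>j<k. (\<Sum>l<k. \<Sum>m<k. N i l * N l m * S m j) = (if i = j then 1 else 0))"
  then have N1: "square_supported k N" "pos_def k N" by (auto simp: square_supported_def pos_def_def)
  have N2: "N i j = N j i" for i j
    using N by (cases "i < k \<and> j < k") (auto simp: not_less)
  have N3: "sq_mult k (sq_mult k N N) S = sq_id k"
  proof (intro ext)
    fix i j show "sq_mult k (sq_mult k N N) S i j = sq_id k i j"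
      using N eq[of i j N] by (cases "i < k \<and> j < k") (auto simp: sq_id_def sq_mult_def)
  qed
  have *: "sq_mult k A A = P" if "sq_mult k (sq_mult k A A) S = sq_id k" for A
  proof -
    have "square_supported k (sq_mult k A A)" by (auto simp: square_supported_def sq_mult_def)
    then have "sq_mult k A A = sq_mult k (sq_mult k A A) (sq_mult k S P)" using P sq_mult_id(2) by simp
    also have "\<dots> = P" unfolding sq_mult_assoc[symmetric] that using P sq_mult_id(1) by simp
    finally show ?thesis .
  qed
  show "N = M"
    by (rule pos_def_square_root_unique) (use N1 N2 M *[OF N3] *[OF M(4)] in auto)
qed

text \<open>By the Sherman-Morrison formula the inverse of \<open>diag (1 / v) + c\<close> is
  \<open>diag v - c / (1 + c \<Sum>v) v v\<^sup>T\<close>, which is diagonally dominant.\<close>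

lemma inv_sqrt_mat_diag_plus_const:
  fixes v :: "nat \<Rightarrow> real" and c :: real
  assumes S: "\<And>i j. i < k \<Longrightarrow> j < k \<Longrightarrow> S i j = (if i = j then 1 / v i else 0) + c"
    and v: "\<And>i. i < k \<Longrightarrow> 0 < v i" and c: "0 < c" and k: "0 < k"
  defines "M \<equiv> inv_sqrt_mat k S"
  shows "\<And>i j. M i j = M j i"
    and "\<And>t. (\<Sum>i<k. (\<Sum>j<k. M i j * t j)^2 / v i) + c * (\<Sum>i<k. \<Sum>j<k. M i j * t j)^2 = (\<Sum>i<k. (t i)^2)"
proof -
  define V where "V = (\<Sum>i<k. v i)"
  have V: "0 \<le> V" unfolding V_def using v by (intro sum_nonneg) (auto intro: less_imp_le)
  have cV: "0 < 1 + c * V" using c V by (simp add: add_pos_nonneg)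
  define \<kappa> where "\<kappa> = c / (1 + c * V)"
  have \<kappa>: "0 < \<kappa>" using c cV by (simp add: \<kappa>_def)
  have \<kappa>V: "1 - \<kappa> * V = 1 / (1 + c * V)" using cV by (simp add: \<kappa>_def field_simps)
  define P where "P = (\<lambda>i j. if i < k \<and> j < k then (if i = j then v i else 0) - \<kappa> * v i * v j else 0)"
  have P: "square_supported k P" by (auto simp: P_def square_supported_def)
  \<comment> \<open>This scaling gives s * v i <= 1, so B = I - s * P has nonnegative entries and
    its norm is a plain row sum.\<close>
  define s where "s = 1 / (1 + V)"
  have s: "0 < s" using V by (simp add: s_def)
  define B where "B = (\<lambda>i j. sq_id k i j - s * P i j)"
  have Bs: "square_supported k B" using P by (auto simp: B_def square_supported_def sq_id_def)
  have Bt: "B i j = B j i" for i j by (auto simp: B_def P_def sq_id_def)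
  have v_le: "s * v i \<le> 1" if "i < k" for i
  proof -
    have "v i \<le> V" unfolding V_def using that v by (intro member_le_sum) (auto intro: less_imp_le)
    then show ?thesis using V by (simp add: s_def)
  qed
  have Bnn: "0 \<le> B i j" if "i < k" "j < k" for i j
  proof -
    have "0 \<le> s * (\<kappa> * v i * v j)" using s \<kappa> v that by (intro mult_nonneg_nonneg) (auto intro: less_imp_le)
    then show ?thesis using v_le[OF that(1)] that by (auto simp: B_def P_def sq_id_def right_diff_distrib)
  qed
  \<comment> \<open>Row i of B sums to 1 - s * v i / (1 + c * V); the smallest v i gives a bound
    below 1 for all rows.\<close>
  define m where "m = Min (v ` {..<k})"
  have m: "0 < m" "\<And>i. i < k \<Longrightarrow> m \<le> v i" using v k by (auto simp: m_def Min_gr_iff lessThan_empty_iff)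
  define \<rho> where "\<rho> = 1 - s * m / (1 + c * V)"
  have B\<rho>: "row_sums_le k B \<rho>" unfolding row_sums_le_def
  proof (intro allI impI)
    fix i assume i: "i < k"
    have "(\<Sum>j<k. \<bar>B i j\<bar>) = (\<Sum>j<k. B i j)"
      using Bnn i by (intro sum.cong) auto
    also have "\<dots> = (\<Sum>j<k. (if j = i then 1 - s * v i else 0) + s * \<kappa> * v i * v j)"
      using Bnn i by (intro sum.cong) (auto simp: B_def P_def sq_id_def algebra_simps)
    also have "\<dots> = 1 - s * v i + s * \<kappa> * v i * V"
      using i by (simp add: sum.distrib V_def sum_distrib_left)
    also have "\<dots> = 1 - s * v i * (1 - \<kappa> * V)" by (simp add: algebra_simps)
    also have "\<dots> \<le> \<rho>" unfolding \<kappa>V \<rho>_def using m(2)[OF i] s cV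
      by (simp add: divide_right_mono)
    finally show "(\<Sum>j<k. \<bar>B i j\<bar>) \<le> \<rho>" .
  qed
  have \<rho>: "\<rho> < 1" using s m cV by (simp add: \<rho>_def)
  have \<rho>0: "0 \<le> \<rho>"
  proof -
    have "0 \<le> (\<Sum>j<k. \<bar>B 0 j\<bar>)" by (simp add: sum_nonneg)
    also have "\<dots> \<le> \<rho>" using B\<rho> k unfolding row_sums_le_def by simp
    finally show ?thesis .
  qed
  obtain Y y where Y: "square_supported k Y" "\<And>i j. Y i j = Y j i" "row_sums_le k Y y" "y < 1"
    "\<And>i j. Y i j = (B i j + sq_mult k Y Y i j) / 2"
    using matrix_square_root_fixed_point[OF B\<rho> \<rho>0 \<rho> Bs Bt] by metis
  \<comment> \<open>The fixed point equation for Y says (I - Y)^2 = I - B = s * P, so R is a square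
    root of P.\<close>
  define R where "R = (\<lambda>i j. (sq_id k i j - Y i j) / sqrt s)"
  have Rs: "square_supported k R" using Y(1) by (auto simp: R_def square_supported_def sq_id_def)
  have Rt: "R i j = R j i" for i j using Y(2) by (auto simp: R_def sq_id_def)
  have RR: "sq_mult k R R = P"
  proof (intro ext)
    fix i j
    show "sq_mult k R R i j = P i j"
    proof (cases "i < k \<and> j < k")
      case True
      have *: "sq_mult k (sq_id k) Y i j = Y i j" "sq_mult k Y (sq_id k) i j = Y i j" "sq_mult k (sq_id k) (sq_id k) i j = sq_id k i j"
        using sq_mult_id[OF Y(1)] sq_mult_id(1)[of k "sq_id k"] by (auto simp: square_supported_def sq_id_def)
      have "sq_mult k R R i j = (\<Sum>l<k. (sq_id k i l - Y i l) * (sq_id k l j - Y l j)) / s"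
        using True s by (simp add: sq_mult_def R_def sum_divide_distrib)
      also have "(\<Sum>l<k. (sq_id k i l - Y i l) * (sq_id k l j - Y l j)) =
          sq_mult k (sq_id k) (sq_id k) i j - sq_mult k (sq_id k) Y i j - sq_mult k Y (sq_id k) i j + sq_mult k Y Y i j"
        using True by (simp add: sq_mult_def algebra_simps sum.distrib sum_subtractf)
      also have "\<dots> = sq_id k i j - B i j" using Y(5)[of i j] by (simp add: *)
      finally show ?thesis using s by (simp add: B_def)
    qed (auto simp: sq_mult_def P_def)
  qed
  have Rp: "pos_def k R" unfolding pos_def_def
  proof (intro allI impI)
    fix x :: "nat \<Rightarrow> real" assume "\<exists>i<k. x i \<noteq> 0"
    then obtain i0 where i0: "i0 < k" "x i0 \<noteq> 0" by auto
    \<comment> \<open>For symmetric Y with absolute row sums at most y < 1, the inequality of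
      arithmetic and geometric means bounds the quadratic form by y times the squared norm of x, so
      I - Y is positive definite.\<close>
    have "(\<Sum>i<k. \<Sum>j<k. x i * Y i j * x j) \<le> (\<Sum>i<k. \<Sum>j<k. \<bar>Y i j\<bar> * (x i)^2 / 2 + \<bar>Y i j\<bar> * (x j)^2 / 2)"
    proof (intro sum_mono)
      fix i j
      have "x i * Y i j * x j \<le> \<bar>Y i j\<bar> * (\<bar>x i\<bar> * \<bar>x j\<bar>)"
        by (metis abs_ge_self abs_mult mult.assoc mult.commute)
      also have "\<bar>x i\<bar> * \<bar>x j\<bar> \<le> (x i)^2 / 2 + (x j)^2 / 2"
        using sum_squares_bound[of "\<bar>x i\<bar>" "\<bar>x j\<bar>"] by simp
      finally show "x i * Y i j * x j \<le> \<bar>Y i j\<bar> * (x i)^2 / 2 + \<bar>Y i j\<bar> * (x j)^2 / 2"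
        by (simp add: distrib_left mult_left_mono)
    qed
    also have "\<dots> = (\<Sum>i<k. \<Sum>j<k. \<bar>Y i j\<bar> * (x i)^2 / 2) + (\<Sum>j<k. \<Sum>i<k. \<bar>Y i j\<bar> * (x j)^2 / 2)"
      unfolding sum.distrib by (subst (2) sum.swap) simp
    also have "(\<Sum>j<k. \<Sum>i<k. \<bar>Y i j\<bar> * (x j)^2 / 2) = (\<Sum>i<k. \<Sum>j<k. \<bar>Y i j\<bar> * (x i)^2 / 2)"
      by (intro sum.cong) (auto simp: Y(2))
    also have "(\<Sum>i<k. \<Sum>j<k. \<bar>Y i j\<bar> * (x i)^2 / 2) + (\<Sum>i<k. \<Sum>j<k. \<bar>Y i j\<bar> * (x i)^2 / 2)
      = (\<Sum>i<k. (\<Sum>j<k. \<bar>Y i j\<bar>) * (x i)^2)"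
      unfolding sum.distrib[symmetric] sum_distrib_right by (intro sum.cong) auto
    also have "\<dots> \<le> (\<Sum>i<k. y * (x i)^2)"
      using Y(3) by (intro sum_mono mult_right_mono) (auto simp: row_sums_le_def)
    also have "\<dots> < (\<Sum>i<k. (x i)^2)"
    proof (rule sum_strict_mono_ex1)
      show "\<forall>i\<in>{..<k}. y * (x i)^2 \<le> (x i)^2" using Y(4) by (auto intro: mult_left_le_one_le mult_right_mono[of y 1, simplified])
      show "\<exists>i\<in>{..<k}. y * (x i)^2 < (x i)^2"
        using i0 Y(4) by (intro bexI[of _ i0]) auto
    qed simp
    finally have "0 < (\<Sum>i<k. (x i)^2) - (\<Sum>i<k. \<Sum>j<k. x i * Y i j * x j)" by simp
    also have "(\<Sum>i<k. (x i)^2) = (\<Sum>i<k. \<Sum>j<k. x i * sq_id k i j * x j)"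
    proof (intro sum.cong refl)
      fix i assume "i \<in> {..<k}"
      then have "(\<Sum>j<k. x i * sq_id k i j * x j) = (\<Sum>j<k. if j = i then x i * x j else 0)"
        by (intro sum.cong) (auto simp: sq_id_def)
      then show "(x i)^2 = (\<Sum>j<k. x i * sq_id k i j * x j)"
        using \<open>i \<in> {..<k}\<close> by (simp add: power2_eq_square)
    qed
    also have "\<dots> - (\<Sum>i<k. \<Sum>j<k. x i * Y i j * x j) = sqrt s * (\<Sum>i<k. \<Sum>j<k. x i * R i j * x j)"
      unfolding sum_subtractf[symmetric] sum_distrib_left
      using s by (intro sum.cong) (auto simp: R_def field_simps)
    finally show "0 < (\<Sum>i<k. \<Sum>j<k. x i * R i j * x j)" using s by (simp add: zero_less_mult_iff)
  qed
  have PS: "sq_mult k P S = sq_id k"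
  proof (intro ext)
    fix i j
    show "sq_mult k P S i j = sq_id k i j"
    proof (cases "i < k \<and> j < k")
      case True
      have "sq_mult k P S i j = (\<Sum>l<k. (if l = i then v i * S i j else 0) - (if l = j then \<kappa> * v i else 0) - \<kappa> * c * v i * v l)"
        unfolding sq_mult_def using True by (auto intro!: sum.cong simp: P_def S v less_imp_neq[OF v, symmetric] algebra_simps)
      also have "\<dots> = v i * S i j - \<kappa> * v i - \<kappa> * c * v i * V"
        using True by (simp add: sum_subtractf V_def sum_distrib_left)
      also have "\<dots> = v i * S i j - v i * (\<kappa> * (1 + c * V))" by (simp add: algebra_simps)
      also have "\<kappa> * (1 + c * V) = c" using cV by (simp add: \<kappa>_def)
      finally show ?thesis using True v[of i] by (auto simp: S sq_id_def algebra_simps)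
    qed (auto simp: sq_mult_def sq_id_def)
  qed
  have SP: "sq_mult k S P = sq_id k"
  proof (intro ext)
    fix i j
    have "sq_mult k S P i j = sq_mult k P S j i"
      unfolding sq_mult_def by (auto intro!: sum.cong simp: P_def S)
    then show "sq_mult k S P i j = sq_id k i j" unfolding PS by (auto simp: sq_id_def)
  qed
  have MR: "M = R" unfolding M_def
    by (rule inv_sqrt_mat_eqI[OF Rs Rt Rp _ SP P]) (simp add: RR PS)
  show Mt: "M i j = M j i" for i j using Rt by (simp add: MR)
  have RSR: "sq_mult k R (sq_mult k S R) = sq_id k"
  proof -
    \<comment> \<open>S is arbitrary outside the block, hence the truncation S'. As P = R^2 commutes
      with R, so does its inverse, and R S R = R^2 S = I.\<close>
    define S' where "S' = sq_mult k (sq_id k) S"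
    have S's: "square_supported k S'" by (simp add: S'_def sq_mult_def square_supported_def)
    have S': "sq_mult k A S' = sq_mult k A S" "sq_mult k S' A = sq_mult k S A" for A
    proof -
      have "S' i j = S i j" if "i < k" "j < k" for i j
      proof -
        have "(\<Sum>l<k. sq_id k i l * S l j) = (\<Sum>l<k. if l = i then S l j else 0)"
          using that by (intro sum.cong) (auto simp: sq_id_def)
        then show ?thesis using that by (simp add: S'_def sq_mult_def)
      qed
      then show "sq_mult k A S' = sq_mult k A S" "sq_mult k S' A = sq_mult k S A"
        by (auto simp: sq_mult_def intro!: ext sum.cong)
    qed
    have RP: "sq_mult k R P = sq_mult k P R" unfolding RR[symmetric] sq_mult_assoc ..
    have "sq_mult k S R = sq_mult k (sq_mult k S R) (sq_mult k P S')" using Rs PS S' sq_mult_id(2)[of k "sq_mult k S R"]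
      by (simp add: square_supported_def sq_mult_def)
    also have "\<dots> = sq_mult k S (sq_mult k (sq_mult k R P) S')" by (simp add: sq_mult_assoc)
    also have "\<dots> = sq_mult k (sq_mult k S P) (sq_mult k R S')" unfolding RP by (simp add: sq_mult_assoc)
    also have "\<dots> = sq_mult k R S'" unfolding SP
      by (rule sq_mult_id(1)) (simp add: square_supported_def sq_mult_def)
    finally have "sq_mult k R (sq_mult k S R) = sq_mult k (sq_mult k R R) S'" by (simp add: sq_mult_assoc)
    then show ?thesis unfolding RR S' PS .
  qed
  show "(\<Sum>i<k. (\<Sum>j<k. M i j * t j)^2 / v i) + c * (\<Sum>i<k. \<Sum>j<k. M i j * t j)^2 = (\<Sum>i<k. (t i)^2)" for t
  proof -
    \<comment> \<open>The claim is the quadratic form of S at u = R t, evaluated with R S R =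
      I.\<close>
    define u where "u i = (\<Sum>j<k. R i j * t j)" for i
    have "(\<Sum>i<k. (u i)^2 / v i) + c * (\<Sum>i<k. u i)^2 = (\<Sum>i<k. u i * (u i / v i + c * (\<Sum>j<k. u j)))"
    proof -
      have "c * (\<Sum>i<k. u i)^2 = (\<Sum>i<k. u i * (c * (\<Sum>j<k. u j)))"
        unfolding sum_distrib_right[symmetric] by (simp add: power2_eq_square)
      then show ?thesis by (simp add: distrib_left sum.distrib power2_eq_square)
    qed
    also have "\<dots> = (\<Sum>i<k. u i * (\<Sum>l<k. S i l * u l))"
    proof (intro sum.cong refl arg_cong2[where f = "(*)"])
      fix i assume i: "i \<in> {..<k}"
      have "(\<Sum>l<k. S i l * u l) = (\<Sum>l<k. (if l = i then u i / v i else 0) + c * u l)"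
        using i by (intro sum.cong) (auto simp: S algebra_simps)
      then show "u i / v i + c * (\<Sum>j<k. u j) = (\<Sum>l<k. S i l * u l)"
        using i by (simp add: sum.distrib sum_distrib_left)
    qed
    also have "\<dots> = (\<Sum>i<k. \<Sum>j<k. R i j * t j * (\<Sum>l<k. S i l * (\<Sum>m<k. R l m * t m)))"
      by (simp add: u_def sum_distrib_right)
    also have "\<dots> = (\<Sum>j<k. \<Sum>i<k. R i j * t j * (\<Sum>l<k. S i l * (\<Sum>m<k. R l m * t m)))"
      by (rule sum.swap)
    also have "\<dots> = (\<Sum>j<k. t j * (\<Sum>i<k. R j i * (\<Sum>m<k. sq_mult k S R i m * t m)))"
    proof (intro sum.cong refl)
      fix j
      have "(\<Sum>l<k. S i l * (\<Sum>m<k. R l m * t m)) = (\<Sum>m<k. sq_mult k S R i m * t m)" if "i < k" for i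
        unfolding sum_distrib_left using that
        by (subst sum.swap) (simp add: sq_mult_def sum_distrib_left sum_distrib_right mult_ac)
      then show "(\<Sum>i<k. R i j * t j * (\<Sum>l<k. S i l * (\<Sum>m<k. R l m * t m))) =
          t j * (\<Sum>i<k. R j i * (\<Sum>m<k. sq_mult k S R i m * t m))"
        unfolding sum_distrib_left[of "t j"] by (intro sum.cong) (auto simp: Rt[of _ j])
    qed
    also have "\<dots> = (\<Sum>j<k. t j * (\<Sum>m<k. sq_mult k R (sq_mult k S R) j m * t m))"
    proof (rule sum.cong[OF refl], rule arg_cong2[where f = "(*)", OF refl])
      fix j assume j: "j \<in> {..<k}"
      show "(\<Sum>i<k. R j i * (\<Sum>m<k. sq_mult k S R i m * t m)) = (\<Sum>m<k. sq_mult k R (sq_mult k S R) j m * t m)"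
        unfolding sum_distrib_left using j
        by (subst sum.swap) (simp add: sq_mult_def[of k R] sum_distrib_left sum_distrib_right mult_ac)
    qed
    also have "\<dots> = (\<Sum>j<k. (t j)^2)"
    proof (intro sum.cong refl)
      fix j assume j: "j \<in> {..<k}"
      have "(\<Sum>m<k. sq_id k j m * t m) = (\<Sum>m<k. if m = j then t m else 0)"
        using j by (intro sum.cong) (auto simp: sq_id_def)
      then show "t j * (\<Sum>m<k. sq_mult k R (sq_mult k S R) j m * t m) = (t j)^2"
        unfolding RSR using j by (simp add: power2_eq_square)
    qed
    finally show ?thesis unfolding MR u_def .
  qed
qed

section \<open>Sums of independent exponential variables\<close>

abbreviation exp_law :: "real \<Rightarrow> real measure" where
  "exp_law l \<equiv> density lborel (exponential_density l)"

section \<open>Transforms of the exponential law and of finite products of such laws\<close>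

lemma exponential_density_has_integral_1:
  assumes "0 < l"
  shows "integrable lborel (exponential_density l)" "(\<integral>x. exponential_density l x \<partial>lborel) = 1"
proof -
  interpret prob_space "exp_law l" using assms by (rule prob_space_exponential_density)
  have d: "integrable (exp_law l) (\<lambda>_. 1::real)" "(\<integral>x. 1 \<partial>exp_law l) = (1::real)"
    using prob_space by simp_all
  show "integrable lborel (exponential_density l)"
    using d(1) exponential_density_nonneg[OF assms] by (subst (asm) integrable_density) auto
  show "(\<integral>x. exponential_density l x \<partial>lborel) = 1"
    using d(2) exponential_density_nonneg[OF assms] by (subst (asm) integral_density) auto
qed

lemma exponential_mgf:
  assumes "0 < l" "s < l"
  shows "integrable (exp_law l) (\<lambda>x. exp (s * x))" "(\<integral>x. exp (s * x) \<partial>exp_law l) = l / (l - s)"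
proof -
  have eq: "exponential_density l x * exp (s * x) = l / (l - s) * exponential_density (l - s) x" for x
  proof -
    have "exp (- x * l) * exp (s * x) = exp (- x * (l - s))" by (simp add: mult_exp_exp algebra_simps)
    then show ?thesis using assms by (auto simp: exponential_density_def mult.assoc)
  qed
  have nn: "AE x in lborel. 0 \<le> exponential_density l x"
    using exponential_density_nonneg[OF assms(1)] by simp
  note int = exponential_density_has_integral_1[of "l - s"]
  show "integrable (exp_law l) (\<lambda>x. exp (s * x))"
    using nn int assms by (subst integrable_density) (auto simp: eq)
  show "(\<integral>x. exp (s * x) \<partial>exp_law l) = l / (l - s)"
    using nn int assms by (subst integral_density) (auto simp: eq)
qed

text \<open>Tilting by an imaginary exponent leaves no probability density to compare with, so the
  integral over the half line comes from the antiderivative F, which vanishes at infinity because Re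
  z = l > 0.\<close>

lemma exponential_char:
  assumes l: "0 < l"
  shows "(\<integral>x. iexp (s * x) \<partial>exp_law l) = 1 / (1 - \<i> * (s / l))"
proof -
  define z where "z = complex_of_real l - \<i> * s"
  have z: "z \<noteq> 0" using l by (auto simp: z_def complex_eq_iff)
  define f where "f x = l * exp (- z * complex_of_real x)" for x
  define F where "F x = - (l / z) * exp (- z * complex_of_real x)" for x
  have Re_z: "Re z = l" by (simp add: z_def)
  have eq: "exponential_density l x *\<^sub>R iexp (s * x) = indicator {0..} x *\<^sub>R f x" for x
    unfolding f_def
    by (auto simp: exponential_density_def z_def indicator_def scaleR_conv_of_real exp_of_real[symmetric]
        mult_exp_exp algebra_simps)
  have "(\<integral>x. iexp (s * x) \<partial>exp_law l) = (\<integral>x. exponential_density l x *\<^sub>R iexp (s * x) \<partial>lborel)"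
    using exponential_density_nonneg[OF l] by (subst integral_density) auto
  also have "\<dots> = (\<integral>x. indicator {0..} x *\<^sub>R f x \<partial>lborel)" unfolding eq ..
  also have "\<dots> = (\<integral>x. indicator {0<..} x *\<^sub>R f x \<partial>lborel)"
  proof (rule integral_cong_AE)
    show "AE x in lborel. indicator {0..} x *\<^sub>R f x = indicator {0<..} x *\<^sub>R f x"
      using AE_lborel_singleton[of "0::real"] by eventually_elim (auto simp: indicator_def)
  qed (auto simp: f_def)
  also have "\<dots> = (LBINT x=0..\<infinity>. f x)"
    by (simp add: interval_lebesgue_integral_0_infty set_lebesgue_integral_def)
  also have "\<dots> = 0 - (- (l / z))"
  proof (rule interval_integral_FTC_integrable)
    show "(F has_vector_derivative f x) (at x)" for x
      unfolding F_def f_def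
      by (rule has_vector_derivative_real_field[where f = "\<lambda>w. - (l / z) * exp (- z * w)"])
        (use z in \<open>auto intro!: derivative_eq_intros\<close>)
    show "isCont f x" for x unfolding f_def by (intro continuous_intros)
    show "set_integrable lborel (einterval 0 \<infinity>) f"
      unfolding set_integrable_def
    proof (rule Bochner_Integration.integrable_bound)
      show "integrable lborel (exponential_density l)" using exponential_density_has_integral_1[OF l] by simp
      show "(\<lambda>x. indicator (einterval 0 \<infinity>) x *\<^sub>R f x) \<in> borel_measurable lborel"
        by (simp add: f_def einterval_def)
      show "AE x in lborel. norm (indicator (einterval 0 \<infinity>) x *\<^sub>R f x) \<le> norm (exponential_density l x)"
        using l by (auto simp: f_def einterval_def indicator_def exponential_density_def norm_mult Re_z mult.commute)
    qed
    have "(F \<longlongrightarrow> F 0) (at_right 0)"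
      unfolding F_def by (intro tendsto_intros)
    then show "((F \<circ> real_of_ereal) \<longlongrightarrow> - (l / z)) (at_right 0)"
      unfolding zero_ereal_def ereal_tendsto_simps by (simp add: F_def)
    define K where "K = l / norm z"
    have nF: "norm (F x) = K * exp (- l * x)" for x
      using l by (simp add: F_def norm_mult Re_z norm_divide K_def)
    have "((\<lambda>x. K * exp (- l * x)) \<longlongrightarrow> 0) at_top"
      using l by real_asymp
    then have "((\<lambda>x. norm (F x)) \<longlongrightarrow> 0) at_top" unfolding nF .
    then have "(F \<longlongrightarrow> 0) at_top" by (rule tendsto_norm_zero_cancel)
    then show "((F \<circ> real_of_ereal) \<longlongrightarrow> 0) (at_left \<infinity>)"
      unfolding ereal_tendsto_simps .
  qed simp
  also have "\<dots> = 1 / (1 - \<i> * (s / l))" using l z by (simp add: z_def field_simps)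
  finally show ?thesis .
qed

lemma prob_space_exp_product:
  assumes "\<And>e. e \<in> I \<Longrightarrow> 0 < l e"
  shows "prob_space (PiM I (\<lambda>e. exp_law (l e)))"
  using assms by (intro prob_space_PiM prob_space_exponential_density)

lemma exp_product_integral_prod:
  fixes f :: "'e \<Rightarrow> real \<Rightarrow> 'b::{real_normed_field,banach,second_countable_topology}"
  assumes I: "finite I" and l: "\<And>e. e \<in> I \<Longrightarrow> 0 < l e"
    and f: "\<And>e. e \<in> I \<Longrightarrow> integrable (exp_law (l e)) (f e)"
  shows "integrable (PiM I (\<lambda>e. exp_law (l e))) (\<lambda>A. \<Prod>e\<in>I. f e (A e))"
    and "(\<integral>A. (\<Prod>e\<in>I. f e (A e)) \<partial>PiM I (\<lambda>e. exp_law (l e))) = (\<Prod>e\<in>I. \<integral>x. f e x \<partial>exp_law (l e))"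
proof -
  \<comment> \<open>\<open>product_sigma_finite\<close> speaks of every index, so rates outside I
    are replaced by 1; the product over I does not see this.\<close>
  define l' where "l' e = (if e \<in> I then l e else 1)" for e
  have "prob_space (exp_law (l' e))" for e
    using l by (intro prob_space_exponential_density) (simp add: l'_def)
  then interpret product_sigma_finite "\<lambda>e. exp_law (l' e)"
    by (intro product_sigma_finite.intro prob_space_imp_sigma_finite)
  have eq: "PiM I (\<lambda>e. exp_law (l e)) = PiM I (\<lambda>e. exp_law (l' e))"
    by (intro PiM_cong) (auto simp: l'_def)
  show "integrable (PiM I (\<lambda>e. exp_law (l e))) (\<lambda>A. \<Prod>e\<in>I. f e (A e))"
    unfolding eq using I f by (intro product_integrable_prod) (auto simp: l'_def)
  have "(\<integral>A. (\<Prod>e\<in>I. f e (A e)) \<partial>PiM I (\<lambda>e. exp_law (l e))) = (\<Prod>e\<in>I. \<integral>x. f e x \<partial>exp_law (l' e))"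
    unfolding eq using I f by (intro product_integral_prod) (auto simp: l'_def)
  then show "(\<integral>A. (\<Prod>e\<in>I. f e (A e)) \<partial>PiM I (\<lambda>e. exp_law (l e))) = (\<Prod>e\<in>I. \<integral>x. f e x \<partial>exp_law (l e))"
    by (simp add: l'_def cong: prod.cong)
qed

lemma exp_product_component_measurable:
  assumes "e \<in> I"
  shows "(\<lambda>A. A e) \<in> borel_measurable (PiM I (\<lambda>e. exp_law (l e)))"
  using measurable_component_singleton[OF assms, of "\<lambda>e. exp_law (l e)"] by (simp cong: measurable_cong_sets)

text \<open>The number 1 / l e is both the mean and the standard deviation of coordinate e, so the
  sum of the (c e / l e)^2 below is the variance.\<close>

definition centered_sum :: "'e set \<Rightarrow> ('e \<Rightarrow> real) \<Rightarrow> ('e \<Rightarrow> real) \<Rightarrow> ('e \<Rightarrow> real) \<Rightarrow> real" where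
  "centered_sum I l c A = (\<Sum>e\<in>I. c e * (A e - 1 / l e))"

lemma centered_sum_measurable [measurable]:
  "centered_sum I l c \<in> borel_measurable (PiM I (\<lambda>e. exp_law (l e)))"
  unfolding centered_sum_def
  by (intro borel_measurable_sum borel_measurable_times borel_measurable_diff exp_product_component_measurable) auto

text \<open>The left side is the moment generating function at u of a centred exponential variable
  of rate 1, which behaves like a Gaussian one near 0.\<close>

lemma exp_neg_divide_le:
  fixes u :: real
  assumes "\<bar>u\<bar> \<le> 1/2"
  shows "exp (- u) / (1 - u) \<le> exp (2 * u^2)"
proof -
  have "- u - 2 * u^2 \<le> ln (1 - u)"
  proof (cases "0 \<le> u")
    case True
    then show ?thesis using ln_one_minus_pos_lower_bound[of u] assms by simp
  next
    case False
    then have "- u - (- u)^2 \<le> ln (1 + (- u))"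
      using assms by (intro ln_one_plus_pos_lower_bound) auto
    then have "- u - u^2 \<le> ln (1 - u)" by simp
    then show ?thesis using zero_le_power2[of u] by linarith
  qed
  then have "exp (- u - 2 * u^2) \<le> 1 - u"
    using assms by (subst (asm) ln_ge_iff) auto
  then have "exp (- u) * exp (- 2 * u^2) \<le> 1 - u" by (simp add: exp_diff exp_minus field_simps)
  then have "exp (- u) * exp (- 2 * u^2) * exp (2 * u^2) \<le> (1 - u) * exp (2 * u^2)"
    by (intro mult_right_mono) auto
  then have "exp (- u) \<le> (1 - u) * exp (2 * u^2)" by (simp add: mult.assoc mult_exp_exp)
  then show ?thesis using assms by (simp add: field_simps abs_le_iff)
qed

text \<open>The exponent s = 1 / (2 * \<sigma>) keeps each u e in [-1/2, 1/2], since no single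
  variance exceeds the total, and gives 2 * s^2 * \<sigma>^2 = 1/2. The tail is exponential in
  \<tau>, which suffices for a union bound over n events when \<tau> is a power of n.\<close>

lemma exp_product_chernoff_upper:
  assumes I: "finite I" and l: "\<And>e. e \<in> I \<Longrightarrow> 0 < l e"
    and \<sigma>: "0 < \<sigma>" "(\<Sum>e\<in>I. (c e / l e)^2) \<le> \<sigma>^2"
  shows "measure (PiM I (\<lambda>e. exp_law (l e)))
      {A \<in> space (PiM I (\<lambda>e. exp_law (l e))). \<tau> * \<sigma> \<le> centered_sum I l c A} \<le> exp (1/2 - \<tau> / 2)"
proof -
  define M where "M = PiM I (\<lambda>e. exp_law (l e))"
  define s where "s = 1 / (2 * \<sigma>)"
  have s: "0 < s" "s * \<sigma> = 1/2" "s^2 * \<sigma>^2 = 1/4" using \<sigma> by (auto simp: s_def power2_eq_square)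
  define u where "u e = s * c e / l e" for e
  have u: "\<bar>u e\<bar> \<le> 1/2" if "e \<in> I" for e
  proof -
    have "(c e / l e)^2 \<le> (\<Sum>e\<in>I. (c e / l e)^2)" using I that by (intro member_le_sum) auto
    then have "\<bar>c e / l e\<bar>^2 \<le> \<sigma>^2" using \<sigma>(2) unfolding power2_abs by linarith
    then have "\<bar>c e / l e\<bar> \<le> \<sigma>" by (rule power2_le_imp_le[OF _ less_imp_le[OF \<sigma>(1)]])
    then have "s * \<bar>c e / l e\<bar> \<le> s * \<sigma>" using s(1) by (intro mult_left_mono) auto
    moreover have "\<bar>u e\<bar> = s * \<bar>c e / l e\<bar>" using s(1) by (simp add: u_def abs_mult)
    ultimately show ?thesis using s(2) by linarith
  qed
  have lt: "s * c e < l e" if "e \<in> I" for e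
    using u[OF that] l[OF that] by (simp add: u_def abs_le_iff field_simps)
  have ex: "exp (s * centered_sum I l c A) = (\<Prod>e\<in>I. exp (- u e) * exp (s * c e * A e))" for A
    unfolding centered_sum_def sum_distrib_left exp_sum[OF I] u_def
    by (intro prod.cong) (auto simp: mult_exp_exp algebra_simps)
  have int: "integrable M (\<lambda>A. exp (s * centered_sum I l c A))"
    unfolding ex M_def using I l lt by (intro exp_product_integral_prod integrable_mult_right exponential_mgf) auto
  have "(\<integral>A. exp (s * centered_sum I l c A) \<partial>M) = (\<Prod>e\<in>I. \<integral>x. exp (- u e) * exp (s * c e * x) \<partial>exp_law (l e))"
    unfolding ex M_def using I l lt by (intro exp_product_integral_prod integrable_mult_right exponential_mgf) auto
  also have "\<dots> = (\<Prod>e\<in>I. exp (- u e) / (1 - u e))"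
  proof (intro prod.cong refl)
    fix e assume e: "e \<in> I"
    then show "(\<integral>x. exp (- u e) * exp (s * c e * x) \<partial>exp_law (l e)) = exp (- u e) / (1 - u e)"
    proof -
      have "1 - u e = (l e - s * c e) / l e" using l[OF e] by (simp add: u_def diff_divide_distrib)
      then show ?thesis using exponential_mgf[OF l[OF e] lt[OF e]] by simp
    qed
  qed
  also have "\<dots> \<le> (\<Prod>e\<in>I. exp (2 * (u e)^2))"
  proof (intro prod_mono conjI)
    fix e assume e: "e \<in> I"
    show "0 \<le> exp (- u e) / (1 - u e)" using u[OF e] by (auto simp: abs_le_iff)
    show "exp (- u e) / (1 - u e) \<le> exp (2 * (u e)^2)" using u[OF e] by (rule exp_neg_divide_le)
  qed
  also have "\<dots> = exp (2 * s^2 * (\<Sum>e\<in>I. (c e / l e)^2))"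
    unfolding exp_sum[OF I, symmetric] sum_distrib_left u_def
    by (intro arg_cong[where f = exp] sum.cong) (auto simp: power_mult_distrib power_divide)
  also have "\<dots> \<le> exp (2 * s^2 * \<sigma>^2)"
    using \<sigma>(2) by (simp add: mult_left_mono)
  also have "\<dots> = exp (1/2)" using s(3) by simp
  finally have le: "(\<integral>A. exp (s * centered_sum I l c A) \<partial>M) \<le> exp (1/2)" .
  have "{A \<in> space M. \<tau> * \<sigma> \<le> centered_sum I l c A} = {A \<in> space M. exp (\<tau> / 2) \<le> exp (s * centered_sum I l c A)}"
  proof -
    have "\<tau> * \<sigma> \<le> x \<longleftrightarrow> \<tau> / 2 \<le> s * x" for x
      using \<sigma>(1) by (simp add: s_def field_simps)
    then show ?thesis by simp
  qed
  also have "measure M \<dots> \<le> (\<integral>A. exp (s * centered_sum I l c A) \<partial>M) / exp (\<tau> / 2)"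
    by (rule integral_Markov_inequality_measure[OF int, of "{}"]) auto
  also have "\<dots> \<le> exp (1/2) / exp (\<tau> / 2)" using le by (intro divide_right_mono) auto
  also have "\<dots> = exp (1/2 - \<tau> / 2)" by (simp add: exp_diff)
  finally show ?thesis unfolding M_def .
qed

lemma exp_product_chernoff:
  assumes I: "finite I" and l: "\<And>e. e \<in> I \<Longrightarrow> 0 < l e"
    and \<sigma>: "0 < \<sigma>" "(\<Sum>e\<in>I. (c e / l e)^2) \<le> \<sigma>^2"
  shows "measure (PiM I (\<lambda>e. exp_law (l e)))
      {A \<in> space (PiM I (\<lambda>e. exp_law (l e))). \<tau> * \<sigma> < \<bar>centered_sum I l c A\<bar>} \<le> 2 * exp (1/2 - \<tau> / 2)"
proof -
  define M where "M = PiM I (\<lambda>e. exp_law (l e))"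
  interpret prob_space M unfolding M_def using l by (rule prob_space_exp_product)
  have neg: "centered_sum I l (\<lambda>e. - c e) A = - centered_sum I l c A" for A
    by (simp add: centered_sum_def sum_negf[symmetric])
  have [measurable]: "centered_sum I l c \<in> borel_measurable M" unfolding M_def by measurable
  have "measure M {A \<in> space M. \<tau> * \<sigma> < \<bar>centered_sum I l c A\<bar>}
      \<le> measure M ({A \<in> space M. \<tau> * \<sigma> \<le> centered_sum I l c A} \<union> {A \<in> space M. \<tau> * \<sigma> \<le> - centered_sum I l c A})"
    by (intro finite_measure_mono) auto
  also have "\<dots> \<le> measure M {A \<in> space M. \<tau> * \<sigma> \<le> centered_sum I l c A} + measure M {A \<in> space M. \<tau> * \<sigma> \<le> - centered_sum I l c A}"
    by (intro measure_Un_le) auto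
  also have "\<dots> \<le> exp (1/2 - \<tau> / 2) + exp (1/2 - \<tau> / 2)"
    using exp_product_chernoff_upper[of I l \<sigma> c \<tau>] exp_product_chernoff_upper[of I l \<sigma> "\<lambda>e. - c e" \<tau>] I l \<sigma>
    unfolding neg M_def by (intro add_mono) auto
  finally show ?thesis unfolding M_def by simp
qed

text \<open>The quotient is the characteristic function of a centred exponential variable of rate 1.
  Multiplying by 1 - \<i> * x, of modulus at least 1, reduces the claim to Taylor expansions up to
  order two; the cubic errors have coefficients 1/6 + 1/2 + 1/4 < 1.\<close>

lemma exponential_char_gaussian_approx:
  fixes x :: real
  assumes "\<bar>x\<bar> \<le> 1"
  shows "norm (iexp (- x) / (1 - \<i> * x) - exp (- (x^2) / 2)) \<le> \<bar>x\<bar>^3"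
proof -
  define E where "E = exp (- (x^2) / 2)"
  have E: "1 - x^2 / 2 \<le> E" "E \<le> 1 - x^2 / 2 + x^4 / 8"
  proof -
    show "1 - x^2 / 2 \<le> E" unfolding E_def using exp_ge_add_one_self[of "- (x^2) / 2"] by simp
    have "exp (- y) \<le> 1 - y + y^2 / 2" if "0 \<le> y" for y :: real
    proof -
      define g where "g t = 1 - t + t^2 / 2 - exp (- t)" for t :: real
      have "g 0 \<le> g y"
      proof (rule DERIV_nonneg_imp_nondecreasing[OF that])
        fix t :: real assume "0 \<le> t" "t \<le> y"
        have "(g has_real_derivative (- 1 + t + exp (- t))) (at t)"
          unfolding g_def by (auto intro!: derivative_eq_intros)
        moreover have "0 \<le> - 1 + t + exp (- t)" using exp_ge_add_one_self[of "- t"] by simp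
        ultimately show "\<exists>d. (g has_real_derivative d) (at t) \<and> 0 \<le> d" by blast
      qed
      then show ?thesis by (simp add: g_def)
    qed
    from this[of "x^2 / 2"] show "E \<le> 1 - x^2 / 2 + x^4 / 8"
      by (simp add: E_def power_divide)
  qed
  define r1 where "r1 = iexp (- x) - (1 - \<i> * x - x^2 / 2)"
  have r1: "norm r1 \<le> \<bar>x\<bar>^3 / 6"
    using iexp_approx1[of "- x" 2] by (simp add: r1_def numeral_2_eq_2 numeral_3_eq_3 fact_numeral power2_eq_square algebra_simps)
  define r2 where "r2 = E - (1 - x^2 / 2)"
  have "x^4 \<le> \<bar>x\<bar>^3 * 1" using assms
  proof -
    have "x^4 = \<bar>x\<bar>^3 * \<bar>x\<bar>" by (metis power_even_abs_numeral even_numeral power_Suc2 numeral_3_eq_3 eval_nat_numeral(3) numeral_eq_Suc pred_numeral_simps(3) pred_numeral_simps(2) semiring_norm(26) semiring_norm(27) semiring_norm(28))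
    then show ?thesis using assms mult_left_mono[of "\<bar>x\<bar>" 1 "\<bar>x\<bar>^3"] by simp
  qed
  then have r2: "\<bar>r2\<bar> \<le> \<bar>x\<bar>^3 / 8" using E by (simp add: r2_def)
  have n: "norm (1 - \<i> * x) \<le> 2"
    using norm_triangle_ineq4[of 1 "\<i> * complex_of_real x"] assms by (simp add: norm_mult)
  have "Re (1 - \<i> * x) \<le> norm (1 - \<i> * x)" by (rule complex_Re_le_cmod)
  then have n1: "1 \<le> norm (1 - \<i> * x)" by simp
  then have nz: "1 - \<i> * x \<noteq> 0" by auto
  have "iexp (- x) - (1 - \<i> * x) * E = r1 - (\<i> * x) * (x^2 / 2) - (1 - \<i> * x) * r2"
    unfolding r1_def r2_def by (simp add: field_simps)
  also have "norm \<dots> \<le> norm r1 + norm ((\<i> * x) * (x^2 / 2)) + norm ((1 - \<i> * x) * complex_of_real r2)"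
    using norm_triangle_ineq4 by (smt (verit, ccfv_SIG))
  also have "\<dots> \<le> \<bar>x\<bar>^3 / 6 + \<bar>x\<bar>^3 / 2 + 2 * (\<bar>x\<bar>^3 / 8)"
  proof (intro add_mono r1)
    show "norm ((\<i> * x) * (x^2 / 2)) \<le> \<bar>x\<bar>^3 / 2"
      by (simp add: norm_mult norm_power norm_divide power3_eq_cube power2_eq_square)
    show "norm ((1 - \<i> * x) * complex_of_real r2) \<le> 2 * (\<bar>x\<bar>^3 / 8)"
      unfolding norm_mult using n r2 by (intro mult_mono) auto
  qed
  also have "\<dots> \<le> \<bar>x\<bar>^3" by simp
  finally have le: "norm (iexp (- x) - (1 - \<i> * x) * E) \<le> \<bar>x\<bar>^3" .
  have "iexp (- x) / (1 - \<i> * x) - E = (iexp (- x) - (1 - \<i> * x) * E) / (1 - \<i> * x)"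
    using nz by (simp add: diff_divide_distrib)
  also have "norm \<dots> \<le> norm (iexp (- x) - (1 - \<i> * x) * E) / 1"
    unfolding norm_divide using n1 by (intro divide_left_mono) auto
  finally show ?thesis using le by (simp add: E_def)
qed

text \<open>By independence both quantities are products of numbers of modulus at most 1, so their
  distance is at most the sum of the distances of the factors (Lindeberg's replacement).\<close>

lemma exp_product_char_gaussian_approx:
  assumes I: "finite I" and l: "\<And>e. e \<in> I \<Longrightarrow> 0 < l e" and c: "\<And>e. e \<in> I \<Longrightarrow> \<bar>c e / l e\<bar> \<le> 1"
  shows "norm ((\<integral>A. iexp (centered_sum I l c A) \<partial>PiM I (\<lambda>e. exp_law (l e))) - exp (- (\<Sum>e\<in>I. (c e / l e)^2) / 2))
    \<le> (\<Sum>e\<in>I. \<bar>c e / l e\<bar>^3)"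
proof -
  define u where "u e = c e / l e" for e
  define M where "M = PiM I (\<lambda>e. exp_law (l e))"
  have ex: "iexp (centered_sum I l c A) = (\<Prod>e\<in>I. iexp (- u e) * iexp (c e * A e))" for A
    unfolding centered_sum_def u_def of_real_sum sum_distrib_left exp_sum[OF I]
    by (intro prod.cong) (auto simp: mult_exp_exp algebra_simps)
  have intg: "integrable (exp_law (l e)) (\<lambda>x. iexp (- u e) * iexp (c e * x))" if "e \<in> I" for e
  proof -
    interpret prob_space "exp_law (l e)" using l that by (intro prob_space_exponential_density)
    show ?thesis by (intro integrable_mult_right integrable_iexp) auto
  qed
  have "(\<integral>A. iexp (centered_sum I l c A) \<partial>M) = (\<Prod>e\<in>I. \<integral>x. iexp (- u e) * iexp (c e * x) \<partial>exp_law (l e))"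
    unfolding ex M_def using I l intg by (intro exp_product_integral_prod) auto
  also have "\<dots> = (\<Prod>e\<in>I. iexp (- u e) / (1 - \<i> * u e))"
    using exponential_char[OF l] by (intro prod.cong) (auto simp: u_def)
  finally have 1: "(\<integral>A. iexp (centered_sum I l c A) \<partial>M) = (\<Prod>e\<in>I. iexp (- u e) / (1 - \<i> * u e))" .
  have "- (\<Sum>e\<in>I. (c e / l e)^2) / 2 = (\<Sum>e\<in>I. - ((u e)^2) / 2)"
    by (simp add: u_def sum_negf sum_divide_distrib)
  then have 2: "complex_of_real (exp (- (\<Sum>e\<in>I. (c e / l e)^2) / 2)) = (\<Prod>e\<in>I. complex_of_real (exp (- ((u e)^2) / 2)))"
    by (simp add: exp_sum[OF I])
  have "norm ((\<Prod>e\<in>I. iexp (- u e) / (1 - \<i> * u e)) - (\<Prod>e\<in>I. complex_of_real (exp (- ((u e)^2) / 2))))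
      \<le> (\<Sum>e\<in>I. norm (iexp (- u e) / (1 - \<i> * u e) - exp (- ((u e)^2) / 2)))"
  proof (rule norm_prod_diff)
    fix e
    have "Re (1 - \<i> * u e) \<le> norm (1 - \<i> * u e)" by (rule complex_Re_le_cmod)
    then have "1 \<le> norm (1 - \<i> * u e)" by simp
    moreover have "norm (iexp (- u e)) = 1" by (simp del: of_real_minus)
    ultimately show "norm (iexp (- u e) / (1 - \<i> * u e)) \<le> 1"
      unfolding norm_divide by (simp add: divide_le_eq_1)
  qed auto
  also have "\<dots> \<le> (\<Sum>e\<in>I. \<bar>u e\<bar>^3)"
    using c by (intro sum_mono exponential_char_gaussian_approx) (auto simp: u_def)
  finally show ?thesis unfolding 1[unfolded M_def] 2 u_def .
qed

section \<open>Convergence in distribution from characteristic functions\<close>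

lemma compact_PiE_UNIV:
  fixes S :: "'a \<Rightarrow> 'b::topological_space set"
  assumes "\<And>i. compact (S i)"
  shows "compact (PiE UNIV S)"
proof -
  have "compactin (product_topology (\<lambda>_. euclidean) UNIV) (PiE UNIV S)"
    unfolding compactin_PiE using assms by simp
  then show ?thesis by (simp add: euclidean_product_topology)
qed

text \<open>The phase a covers sines and makes the class closed under products. The integral of a
  wave is determined by one value of the characteristic function, the one at t.\<close>

inductive trig_poly :: "nat \<Rightarrow> ((nat \<Rightarrow> real) \<Rightarrow> real) \<Rightarrow> bool" for k where
  wave: "trig_poly k (\<lambda>x. r * cos ((\<Sum>i<k. t i * x i) + a))"
| add: "trig_poly k f \<Longrightarrow> trig_poly k g \<Longrightarrow> trig_poly k (\<lambda>x. f x + g x)"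

lemma trig_poly_mult:
  assumes "trig_poly k f" "trig_poly k g"
  shows "trig_poly k (\<lambda>x. f x * g x)"
  using assms(1)
proof induction
  case (wave r t a)
  show ?case using assms(2)
  proof induction
    case (wave r' t' a')
    have eq: "r * cos ((\<Sum>i<k. t i * x i) + a) * (r' * cos ((\<Sum>i<k. t' i * x i) + a')) =
      r * r' / 2 * cos ((\<Sum>i<k. (t i - t' i) * x i) + (a - a')) +
      r * r' / 2 * cos ((\<Sum>i<k. (t i + t' i) * x i) + (a + a'))" for x
    proof -
      have "(\<Sum>i<k. (t i - t' i) * x i) + (a - a') = ((\<Sum>i<k. t i * x i) + a) - ((\<Sum>i<k. t' i * x i) + a')"
        "(\<Sum>i<k. (t i + t' i) * x i) + (a + a') = ((\<Sum>i<k. t i * x i) + a) + ((\<Sum>i<k. t' i * x i) + a')"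
        by (simp_all add: left_diff_distrib distrib_right sum_subtractf sum.distrib)
      then show ?thesis by (simp only: cos_diff cos_add) (simp add: algebra_simps)
    qed
    show ?case unfolding eq by (intro trig_poly.intros)
  next
    case (add f g)
    then show ?case by (simp add: distrib_left trig_poly.add)
  qed
next
  case (add f g)
  then show ?case by (simp add: distrib_right trig_poly.add)
qed

text \<open>A subalgebra of the trigonometric polynomials whose members see x only through the
  numbers sin (c * x i), i < k; a linear combination of general waves has no such folding
  property.\<close>

inductive sin_poly :: "nat \<Rightarrow> real \<Rightarrow> ((nat \<Rightarrow> real) \<Rightarrow> real) \<Rightarrow> bool" for k c where
  const: "sin_poly k c (\<lambda>x. r)"
| sin: "i < k \<Longrightarrow> sin_poly k c (\<lambda>x. sin (c * x i))"
| add: "sin_poly k c f \<Longrightarrow> sin_poly k c g \<Longrightarrow> sin_poly k c (\<lambda>x. f x + g x)"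
| mult: "sin_poly k c f \<Longrightarrow> sin_poly k c g \<Longrightarrow> sin_poly k c (\<lambda>x. f x * g x)"

lemma trig_poly_sin_poly: "sin_poly k c f \<Longrightarrow> trig_poly k f"
proof (induction rule: sin_poly.induct)
  case (const r)
  show ?case using trig_poly.wave[of k r "\<lambda>_. 0" 0] by simp
next
  case (sin i)
  have "(\<Sum>j<k. (if j = i then c else 0) * x j) = (\<Sum>j<k. if j = i then c * x j else 0)" for x
    by (intro sum.cong) auto
  then have "(\<lambda>x. 1 * cos ((\<Sum>j<k. (if j = i then c else 0) * x j) + - (pi / 2))) = (\<lambda>x. sin (c * x i))"
    using sin by (simp add: cos_diff)
  then show ?case using trig_poly.wave[of k 1 "\<lambda>j. if j = i then c else 0" "- (pi / 2)"] by simp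
qed (auto intro: trig_poly.intros trig_poly_mult)

lemma continuous_sin_poly: "sin_poly k c f \<Longrightarrow> continuous_on S f"
proof (induction rule: sin_poly.induct)
  case (sin i)
  have "continuous_on S (\<lambda>x::nat \<Rightarrow> real. x i)"
    by (rule continuous_on_product_then_coordinatewise[OF continuous_on_id])
  then show ?case by (intro continuous_intros)
qed (auto intro!: continuous_intros)

text \<open>Moving each c * x i to the principal branch of the sine leaves sin (c * x i) unchanged,
  so every value of f is already taken on a box.\<close>

lemma sin_poly_fold:
  assumes "c \<noteq> 0" "sin_poly k c f"
  shows "f x = f (\<lambda>i. if i < k then arcsin (sin (c * x i)) / c else undefined)"
  using assms(2)
  by induction (use assms(1) in \<open>auto simp: sin_arcsin\<close>)

text \<open>Polynomials in \<open>sin (\<pi> x\<^sub>i / (2 K))\<close> separate the points of the box \<open>[-K, K]\<^sup>k\<close>, and their global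
  supremum is attained on that box.\<close>

lemma sin_poly_approximation:
  fixes f :: "(nat \<Rightarrow> real) \<Rightarrow> real" and K :: real
  assumes f: "continuous_on UNIV f" "\<And>x. \<bar>f x\<bar> \<le> B" and K: "0 < K" and \<epsilon>: "0 < \<epsilon>"
  obtains g where "trig_poly k g" "\<And>x. \<bar>g x\<bar> \<le> B + \<epsilon>"
    "\<And>x. (\<And>i. i < k \<Longrightarrow> \<bar>x i\<bar> \<le> K) \<Longrightarrow> (\<And>i. k \<le> i \<Longrightarrow> x i = undefined) \<Longrightarrow> \<bar>f x - g x\<bar> \<le> \<epsilon>"
proof -
  \<comment> \<open>Chosen so that the principal branch of sin (c * x) is exactly [-K, K]: the sine
    is injective there, and folding lands there.\<close>
  define c where "c = pi / (2 * K)"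
  have c: "0 < c" using K by (simp add: c_def)
  have cK: "c * K = pi / 2" using K by (simp add: c_def)
  \<comment> \<open>Coordinates from k on are pinned to \<open>undefined\<close>, as for points of
    the limit measure. This makes S compact and leaves only the coordinates below k to be
    separated.\<close>
  define S where "S = PiE UNIV (\<lambda>i. if i < k then {- K..K} else {undefined})"
  have S: "x \<in> S \<longleftrightarrow> (\<forall>i<k. \<bar>x i\<bar> \<le> K) \<and> (\<forall>i\<ge>k. x i = undefined)" for x
    unfolding S_def PiE_UNIV_domain by (auto simp: Pi_iff abs_le_iff not_less split: if_splits)
  have "compact S" unfolding S_def by (intro compact_PiE_UNIV) auto
  moreover have "\<exists>g. sin_poly k c g \<and> g x \<noteq> g y" if xy: "x \<in> S" "y \<in> S" "x \<noteq> y" for x y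
  proof -
    obtain i where i: "x i \<noteq> y i" using xy(3) by auto
    then have ik: "i < k" using xy S by (metis not_less)
    have range: "- (pi / 2) \<le> c * z \<and> c * z \<le> pi / 2" if "\<bar>z\<bar> \<le> K" for z
    proof -
      have "\<bar>c * z\<bar> \<le> c * K" using that c by (simp add: abs_mult mult_left_mono)
      then show ?thesis unfolding cK by (auto simp only: abs_le_iff)
    qed
    have "sin (c * x i) \<noteq> sin (c * y i)"
      using sin_inj_pi[of "c * x i" "c * y i"] range[of "x i"] range[of "y i"] xy S ik i c by auto
    then show ?thesis using sin_poly.sin[OF ik] by blast
  qed
  ultimately have "\<exists>g. sin_poly k c g \<and> (\<forall>x\<in>S. \<bar>f x - g x\<bar> < \<epsilon>)"
    using f(1) \<epsilon>
    by (intro Stone_Weierstrass_HOL) (auto intro: sin_poly.intros continuous_sin_poly continuous_on_subset)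
  then obtain g where g: "sin_poly k c g" "\<And>x. x \<in> S \<Longrightarrow> \<bar>f x - g x\<bar> < \<epsilon>" by blast
  show ?thesis
  proof (rule that[OF trig_poly_sin_poly[OF g(1)]])
    fix x
    show "\<bar>f x - g x\<bar> \<le> \<epsilon>" if "\<And>i. i < k \<Longrightarrow> \<bar>x i\<bar> \<le> K" "\<And>i. k \<le> i \<Longrightarrow> x i = undefined"
      using g(2)[of x] S that by (simp add: less_imp_le)
    define z where "z = (\<lambda>i. if i < k then arcsin (sin (c * x i)) / c else undefined)"
    have "z \<in> S" unfolding S
    proof (intro conjI allI impI)
      fix i assume i: "i < k"
      have "\<bar>arcsin (sin (c * x i))\<bar> \<le> pi / 2"
        using arcsin_bounded[of "sin (c * x i)"] unfolding abs_le_iff by simp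
      then show "\<bar>z i\<bar> \<le> K" using i c cK by (simp add: z_def field_simps)
    qed (simp add: z_def)
    then have "\<bar>g z\<bar> \<le> B + \<epsilon>" using g(2)[of z] f(2)[of z] by linarith
    then show "\<bar>g x\<bar> \<le> B + \<epsilon>" using sin_poly_fold[OF _ g(1), of x] c unfolding z_def[symmetric] by simp
  qed
qed

section \<open>From characteristic functions and tightness to weak convergence\<close>

lemma (in prob_space) trig_poly_integral:
  assumes X: "X \<in> borel_measurable M"
  shows "integrable M (\<lambda>\<omega>. r * cos ((\<Sum>i<k. t i * X \<omega> i) + a))"
    and "(\<integral>\<omega>. r * cos ((\<Sum>i<k. t i * X \<omega> i) + a) \<partial>M) = r * Re (iexp a * (\<integral>\<omega>. iexp (\<Sum>i<k. t i * X \<omega> i) \<partial>M))"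
proof -
  have [measurable]: "(\<lambda>\<omega>. X \<omega> i) \<in> borel_measurable M" for i
    using X by (rule measurable_product_then_coordinatewise)
  have int: "integrable M (\<lambda>\<omega>. iexp a * iexp (\<Sum>i<k. t i * X \<omega> i))"
    by (intro integrable_mult_right integrable_iexp) auto
  have eq: "cos ((\<Sum>i<k. t i * X \<omega> i) + a) = Re (iexp a * iexp (\<Sum>i<k. t i * X \<omega> i))" for \<omega>
    by (simp only: mult_exp_exp distrib_left[symmetric] of_real_add[symmetric] Re_exp) (simp add: add.commute)
  show "integrable M (\<lambda>\<omega>. r * cos ((\<Sum>i<k. t i * X \<omega> i) + a))"
    unfolding eq using integrable_Re[OF int] by (rule integrable_mult_right)
  have "(\<integral>\<omega>. Re (iexp a * iexp (\<Sum>i<k. t i * X \<omega> i)) \<partial>M) = Re (\<integral>\<omega>. iexp a * iexp (\<Sum>i<k. t i * X \<omega> i) \<partial>M)"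
    by (rule integral_Re[OF int])
  also have "(\<integral>\<omega>. iexp a * iexp (\<Sum>i<k. t i * X \<omega> i) \<partial>M) = iexp a * (\<integral>\<omega>. iexp (\<Sum>i<k. t i * X \<omega> i) \<partial>M)"
    by (rule integral_mult_right_zero)
  finally show "(\<integral>\<omega>. r * cos ((\<Sum>i<k. t i * X \<omega> i) + a) \<partial>M) = r * Re (iexp a * (\<integral>\<omega>. iexp (\<Sum>i<k. t i * X \<omega> i) \<partial>M))"
    unfolding eq integral_mult_right_zero[of M r] by (simp only:)
qed

lemma (in prob_space) trig_poly_integrable:
  assumes "trig_poly k g" "X \<in> borel_measurable M"
  shows "integrable M (\<lambda>\<omega>. g (X \<omega>))"
  using assms(1) by induction (use trig_poly_integral(1)[OF assms(2)] in auto)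

text \<open>Off the box nothing relates f and g, and only their bounds B and B + \<epsilon> are
  available; this is where the global bound on the approximating polynomial is spent.\<close>

lemma (in prob_space) integral_close_on_box:
  fixes f g :: "(nat \<Rightarrow> real) \<Rightarrow> real"
  assumes X: "X \<in> borel_measurable M" "\<And>\<omega> i. \<omega> \<in> space M \<Longrightarrow> k \<le> i \<Longrightarrow> X \<omega> i = undefined"
    and f: "continuous_on UNIV f" "\<And>x. \<bar>f x\<bar> \<le> B"
    and g: "integrable M (\<lambda>\<omega>. g (X \<omega>))" "\<And>x. \<bar>g x\<bar> \<le> B + \<epsilon>"
      "\<And>x. (\<And>i. i < k \<Longrightarrow> \<bar>x i\<bar> \<le> K) \<Longrightarrow> (\<And>i. k \<le> i \<Longrightarrow> x i = undefined) \<Longrightarrow> \<bar>f x - g x\<bar> \<le> \<epsilon>"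
    and \<epsilon>: "0 \<le> \<epsilon>" and tight: "measure M {\<omega> \<in> space M. \<exists>i<k. K < \<bar>X \<omega> i\<bar>} \<le> \<eta>"
  shows "\<bar>(\<integral>\<omega>. f (X \<omega>) \<partial>M) - (\<integral>\<omega>. g (X \<omega>) \<partial>M)\<bar> \<le> \<epsilon> + (2 * B + \<epsilon>) * \<eta>"
proof -
  have [measurable]: "(\<lambda>\<omega>. X \<omega> i) \<in> borel_measurable M" for i
    using X(1) by (rule measurable_product_then_coordinatewise)
  define N where "N = {\<omega> \<in> space M. \<exists>i<k. K < \<bar>X \<omega> i\<bar>}"
  have [measurable]: "N \<in> sets M" unfolding N_def by measurable
  have "f \<in> borel_measurable borel" using f(1) by (rule borel_measurable_continuous_onI)
  then have fm: "(\<lambda>\<omega>. f (X \<omega>)) \<in> borel_measurable M" using X(1) by measurable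
  have intf: "integrable M (\<lambda>\<omega>. f (X \<omega>))"
    by (rule integrable_const_bound[of _ B]) (use f(2) fm in auto)
  have B: "0 \<le> B" using f(2)[of undefined] by linarith
  have intN: "integrable M (\<lambda>\<omega>. (2 * B + \<epsilon>) * indicator N \<omega>)"
    by (intro integrable_mult_right integrable_real_indicator) (auto simp: less_top[symmetric])
  have "\<bar>(\<integral>\<omega>. f (X \<omega>) \<partial>M) - (\<integral>\<omega>. g (X \<omega>) \<partial>M)\<bar> = \<bar>\<integral>\<omega>. f (X \<omega>) - g (X \<omega>) \<partial>M\<bar>"
    using intf g(1) by simp
  also have "\<dots> \<le> (\<integral>\<omega>. \<bar>f (X \<omega>) - g (X \<omega>)\<bar> \<partial>M)" by (rule integral_abs_bound)
  also have "\<dots> \<le> (\<integral>\<omega>. \<epsilon> + (2 * B + \<epsilon>) * indicator N \<omega> \<partial>M)"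
  proof (rule integral_mono)
    show "integrable M (\<lambda>\<omega>. \<bar>f (X \<omega>) - g (X \<omega>)\<bar>)" using intf g(1) by auto
    show "integrable M (\<lambda>\<omega>. \<epsilon> + (2 * B + \<epsilon>) * indicator N \<omega>)"
      by (intro Bochner_Integration.integrable_add integrable_const intN)
    fix \<omega> assume \<omega>: "\<omega> \<in> space M"
    show "\<bar>f (X \<omega>) - g (X \<omega>)\<bar> \<le> \<epsilon> + (2 * B + \<epsilon>) * indicator N \<omega>"
    proof (cases "\<omega> \<in> N")
      case True
      then show ?thesis using f(2)[of "X \<omega>"] g(2)[of "X \<omega>"] \<epsilon> by (simp add: indicator_def)
    next
      case False
      then have "\<bar>X \<omega> i\<bar> \<le> K" if "i < k" for i using that \<omega> by (intro leI) (auto simp: N_def)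
      from g(3)[OF this X(2)[OF \<omega>]] False show ?thesis by simp
    qed
  qed
  also have "\<dots> = \<epsilon> + (2 * B + \<epsilon>) * measure M N"
    using intN by (simp add: prob_space)
  also have "\<dots> \<le> \<epsilon> + (2 * B + \<epsilon>) * \<eta>"
    using tight B \<epsilon> unfolding N_def by (intro add_left_mono mult_left_mono) auto
  finally show ?thesis .
qed

text \<open>The polynomial g depends on the accuracy but not on n, so the limit involves finitely
  many values of the characteristic functions. Measurability is asked for large n because the
  estimator is treated for n >= 3 and k <= n.\<close>

theorem conv_in_distr_of_char:
  fixes X :: "nat \<Rightarrow> 'a \<Rightarrow> nat \<Rightarrow> real" and L :: "(nat \<Rightarrow> real) measure"
  assumes X: "\<forall>\<^sub>F n in sequentially. prob_space (M n) \<and> X n \<in> borel_measurable (M n)"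
    and Xu: "\<And>n \<omega> i. k \<le> i \<Longrightarrow> X n \<omega> i = undefined"
    and L: "prob_space L" "(\<lambda>x. x) \<in> borel_measurable L" "\<And>x i. x \<in> space L \<Longrightarrow> k \<le> i \<Longrightarrow> x i = undefined"
    and char: "\<And>t. (\<lambda>n. \<integral>\<omega>. iexp (\<Sum>i<k. t i * X n \<omega> i) \<partial>M n) \<longlonglongrightarrow> (\<integral>x. iexp (\<Sum>i<k. t i * x i) \<partial>L)"
    and tight: "\<And>\<eta>. 0 < \<eta> \<Longrightarrow> \<exists>K>0. (\<forall>\<^sub>F n in sequentially. measure (M n) {\<omega> \<in> space (M n). \<exists>i<k. K < \<bar>X n \<omega> i\<bar>} \<le> \<eta>)
        \<and> measure L {x \<in> space L. \<exists>i<k. K < \<bar>x i\<bar>} \<le> \<eta>"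
  shows "conv_in_distr M X L"
  unfolding conv_in_distr_def
proof (intro allI impI)
  fix f :: "(nat \<Rightarrow> real) \<Rightarrow> real"
  assume f: "continuous_on UNIV f" and bdd: "bounded (range f)"
  obtain B where B: "\<And>x. \<bar>f x\<bar> \<le> B" using bdd by (auto simp: bounded_iff)
  have B0: "0 \<le> B" using B[of undefined] by linarith
  interpret L: prob_space L by (rule L(1))
  have trig_lim: "(\<lambda>n. \<integral>\<omega>. g (X n \<omega>) \<partial>M n) \<longlonglongrightarrow> (\<integral>x. g x \<partial>L)" if "trig_poly k g" for g
    using that
  proof induction
    case (wave r t a)
    have "(\<lambda>n. r * Re (iexp a * (\<integral>\<omega>. iexp (\<Sum>i<k. t i * X n \<omega> i) \<partial>M n)))
        \<longlonglongrightarrow> r * Re (iexp a * (\<integral>x. iexp (\<Sum>i<k. t i * x i) \<partial>L))"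
      by (intro tendsto_intros char)
    moreover have "\<forall>\<^sub>F n in sequentially. r * Re (iexp a * (\<integral>\<omega>. iexp (\<Sum>i<k. t i * X n \<omega> i) \<partial>M n))
        = (\<integral>\<omega>. r * cos ((\<Sum>i<k. t i * X n \<omega> i) + a) \<partial>M n)"
      using X
    proof eventually_elim
      case (elim n)
      then interpret prob_space "M n" by simp
      show ?case using trig_poly_integral(2)[where X = "X n" and r = r and k = k and t = t and a = a] elim by (simp only:)
    qed
    ultimately show ?case unfolding L.trig_poly_integral(2)[OF L(2)]
      by (rule Lim_transform_eventually)
  next
    case (add g h)
    have "\<forall>\<^sub>F n in sequentially. (\<integral>\<omega>. g (X n \<omega>) \<partial>M n) + (\<integral>\<omega>. h (X n \<omega>) \<partial>M n) = (\<integral>\<omega>. g (X n \<omega>) + h (X n \<omega>) \<partial>M n)"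
      using X
    proof eventually_elim
      case (elim n)
      then interpret prob_space "M n" by simp
      have "X n \<in> borel_measurable (M n)" using elim by simp
      from trig_poly_integrable[OF add.hyps(1) this] trig_poly_integrable[OF add.hyps(2) this]
      show ?case by simp
    qed
    moreover have "(\<integral>x. g x \<partial>L) + (\<integral>x. h x \<partial>L) = (\<integral>x. g x + h x \<partial>L)"
      using L.trig_poly_integrable[OF add.hyps(1) L(2)] L.trig_poly_integrable[OF add.hyps(2) L(2)] by simp
    ultimately show ?case using Lim_transform_eventually[OF tendsto_add[OF add.IH]] by (simp only:)
  qed
  show "(\<lambda>n. \<integral>\<omega>. f (X n \<omega>) \<partial>M n) \<longlonglongrightarrow> (\<integral>x. f x \<partial>L)"
  proof (rule LIMSEQ_I)
    fix e :: real assume e: "0 < e"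
    define \<epsilon> where "\<epsilon> = min 1 (e / (8 * (2 * B + 2)))"
    have \<epsilon>: "0 < \<epsilon>" "\<epsilon> \<le> 1" using e B0 by (auto simp: \<epsilon>_def)
    have "\<epsilon> + (2 * B + \<epsilon>) * \<epsilon> \<le> \<epsilon> * (2 * B + 2)"
      using \<epsilon> by (simp add: algebra_simps mult_left_le)
    also have "\<dots> \<le> e / (8 * (2 * B + 2)) * (2 * B + 2)"
      using B0 by (intro mult_right_mono) (auto simp: \<epsilon>_def)
    also have "\<dots> = e / 8"
    proof -
      have "e / (8 * b) * b = e / 8" if "0 < b" for b using that by simp
      from this[of "2 * B + 2"] B0 show ?thesis by argo
    qed
    finally have small: "\<epsilon> + (2 * B + \<epsilon>) * \<epsilon> \<le> e / 8" .
    obtain K where K: "0 < K"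
      "\<forall>\<^sub>F n in sequentially. measure (M n) {\<omega> \<in> space (M n). \<exists>i<k. K < \<bar>X n \<omega> i\<bar>} \<le> \<epsilon>"
      "measure L {x \<in> space L. \<exists>i<k. K < \<bar>x i\<bar>} \<le> \<epsilon>"
      using tight[OF \<epsilon>(1)] by blast
    obtain g where g: "trig_poly k g" "\<And>x. \<bar>g x\<bar> \<le> B + \<epsilon>"
      "\<And>x. (\<And>i. i < k \<Longrightarrow> \<bar>x i\<bar> \<le> K) \<Longrightarrow> (\<And>i. k \<le> i \<Longrightarrow> x i = undefined) \<Longrightarrow> \<bar>f x - g x\<bar> \<le> \<epsilon>"
      using sin_poly_approximation[OF f B K(1) \<epsilon>(1)] by metis
    have 1: "\<bar>(\<integral>x. f x \<partial>L) - (\<integral>x. g x \<partial>L)\<bar> \<le> e / 8"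
    proof -
      have int: "integrable L g" by (rule L.trig_poly_integrable[OF g(1) L(2)])
      have \<epsilon>0: "0 \<le> \<epsilon>" using \<epsilon> by simp
      have "\<bar>(\<integral>x. f x \<partial>L) - (\<integral>x. g x \<partial>L)\<bar> \<le> \<epsilon> + (2 * B + \<epsilon>) * \<epsilon>"
        by (rule L.integral_close_on_box[where X = "\<lambda>x. x" and f = f and g = g and k = k and K = K]; fact)
      then show ?thesis using small by linarith
    qed
    have 2: "\<forall>\<^sub>F n in sequentially. \<bar>(\<integral>\<omega>. f (X n \<omega>) \<partial>M n) - (\<integral>\<omega>. g (X n \<omega>) \<partial>M n)\<bar> \<le> e / 8"
      using X K(2)
    proof eventually_elim
      case (elim n)
      then interpret prob_space "M n" by simp
      have Xn: "X n \<in> borel_measurable (M n)" using elim by simp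
      have Xnu: "X n \<omega> i = undefined" if "\<omega> \<in> space (M n)" "k \<le> i" for \<omega> i using that(2) by (rule Xu)
      from Xn have int: "integrable (M n) (\<lambda>\<omega>. g (X n \<omega>))" by (rule trig_poly_integrable[OF g(1)])
      have \<epsilon>0: "0 \<le> \<epsilon>" using \<epsilon> by simp
      have "\<bar>(\<integral>\<omega>. f (X n \<omega>) \<partial>M n) - (\<integral>\<omega>. g (X n \<omega>) \<partial>M n)\<bar> \<le> \<epsilon> + (2 * B + \<epsilon>) * \<epsilon>"
        using Xn Xnu elim f B g \<epsilon>0 int
        by (intro integral_close_on_box[where X = "X n" and f = f and g = g and k = k and K = K]) blast+
      then show ?case using small by linarith
    qed
    have 3: "\<forall>\<^sub>F n in sequentially. \<bar>(\<integral>\<omega>. g (X n \<omega>) \<partial>M n) - (\<integral>x. g x \<partial>L)\<bar> < e / 8"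
      using tendstoD[OF trig_lim[OF g(1)], of "e / 8"] e by (simp add: dist_real_def)
    have "\<forall>\<^sub>F n in sequentially. norm ((\<integral>\<omega>. f (X n \<omega>) \<partial>M n) - (\<integral>x. f x \<partial>L)) < e"
      using 2 3
    proof eventually_elim
      case (elim n)
      then show ?case unfolding real_norm_def using 1 e by linarith
    qed
    then show "\<exists>n0. \<forall>n\<ge>n0. norm ((\<integral>\<omega>. f (X n \<omega>) \<partial>M n) - (\<integral>x. f x \<partial>L)) < e"
      by (simp add: eventually_sequentially)
  qed
qed

section \<open>Existence, uniqueness and measurability of the estimator\<close>

lemma offdiag_rows: "offdiag n = Sigma {1..n} (\<lambda>i. {1..n} - {i})"
  by (auto simp: offdiag_def)

lemma finite_offdiag [simp]: "finite (offdiag n)"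
  unfolding offdiag_rows by simp

lemma mem_offdiag: "(i, j) \<in> offdiag n \<longleftrightarrow> i \<in> {1..n} \<and> j \<in> {1..n} \<and> i \<noteq> j"
  by (simp add: offdiag_def)

lemma sum_offdiag_rows: "(\<Sum>e\<in>offdiag n. f e) = (\<Sum>i\<in>{1..n}. \<Sum>j\<in>{1..n} - {i}. f (i, j))"
  unfolding offdiag_rows by (subst sum.Sigma) auto

lemma sum_offdiag_columns: "(\<Sum>e\<in>offdiag n. f e) = (\<Sum>j\<in>{1..n}. \<Sum>i\<in>{1..n} - {j}. f (i, j))"
proof -
  have "(\<Sum>e\<in>offdiag n. f e) = (\<Sum>e\<in>offdiag n. f (prod.swap e))"
    by (rule sum.reindex_bij_witness[of _ prod.swap prod.swap]) (auto simp: offdiag_def)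
  then show ?thesis by (simp add: sum_offdiag_rows)
qed

lemma sum_offdiag_row:
  fixes f :: "nat \<times> nat \<Rightarrow> real"
  assumes "i \<in> {1..n}"
  shows "(\<Sum>e\<in>offdiag n. of_bool (fst e = i) * f e) = (\<Sum>j\<in>{1..n} - {i}. f (i, j))"
proof -
  have "(\<Sum>e\<in>offdiag n. of_bool (fst e = i) * f e) = (\<Sum>i'\<in>{1..n}. if i' = i then \<Sum>j\<in>{1..n} - {i'}. f (i', j) else 0)"
    unfolding sum_offdiag_rows by (intro sum.cong) auto
  then show ?thesis using assms by simp
qed

lemma sum_offdiag_column:
  fixes f :: "nat \<times> nat \<Rightarrow> real"
  assumes "j \<in> {1..n}"
  shows "(\<Sum>e\<in>offdiag n. of_bool (snd e = j) * f e) = (\<Sum>i\<in>{1..n} - {j}. f (i, j))"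
proof -
  have "(\<Sum>e\<in>offdiag n. of_bool (snd e = j) * f e) = (\<Sum>j'\<in>{1..n}. if j' = j then \<Sum>i\<in>{1..n} - {j'}. f (i, j') else 0)"
    unfolding sum_offdiag_columns by (intro sum.cong) auto
  then show ?thesis using assms by simp
qed

text \<open>Parameters out of range are pinned to 0 so that the box is compact in the product
  topology; as n is not in {1..n-1}, this includes the normalisation of \<beta> at n.\<close>

definition param_box :: "nat \<Rightarrow> real \<Rightarrow> real \<Rightarrow> ((nat \<Rightarrow> real) \<times> (nat \<Rightarrow> real)) set" where
  "param_box n R \<delta> = {p. (\<forall>i. fst p i \<in> (if i \<in> {1..n} then {- R..R} else {0})) \<and>
     (\<forall>j. snd p j \<in> (if j \<in> {1..n-1} then {- R..R} else {0})) \<and>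
     (\<forall>e\<in>offdiag n. \<delta> \<le> fst p (fst e) + snd p (snd e))}"

lemma continuous_on_fst_component [continuous_intros]:
  "continuous_on S (\<lambda>p :: (nat \<Rightarrow> real) \<times> (nat \<Rightarrow> real). fst p i)"
  by (rule continuous_on_product_then_coordinatewise[OF continuous_on_fst[OF continuous_on_id]])

lemma continuous_on_snd_component [continuous_intros]:
  "continuous_on S (\<lambda>p :: (nat \<Rightarrow> real) \<times> (nat \<Rightarrow> real). snd p i)"
  by (rule continuous_on_product_then_coordinatewise[OF continuous_on_snd[OF continuous_on_id]])

lemma compact_param_box: "compact (param_box n R \<delta>)"
proof -
  have "compact (PiE UNIV (\<lambda>i. if i \<in> {1..n} then {- R..R} else {0}) \<times>
      PiE UNIV (\<lambda>j. if j \<in> {1..n-1} then {- R..R} else {0}))" (is "compact ?A")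
    by (intro compact_Times compact_PiE_UNIV) auto
  moreover have "closed (\<Inter>e\<in>offdiag n. {p :: (nat \<Rightarrow> real) \<times> (nat \<Rightarrow> real). \<delta> \<le> fst p (fst e) + snd p (snd e)})" (is "closed ?B")
    by (intro closed_INT ballI closed_Collect_le continuous_intros)
  moreover have "param_box n R \<delta> = ?A \<inter> ?B"
    unfolding param_box_def
    by (simp add: set_eq_iff mem_Times_iff PiE_UNIV_domain Pi_def split del: if_split del: atLeastAtMost_iff)
  ultimately show ?thesis by (simp add: compact_Int_closed)
qed

definition neg_log_lik :: "nat \<Rightarrow> (nat \<times> nat \<Rightarrow> real) \<Rightarrow> (nat \<times> nat \<Rightarrow> real) \<Rightarrow> real" where
  "neg_log_lik n A w = (\<Sum>e\<in>offdiag n. A e * w e - ln (w e))"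

lemma linear_minus_ln_ge: "0 < a \<Longrightarrow> 0 < w \<Longrightarrow> 1 + ln a \<le> a * w - ln w" for a w :: real
  using ln_le_minus_one[of "a * w"] by (simp add: ln_mult)

text \<open>Each summand is bounded below in terms of A alone, so a bound on the sum bounds every
  single summand from above, and one summand is coercive in its rate at both 0 and infinity.\<close>

lemma neg_log_lik_sublevel:
  assumes A: "\<And>e. e \<in> offdiag n \<Longrightarrow> 0 < A e"
  obtains \<delta> W where "0 < \<delta>"
    "\<And>w e. (\<And>e. e \<in> offdiag n \<Longrightarrow> 0 < w e) \<Longrightarrow> neg_log_lik n A w \<le> c \<Longrightarrow> e \<in> offdiag n \<Longrightarrow> \<delta> \<le> w e \<and> w e \<le> W"
proof -
  define B where "B = c + (\<Sum>e\<in>offdiag n. \<bar>1 + ln (A e)\<bar>)"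
  define W where "W = (\<Sum>e\<in>offdiag n. 2 / A e * \<bar>B + ln (2 / A e)\<bar>)"
  show ?thesis
  proof (rule that[of "exp (- B)" W])
    fix w e
    assume w: "\<And>e. e \<in> offdiag n \<Longrightarrow> 0 < w e" and c: "neg_log_lik n A w \<le> c" and e: "e \<in> offdiag n"
    have "(A e * w e - ln (w e)) - (\<Sum>e\<in>offdiag n - {e}. \<bar>1 + ln (A e)\<bar>)
        \<le> (A e * w e - ln (w e)) + (\<Sum>e\<in>offdiag n - {e}. A e * w e - ln (w e))"
    proof -
      have "- (\<Sum>e\<in>offdiag n - {e}. \<bar>1 + ln (A e)\<bar>) \<le> (\<Sum>e\<in>offdiag n - {e}. A e * w e - ln (w e))"
        unfolding sum_negf[symmetric]
      proof (rule sum_mono)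
        fix x assume "x \<in> offdiag n - {e}"
        then show "- \<bar>1 + ln (A x)\<bar> \<le> A x * w x - ln (w x)"
          using linear_minus_ln_ge[of "A x" "w x"] A[of x] w[of x] by auto
      qed
      then show ?thesis by simp
    qed
    also have "\<dots> = neg_log_lik n A w"
      unfolding neg_log_lik_def using e by (simp add: sum.remove)
    also have "\<dots> \<le> c" by fact
    finally have "A e * w e - ln (w e) \<le> c + (\<Sum>e\<in>offdiag n - {e}. \<bar>1 + ln (A e)\<bar>)" by simp
    also have "\<dots> \<le> B" unfolding B_def by (intro add_left_mono sum_mono2) auto
    finally have t: "A e * w e - ln (w e) \<le> B" .
    have Aw: "0 < A e * w e" using A[OF e] w[OF e] by simp
    then have "- B \<le> ln (w e)" using t by linarith
    then have 1: "exp (- B) \<le> w e" using w[OF e] by (simp add: ln_ge_iff)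
    \<comment> \<open>Half of the linear term absorbs the logarithm; the other half bounds w
      e.\<close>
    have "1 + ln (A e / 2) \<le> A e / 2 * w e - ln (w e)"
      using A[OF e] w[OF e] by (intro linear_minus_ln_ge) auto
    then have "A e / 2 * w e \<le> B - ln (A e / 2)" using t by (simp add: field_simps)
    also have "- ln (A e / 2) = ln (2 / A e)" using A[OF e] by (simp add: ln_div)
    then have "B - ln (A e / 2) \<le> \<bar>B + ln (2 / A e)\<bar>" by linarith
    finally have "w e \<le> 2 / A e * \<bar>B + ln (2 / A e)\<bar>" using A[OF e] by (simp add: field_simps)
    also have "\<dots> \<le> W" unfolding W_def
    proof (rule member_le_sum[OF e])
      fix x assume "x \<in> offdiag n - {e}"
      then show "0 \<le> 2 / A x * \<bar>B + ln (2 / A x)\<bar>" using A[of x] by simp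
    qed simp
    finally show "exp (- B) \<le> w e \<and> w e \<le> W" using 1 by simp
  qed simp
qed

text \<open>The direction \<eta> will be the indicator of a row or of a column, for which
  stationarity is one likelihood equation. Its entries lie in [0, 1], so all rates stay positive for
  steps shorter than d.\<close>

lemma neg_log_lik_stationary:
  assumes w: "\<And>e. e \<in> offdiag n \<Longrightarrow> 0 < w e" and \<eta>: "\<And>e. 0 \<le> \<eta> e \<and> \<eta> e \<le> 1"
    and min: "\<And>t. (\<And>e. e \<in> offdiag n \<Longrightarrow> 0 < w e + t * \<eta> e) \<Longrightarrow> neg_log_lik n A w \<le> neg_log_lik n A (\<lambda>e. w e + t * \<eta> e)"
  shows "(\<Sum>e\<in>offdiag n. \<eta> e * (A e - 1 / w e)) = 0"
proof -
  define d where "d = Min (insert 1 (w ` offdiag n))"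
  have d: "0 < d" "\<And>e. e \<in> offdiag n \<Longrightarrow> d \<le> w e" using w by (auto simp: d_def)
  have "((\<lambda>t. neg_log_lik n A (\<lambda>e. w e + t * \<eta> e)) has_real_derivative
      (\<Sum>e\<in>offdiag n. \<eta> e * (A e - 1 / w e))) (at 0)"
    unfolding neg_log_lik_def
    by (rule DERIV_sum) (use w in \<open>fastforce intro!: derivative_eq_intros simp: field_simps\<close>)
  then show ?thesis
  proof (rule DERIV_local_min[OF _ d(1)], intro allI impI)
    fix t :: real assume t: "\<bar>0 - t\<bar> < d"
    have "0 < w e + t * \<eta> e" if e: "e \<in> offdiag n" for e
    proof -
      have "\<bar>t * \<eta> e\<bar> \<le> \<bar>t\<bar>" using \<eta>[of e] by (simp add: abs_mult mult_left_le)
      then show ?thesis using d(2)[OF e] t by linarith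
    qed
    then show "neg_log_lik n A (\<lambda>e. w e + 0 * \<eta> e) \<le> neg_log_lik n A (\<lambda>e. w e + t * \<eta> e)"
      using min[of t] by simp
  qed
qed

text \<open>The likelihood depends on the rates alone, so a sublevel set bounds the rates, and the
  normalisation turns this into bounds for the parameters. A minimiser over a compact box containing
  the sublevel set of p0 is a global one, and moving one parameter at a time gives the likelihood
  equations.\<close>

lemma mle_exists:
  assumes n: "3 \<le> n" and A: "\<And>e. e \<in> offdiag n \<Longrightarrow> 0 < A e"
  shows "\<exists>\<alpha> \<beta>. is_mle n A \<alpha> \<beta>"
proof -
  define wt where "wt p e = fst p (fst e) + snd p (snd e)" for p :: "(nat \<Rightarrow> real) \<times> (nat \<Rightarrow> real)" and e :: "nat \<times> nat"
  define D where "D = {p. (\<forall>i. i \<notin> {1..n} \<longrightarrow> fst p i = 0) \<and> (\<forall>j. j \<notin> {1..n-1} \<longrightarrow> snd p j = 0) \<and>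
    (\<forall>e\<in>offdiag n. 0 < wt p e)}"
  define p0 :: "(nat \<Rightarrow> real) \<times> (nat \<Rightarrow> real)" where "p0 = (\<lambda>i. if i \<in> {1..n} then 1 else 0, \<lambda>_. 0)"
  define F where "F p = neg_log_lik n A (wt p)" for p
  have p0: "p0 \<in> D" by (auto simp: p0_def D_def wt_def offdiag_def)
  obtain \<delta> W where \<delta>: "0 < \<delta>" and W: "\<And>w e. (\<And>e. e \<in> offdiag n \<Longrightarrow> 0 < w e) \<Longrightarrow>
      neg_log_lik n A w \<le> F p0 \<Longrightarrow> e \<in> offdiag n \<Longrightarrow> \<delta> \<le> w e \<and> w e \<le> W"
    by (rule neg_log_lik_sublevel[of n A "F p0"]) (use A in blast)+
  have inbox: "p \<in> param_box n (2 * W) \<delta>" if p: "p \<in> D" "F p \<le> F p0" for p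
  proof -
    have w: "\<delta> \<le> wt p e \<and> wt p e \<le> W" if "e \<in> offdiag n" for e
      using W[of "wt p" e] p that by (auto simp: D_def F_def)
    \<comment> \<open>Column n bounds \<alpha> i for i < n; a row other than j and n, available
      since n >= 3, bounds \<beta> j; column 1 bounds \<alpha> n at the price of 2 * W.\<close>
    have pn: "snd p n = 0" using p n by (auto simp: D_def)
    have a: "0 \<le> fst p i \<and> fst p i \<le> W" if "i \<in> {1..n}" "i \<noteq> n" for i
      using w[of "(i, n)"] that pn \<delta> n by (auto simp: wt_def mem_offdiag)
    have b: "\<bar>snd p j\<bar> \<le> W" if j: "j \<in> {1..n-1}" for j
    proof -
      obtain i where i: "i \<in> {1..n}" "i \<noteq> n" "i \<noteq> j"
      proof (cases "j = 1")
        case True then show ?thesis using that[of 2] n by auto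
      next
        case False then show ?thesis using that[of 1] n by auto
      qed
      moreover have "j \<in> {1..n}" using j by auto
      ultimately show ?thesis using w[of "(i, j)"] a[of i] \<delta> by (auto simp: wt_def mem_offdiag)
    qed
    have "1 \<in> {1..n-1}" using n by auto
    from b[OF this] have an: "\<bar>fst p n\<bar> \<le> 2 * W"
      using w[of "(n, 1)"] n \<delta> by (auto simp: wt_def mem_offdiag)
    have "0 \<le> W" using a[of 1] n by auto
    show ?thesis unfolding param_box_def
    proof (intro CollectI conjI allI ballI)
      fix i show "fst p i \<in> (if i \<in> {1..n} then {- (2 * W)..2 * W} else {0})"
        using a[of i] an p(1) \<open>0 \<le> W\<close> by (cases "i = n") (auto simp: D_def abs_le_iff)
      show "snd p i \<in> (if i \<in> {1..n-1} then {- (2 * W)..2 * W} else {0})"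
        using b[of i] p(1) \<open>0 \<le> W\<close> by (auto simp: D_def abs_le_iff)
    qed (use w in \<open>auto simp: wt_def\<close>)
  qed
  have "\<exists>p\<in>param_box n (2 * W) \<delta>. \<forall>r\<in>param_box n (2 * W) \<delta>. F p \<le> F r"
  proof (rule continuous_attains_inf[OF compact_param_box])
    show "param_box n (2 * W) \<delta> \<noteq> {}" using inbox[OF p0] by auto
    show "continuous_on (param_box n (2 * W) \<delta>) F"
      unfolding F_def neg_log_lik_def wt_def
      by (intro continuous_intros) (use \<delta> in \<open>auto simp: param_box_def\<close>)
  qed
  then obtain p where p: "p \<in> param_box n (2 * W) \<delta>" "\<And>r. r \<in> param_box n (2 * W) \<delta> \<Longrightarrow> F p \<le> F r" by blast
  have pD: "p \<in> D" using p(1) \<delta> unfolding param_box_def D_def wt_def by (fastforce split: if_splits)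
  have min: "F p \<le> F r" if "r \<in> D" for r
    using inbox[OF that] inbox[OF p0] p(2)[of r] p(2)[of p0] by fastforce
  have wp: "0 < wt p e" if "e \<in> offdiag n" for e using pD that by (auto simp: D_def)
  have row: "(\<Sum>e\<in>offdiag n. of_bool (fst e = i) * (A e - 1 / wt p e)) = 0" if i: "i \<in> {1..n}" for i
  proof (rule neg_log_lik_stationary[OF wp])
    fix t assume t: "\<And>e. e \<in> offdiag n \<Longrightarrow> 0 < wt p e + t * of_bool (fst e = i)"
    define r where "r = ((fst p)(i := fst p i + t), snd p)"
    have wr: "wt r = (\<lambda>e. wt p e + t * of_bool (fst e = i))" by (auto simp: wt_def r_def)
    have "r \<in> D" unfolding D_def mem_Collect_eq wr using pD i t by (auto simp: r_def D_def)
    from min[OF this] show "neg_log_lik n A (wt p) \<le> neg_log_lik n A (\<lambda>e. wt p e + t * of_bool (fst e = i))"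
      unfolding F_def wr .
  qed auto
  have col: "(\<Sum>e\<in>offdiag n. of_bool (snd e = j) * (A e - 1 / wt p e)) = 0" if j: "j \<in> {1..n-1}" for j
  proof (rule neg_log_lik_stationary[OF wp])
    fix t assume t: "\<And>e. e \<in> offdiag n \<Longrightarrow> 0 < wt p e + t * of_bool (snd e = j)"
    define r where "r = (fst p, (snd p)(j := snd p j + t))"
    have wr: "wt r = (\<lambda>e. wt p e + t * of_bool (snd e = j))" by (auto simp: wt_def r_def)
    have "r \<in> D" unfolding D_def mem_Collect_eq wr using pD j t by (auto simp: r_def D_def)
    from min[OF this] show "neg_log_lik n A (wt p) \<le> neg_log_lik n A (\<lambda>e. wt p e + t * of_bool (snd e = j))"
      unfolding F_def wr .
  qed auto
  have "is_mle n A (fst p) (snd p)"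
    unfolding is_mle_def
  proof (intro conjI ballI impI)
    show "snd p n = 0" using pD n by (auto simp: D_def)
    show "0 < fst p i + snd p j" if "i \<in> {1..n}" "j \<in> {1..n}" "i \<noteq> j" for i j
      using wp[of "(i, j)"] that by (simp add: wt_def mem_offdiag)
    show "out_deg n A i = (\<Sum>k\<in>{1..n} - {i}. 1 / (fst p i + snd p k))" if "i \<in> {1..n}" for i
      using row[OF that] unfolding sum_offdiag_row[OF that] by (simp add: out_deg_def wt_def sum_subtractf)
    show "in_deg n A j = (\<Sum>k\<in>{1..n} - {j}. 1 / (fst p k + snd p j))" if "j \<in> {1..n-1}" for j
    proof -
      have "j \<in> {1..n}" using that by auto
      from col[OF that, unfolded sum_offdiag_column[OF this]] show ?thesis
        by (simp add: in_deg_def wt_def sum_subtractf)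
    qed
  qed
  then show ?thesis by blast
qed

text \<open>Monotonicity of 1 / w: by the equations the sum of (w e - w' e) * (1 / w e - 1 / w' e)
  vanishes, while no term is positive, so the rates agree. In column n the factor \<beta> n -
  \<beta>' n = 0 stands in for the equation absent from \<open>is_mle\<close>.\<close>

lemma is_mle_unique:
  assumes n: "3 \<le> n" and m: "is_mle n A \<alpha> \<beta>" "is_mle n A \<alpha>' \<beta>'" and i: "i \<in> {1..n}"
  shows "\<alpha> i = \<alpha>' i"
proof -
  define w w' where "w = (\<lambda>e. \<alpha> (fst e) + \<beta> (snd e))" and "w' = (\<lambda>e. \<alpha>' (fst e) + \<beta>' (snd e))"
  have pos: "0 < w e" "0 < w' e" if "e \<in> offdiag n" for e
    using m that by (auto simp: is_mle_def w_def w'_def offdiag_def)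
  have \<beta>n: "\<beta> n = 0" "\<beta>' n = 0" using m by (auto simp: is_mle_def)
  define g where "g e = 1 / w e - 1 / w' e" for e
  have "(\<Sum>e\<in>offdiag n. (w e - w' e) * g e) =
      (\<Sum>e\<in>offdiag n. (\<alpha> (fst e) - \<alpha>' (fst e)) * g e) + (\<Sum>e\<in>offdiag n. (\<beta> (snd e) - \<beta>' (snd e)) * g e)"
    unfolding sum.distrib[symmetric] by (intro sum.cong) (auto simp: w_def w'_def algebra_simps)
  also have "(\<Sum>e\<in>offdiag n. (\<alpha> (fst e) - \<alpha>' (fst e)) * g e) = (\<Sum>i\<in>{1..n}. (\<alpha> i - \<alpha>' i) * (\<Sum>j\<in>{1..n} - {i}. g (i, j)))"
    unfolding sum_offdiag_rows by (simp add: sum_distrib_left)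
  also have "\<dots> = 0"
  proof (intro sum.neutral ballI)
    fix i assume "i \<in> {1..n}"
    then have "(\<Sum>j\<in>{1..n} - {i}. g (i, j)) = 0"
      using m unfolding is_mle_def g_def w_def w'_def by (simp add: sum_subtractf)
    then show "(\<alpha> i - \<alpha>' i) * (\<Sum>j\<in>{1..n} - {i}. g (i, j)) = 0" by simp
  qed
  also have "(\<Sum>e\<in>offdiag n. (\<beta> (snd e) - \<beta>' (snd e)) * g e) = (\<Sum>j\<in>{1..n}. (\<beta> j - \<beta>' j) * (\<Sum>i\<in>{1..n} - {j}. g (i, j)))"
    unfolding sum_offdiag_columns by (simp add: sum_distrib_left)
  also have "\<dots> = 0"
  proof (intro sum.neutral ballI)
    fix j assume j: "j \<in> {1..n}"
    show "(\<beta> j - \<beta>' j) * (\<Sum>i\<in>{1..n} - {j}. g (i, j)) = 0"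
    proof (cases "j = n")
      case False
      then have "j \<in> {1..n-1}" using j by auto
      then have "(\<Sum>i\<in>{1..n} - {j}. g (i, j)) = 0"
        using m unfolding is_mle_def g_def w_def w'_def by (simp add: sum_subtractf)
      then show ?thesis by simp
    qed (simp add: \<beta>n)
  qed
  finally have 0: "(\<Sum>e\<in>offdiag n. - ((w e - w' e) * g e)) = 0" by (simp add: sum_negf)
  have g: "- ((w e - w' e) * g e) = (w e - w' e)^2 / (w e * w' e)" if "e \<in> offdiag n" for e
    using pos[OF that] by (simp add: g_def field_simps power2_eq_square)
  have "\<forall>e\<in>offdiag n. - ((w e - w' e) * g e) = 0"
  proof (subst sum_nonneg_eq_0_iff[symmetric])
    fix e assume e: "e \<in> offdiag n"
    show "0 \<le> - ((w e - w' e) * g e)" unfolding g[OF e] using pos[OF e] by simp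
  qed (use 0 in auto)
  then have eq: "w e = w' e" if "e \<in> offdiag n" for e
    using g[OF that] pos[OF that] that by auto
  have a: "\<alpha> i = \<alpha>' i" if "i \<in> {1..n}" "i \<noteq> n" for i
    using eq[of "(i, n)"] that n \<beta>n by (auto simp: w_def w'_def mem_offdiag)
  have "\<beta> 1 = \<beta>' 1" using eq[of "(2, 1)"] a[of 2] n by (auto simp: w_def w'_def mem_offdiag)
  then have "\<alpha> n = \<alpha>' n" using eq[of "(n, 1)"] n by (auto simp: w_def w'_def mem_offdiag)
  then show ?thesis using a i by blast
qed

section \<open>Measurability of the chosen solution\<close>

lemma is_mle_mle:
  assumes "is_mle n A \<alpha> \<beta>"
  shows "is_mle n A (fst (mle n A)) (snd (mle n A))"
  unfolding mle_def by (rule someI[of "\<lambda>p. is_mle n A (fst p) (snd p)" "(\<alpha>, \<beta>)"]) (use assms in simp)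

text \<open>The sufficient statistic. Padding with 0 turns the likelihood equations into one
  equality of functions, \<open>degree_map n A = mean_map n p\<close>.\<close>

definition degree_map :: "nat \<Rightarrow> (nat \<times> nat \<Rightarrow> real) \<Rightarrow> (nat \<Rightarrow> real) \<times> (nat \<Rightarrow> real)" where
  "degree_map n A = (\<lambda>i. if i \<in> {1..n} then out_deg n A i else 0, \<lambda>j. if j \<in> {1..n-1} then in_deg n A j else 0)"

definition mean_map :: "nat \<Rightarrow> (nat \<Rightarrow> real) \<times> (nat \<Rightarrow> real) \<Rightarrow> (nat \<Rightarrow> real) \<times> (nat \<Rightarrow> real)" where
  "mean_map n p = (\<lambda>i. if i \<in> {1..n} then \<Sum>k\<in>{1..n} - {i}. 1 / (fst p i + snd p k) else 0,
    \<lambda>j. if j \<in> {1..n-1} then \<Sum>k\<in>{1..n} - {j}. 1 / (fst p k + snd p j) else 0)"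

lemma is_mle_iff_mean_map:
  "is_mle n A (fst p) (snd p) \<longleftrightarrow> snd p n = 0 \<and> (\<forall>e\<in>offdiag n. 0 < fst p (fst e) + snd p (snd e)) \<and> degree_map n A = mean_map n p"
  unfolding is_mle_def degree_map_def mean_map_def offdiag_def prod.inject fun_eq_iff by auto

text \<open>The solvable data sets form a countable union of compact sets in the degree coordinates, so the
  estimator is measurable although it is only a choice among the solutions.\<close>

lemma mle_restricted_set_measurable:
  assumes n: "3 \<le> n" and l: "l \<in> {1..n}" and T: "degree_map n \<in> borel_measurable M"
  shows "{A \<in> space M. \<exists>\<alpha> \<beta>. is_mle n A \<alpha> \<beta> \<and> \<alpha> l \<le> c} \<in> sets M"
proof -
  define C where "C m = param_box n (real m) (1 / real (Suc m)) \<inter> {p. fst p l \<le> c}" for m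
  have comp: "compact (C m)" for m
    unfolding C_def by (intro compact_Int_closed compact_param_box closed_Collect_le continuous_intros)
  have pos: "0 < fst p (fst e) + snd p (snd e)" if "p \<in> C m" "e \<in> offdiag n" for p m e
  proof -
    have "0 < 1 / real (Suc m)" by simp
    also have "\<dots> \<le> fst p (fst e) + snd p (snd e)" using that by (auto simp: C_def param_box_def)
    finally show ?thesis .
  qed
  have "continuous_on (C m) (mean_map n)" for m
    unfolding mean_map_def
  proof (intro continuous_on_Pair continuous_on_coordinatewise_then_product)
    fix i
    show "continuous_on (C m) (\<lambda>x. if i \<in> {1..n} then \<Sum>k\<in>{1..n} - {i}. 1 / (fst x i + snd x k) else 0)"
    proof (cases "i \<in> {1..n}")
      case True
      have "continuous_on (C m) (\<lambda>x. \<Sum>k\<in>{1..n} - {i}. 1 / (fst x i + snd x k))"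
      proof (intro continuous_intros ballI)
        fix k p assume "k \<in> {1..n} - {i}" "p \<in> C m"
        then show "fst p i + snd p k \<noteq> 0" using pos[of p m "(i, k)"] True by (auto simp: mem_offdiag)
      qed
      then show ?thesis using True by simp
    qed (auto intro: continuous_on_const)
    show "continuous_on (C m) (\<lambda>x. if i \<in> {1..n-1} then \<Sum>k\<in>{1..n} - {i}. 1 / (fst x k + snd x i) else 0)"
    proof (cases "i \<in> {1..n-1}")
      case True
      then have "i \<in> {1..n}" by auto
      have "continuous_on (C m) (\<lambda>x. \<Sum>k\<in>{1..n} - {i}. 1 / (fst x k + snd x i))"
      proof (intro continuous_intros ballI)
        fix k p assume "k \<in> {1..n} - {i}" "p \<in> C m"
        then show "fst p k + snd p i \<noteq> 0" using pos[of p m "(k, i)"] True \<open>i \<in> {1..n}\<close> by (auto simp: mem_offdiag)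
      qed
      then show ?thesis using True by simp
    qed (auto intro: continuous_on_const)
  qed
  then have "mean_map n ` C m \<in> sets borel" for m
    using comp by (intro borel_closed compact_imp_closed compact_continuous_image)
  then have meas: "{A \<in> space M. degree_map n A \<in> mean_map n ` C m} \<in> sets M" for m
    using measurable_sets[OF T, of "mean_map n ` C m"] by (simp add: vimage_def Int_def conj_commute)
  have "{A \<in> space M. \<exists>\<alpha> \<beta>. is_mle n A \<alpha> \<beta> \<and> \<alpha> l \<le> c} = (\<Union>m. {A \<in> space M. degree_map n A \<in> mean_map n ` C m})"
  proof (intro equalityI subsetI)
    fix A assume "A \<in> {A \<in> space M. \<exists>\<alpha> \<beta>. is_mle n A \<alpha> \<beta> \<and> \<alpha> l \<le> c}"
    then obtain \<alpha> \<beta> where A: "A \<in> space M" "is_mle n A \<alpha> \<beta>" "\<alpha> l \<le> c" by auto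
    define p where "p = (\<lambda>i. if i \<in> {1..n} then \<alpha> i else 0, \<lambda>j. if j \<in> {1..n-1} then \<beta> j else 0)"
    have \<beta>n: "\<beta> n = 0" using A(2) by (simp add: is_mle_def)
    have s: "snd p j = \<beta> j" if "j \<in> {1..n}" for j
      using that \<beta>n by (cases "j = n") (auto simp: p_def)
    have f: "fst p j = \<alpha> j" if "j \<in> {1..n}" for j
      using that by (auto simp: p_def)
    have "is_mle n A (fst p) (snd p)"
      using A(2) n unfolding is_mle_def by (auto simp: s f)
    then have mp: "\<forall>e\<in>offdiag n. 0 < fst p (fst e) + snd p (snd e)" "degree_map n A = mean_map n p"
      unfolding is_mle_iff_mean_map by auto
    \<comment> \<open>The index m has to exceed every parameter in absolute value and every
      reciprocal rate.\<close>
    define R where "R = (\<Sum>i\<in>{1..n}. \<bar>\<alpha> i\<bar> + \<bar>\<beta> i\<bar>) + (\<Sum>e\<in>offdiag n. 1 / (fst p (fst e) + snd p (snd e)))"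
    obtain m :: nat where m: "R \<le> real m" using real_arch_simple by blast
    have nn: "0 \<le> (\<Sum>e\<in>offdiag n. 1 / (fst p (fst e) + snd p (snd e)))" "0 \<le> (\<Sum>i\<in>{1..n}. \<bar>\<alpha> i\<bar> + \<bar>\<beta> i\<bar>)"
      using mp(1) by (intro sum_nonneg; simp add: less_imp_le)+
    have ab: "\<bar>\<alpha> i\<bar> + \<bar>\<beta> i\<bar> \<le> real m" if "i \<in> {1..n}" for i
    proof -
      have "\<bar>\<alpha> i\<bar> + \<bar>\<beta> i\<bar> \<le> (\<Sum>i\<in>{1..n}. \<bar>\<alpha> i\<bar> + \<bar>\<beta> i\<bar>)" using that by (intro member_le_sum) auto
      then show ?thesis using m nn by (simp add: R_def)
    qed
    have ew: "1 / real (Suc m) \<le> fst p (fst e) + snd p (snd e)" if e: "e \<in> offdiag n" for e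
    proof -
      have "1 / (fst p (fst e) + snd p (snd e)) \<le> (\<Sum>e\<in>offdiag n. 1 / (fst p (fst e) + snd p (snd e)))"
        using e mp(1) by (intro member_le_sum) (auto intro: less_imp_le)
      then have "1 / (fst p (fst e) + snd p (snd e)) \<le> real (Suc m)" using m nn by (simp add: R_def)
      then show ?thesis using mp(1) e by (simp add: field_simps)
    qed
    have "p \<in> C m" unfolding C_def param_box_def
    proof (intro IntI CollectI conjI allI ballI)
      fix i show "fst p i \<in> (if i \<in> {1..n} then {- real m..real m} else {0})"
        using ab[of i] by (auto simp: p_def)
      show "snd p i \<in> (if i \<in> {1..n-1} then {- real m..real m} else {0})"
      proof (cases "i \<in> {1..n-1}")
        case True
        then have "i \<in> {1..n}" by auto
        from ab[OF this] True show ?thesis by (auto simp: p_def)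
      qed (auto simp: p_def)
      show "fst p l \<le> c" using A(3) l f by simp
    qed (use ew in auto)
    then show "A \<in> (\<Union>m. {A \<in> space M. degree_map n A \<in> mean_map n ` C m})" using A(1) mp(2) by auto
  next
    fix A assume "A \<in> (\<Union>m. {A \<in> space M. degree_map n A \<in> mean_map n ` C m})"
    then obtain m p where A: "A \<in> space M" "p \<in> C m" "degree_map n A = mean_map n p" by auto
    have "snd p n = 0" using A(2) n by (auto simp: C_def param_box_def split: if_splits dest!: spec[of _ n])
    then have "is_mle n A (fst p) (snd p)" unfolding is_mle_iff_mean_map using A pos[OF A(2)] by auto
    moreover have "fst p l \<le> c" using A(2) by (auto simp: C_def)
    ultimately show "A \<in> {A \<in> space M. \<exists>\<alpha> \<beta>. is_mle n A \<alpha> \<beta> \<and> \<alpha> l \<le> c}" using A(1) by auto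
  qed
  then show ?thesis using meas by (simp add: sets.countable_UN)
qed

text \<open>Where a solution exists, uniqueness identifies its \<alpha>-part with the chosen one, so
  the restricted sets of the previous lemma are level sets of the estimator; elsewhere the estimator
  is constant.\<close>

lemma mle_measurable:
  assumes n: "3 \<le> n" and l: "l \<in> {1..n}" and T: "degree_map n \<in> borel_measurable M"
  shows "(\<lambda>A. fst (mle n A) l) \<in> borel_measurable M"
  unfolding borel_measurable_iff_le
proof
  fix c
  define G where "G c = {A \<in> space M. \<exists>\<alpha> \<beta>. is_mle n A \<alpha> \<beta> \<and> \<alpha> l \<le> c}" for c
  have G: "G c \<in> sets M" for c unfolding G_def using assms by (rule mle_restricted_set_measurable)
  define E where "E = (\<Union>m. G (real m))"
  have E: "E \<in> sets M" unfolding E_def using G by auto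
  have E_iff: "A \<in> E \<longleftrightarrow> A \<in> space M \<and> (\<exists>\<alpha> \<beta>. is_mle n A \<alpha> \<beta>)" for A
  proof
    assume "A \<in> space M \<and> (\<exists>\<alpha> \<beta>. is_mle n A \<alpha> \<beta>)"
    then obtain \<alpha> \<beta> where A: "A \<in> space M" "is_mle n A \<alpha> \<beta>" by blast
    obtain m where "\<alpha> l \<le> real m" using real_arch_simple by blast
    then show "A \<in> E" using A unfolding E_def G_def by blast
  qed (auto simp: E_def G_def)
  \<comment> \<open>A choice depends only on the predicate, and for all unsolvable data this is the
    predicate that is false everywhere.\<close>
  define c0 :: "(nat \<Rightarrow> real) \<times> (nat \<Rightarrow> real)" where "c0 = (SOME p. False)"
  have none: "mle n A = c0" if "A \<in> space M" "A \<notin> E" for A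
  proof -
    have "\<not> is_mle n A (fst p) (snd p)" for p using that E_iff by blast
    then show ?thesis by (simp add: mle_def c0_def)
  qed
  have some: "fst (mle n A) l = \<alpha> l" if "is_mle n A \<alpha> \<beta>" for A \<alpha> \<beta>
    using is_mle_unique[OF n is_mle_mle[OF that] that l] .
  have "{A \<in> space M. fst (mle n A) l \<le> c} = G c \<union> (if fst c0 l \<le> c then space M - E else {})"
  proof (intro set_eqI iffI)
    fix A assume A: "A \<in> {A \<in> space M. fst (mle n A) l \<le> c}"
    then show "A \<in> G c \<union> (if fst c0 l \<le> c then space M - E else {})"
    proof (cases "A \<in> E")
      case True
      then obtain \<alpha> \<beta> where "is_mle n A \<alpha> \<beta>" using E_iff by blast
      then have "A \<in> G c" using A some unfolding G_def by auto
      then show ?thesis by simp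
    qed (use A none in auto)
  next
    fix A assume A: "A \<in> G c \<union> (if fst c0 l \<le> c then space M - E else {})"
    then show "A \<in> {A \<in> space M. fst (mle n A) l \<le> c}"
      using some none unfolding G_def by (auto split: if_splits)
  qed
  then show "{A \<in> space M. fst (mle n A) l \<le> c} \<in> sets M" using G E by auto
qed

section \<open>The model at a fixed size\<close>

locale cw_bounded =
  fixes n :: nat and \<alpha> \<beta> :: "nat \<Rightarrow> real" and q Q :: real
  assumes n3: "3 \<le> n" and beta_n: "\<beta> n = 0" and q0: "0 < q" and qQ: "q \<le> Q"
    and bounds: "\<And>i j. i \<in> {1..n} \<Longrightarrow> j \<in> {1..n} \<Longrightarrow> i \<noteq> j \<Longrightarrow> q \<le> \<alpha> i + \<beta> j \<and> \<alpha> i + \<beta> j \<le> Q"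
begin

definition rate :: "nat \<times> nat \<Rightarrow> real" where
  "rate e = \<alpha> (fst e) + \<beta> (snd e)"

text \<open>The variance of the out-degree of i, and at the same time its diagonal Fisher
  information.\<close>

definition row_info :: "nat \<Rightarrow> real" where
  "row_info i = (\<Sum>k\<in>{1..n} - {i}. 1 / (\<alpha> i + \<beta> k)^2)"

definition col_info :: "nat \<Rightarrow> real" where
  "col_info k = (\<Sum>i\<in>{1..n} - {k}. 1 / (\<alpha> i + \<beta> k)^2)"

definition row_dev :: "(nat \<times> nat \<Rightarrow> real) \<Rightarrow> nat \<Rightarrow> real" where
  "row_dev A i = (\<Sum>k\<in>{1..n} - {i}. A (i, k) - 1 / (\<alpha> i + \<beta> k))"

definition col_dev :: "(nat \<times> nat \<Rightarrow> real) \<Rightarrow> nat \<Rightarrow> real" where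
  "col_dev A k = (\<Sum>i\<in>{1..n} - {k}. A (i, k) - 1 / (\<alpha> i + \<beta> k))"

text \<open>Single degrees, their weighted averages and the leading term of the estimator all have
  this form, so one tail bound and one characteristic function serve for all.\<close>

definition lin_dev :: "(nat \<Rightarrow> real) \<Rightarrow> (nat \<Rightarrow> real) \<Rightarrow> (nat \<times> nat \<Rightarrow> real) \<Rightarrow> real" where
  "lin_dev f g A = (\<Sum>i\<in>{1..n}. f i * row_dev A i) + (\<Sum>k\<in>{1..n}. g k * col_dev A k)"

abbreviation M :: "(nat \<times> nat \<Rightarrow> real) measure" where
  "M \<equiv> cw_model n \<alpha> \<beta>"

section \<open>Variances, tail bounds and the good event\<close>

lemma Q0: "0 < Q" using q0 qQ by simp

lemma rate_bounds: "e \<in> offdiag n \<Longrightarrow> q \<le> rate e \<and> rate e \<le> Q"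
  using bounds by (auto simp: rate_def offdiag_def)

lemma rate_pos: "e \<in> offdiag n \<Longrightarrow> 0 < rate e"
  using rate_bounds[of e] q0 by linarith

lemma offdiag_nonempty: "offdiag n \<noteq> {}"
proof -
  have "(1, 2) \<in> offdiag n" using n3 by (simp add: offdiag_def)
  then show ?thesis by blast
qed

lemma M_eq: "M = PiM (offdiag n) (\<lambda>e. exp_law (rate e))"
  by (simp add: cw_model_def rate_def case_prod_unfold)

sublocale prob_space M
  unfolding M_eq using rate_pos by (rule prob_space_exp_product)

lemma component_measurable [measurable]: "e \<in> offdiag n \<Longrightarrow> (\<lambda>A. A e) \<in> borel_measurable M"
  unfolding M_eq by (rule exp_product_component_measurable)

lemma row_dev_measurable [measurable]: "i \<in> {1..n} \<Longrightarrow> (\<lambda>A. row_dev A i) \<in> borel_measurable M"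
  unfolding row_dev_def
  by (intro borel_measurable_sum borel_measurable_diff component_measurable) (auto simp: mem_offdiag)

lemma col_dev_measurable [measurable]: "i \<in> {1..n} \<Longrightarrow> (\<lambda>A. col_dev A i) \<in> borel_measurable M"
  unfolding col_dev_def
  by (intro borel_measurable_sum borel_measurable_diff component_measurable) (auto simp: mem_offdiag)

lemma lin_dev_measurable [measurable]: "lin_dev f g \<in> borel_measurable M"
  unfolding lin_dev_def
  by (intro borel_measurable_add borel_measurable_sum borel_measurable_times row_dev_measurable col_dev_measurable) auto

lemma lin_dev_eq: "lin_dev f g A = centered_sum (offdiag n) rate (\<lambda>e. f (fst e) + g (snd e)) A"
proof -
  have "centered_sum (offdiag n) rate (\<lambda>e. f (fst e) + g (snd e)) A =
      (\<Sum>e\<in>offdiag n. f (fst e) * (A e - 1 / rate e)) + (\<Sum>e\<in>offdiag n. g (snd e) * (A e - 1 / rate e))"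
    unfolding centered_sum_def by (simp add: distrib_right sum.distrib)
  then show ?thesis
    unfolding sum_offdiag_rows[of "\<lambda>e. f (fst e) * (A e - 1 / rate e)"]
      sum_offdiag_columns[of "\<lambda>e. g (snd e) * (A e - 1 / rate e)"]
    by (simp add: lin_dev_def row_dev_def col_dev_def rate_def sum_distrib_left)
qed

text \<open>The out-degree of i and the in-degree of k have just the entry (i, k) in common, which
  produces the cross sum.\<close>

lemma variance_eq:
  "(\<Sum>e\<in>offdiag n. ((f (fst e) + g (snd e)) / rate e)^2) =
    (\<Sum>i\<in>{1..n}. (f i)^2 * row_info i) + (\<Sum>k\<in>{1..n}. (g k)^2 * col_info k)
    + 2 * (\<Sum>e\<in>offdiag n. f (fst e) * g (snd e) / (rate e)^2)"
proof -
  have "(\<Sum>e\<in>offdiag n. ((f (fst e) + g (snd e)) / rate e)^2) =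
      (\<Sum>e\<in>offdiag n. (f (fst e))^2 * (1 / (rate e)^2)) + (\<Sum>e\<in>offdiag n. (g (snd e))^2 * (1 / (rate e)^2))
      + 2 * (\<Sum>e\<in>offdiag n. f (fst e) * g (snd e) / (rate e)^2)"
    unfolding sum_distrib_left sum.distrib[symmetric]
  proof (intro sum.cong refl)
    fix e
    have "((x + y) / r)^2 = x^2 * (1 / r^2) + y^2 * (1 / r^2) + 2 * (x * y / r^2)" for x y r :: real
      by (cases "r = 0") (auto simp: field_simps power2_eq_square)
    then show "((f (fst e) + g (snd e)) / rate e)^2 = (f (fst e))^2 * (1 / (rate e)^2) + (g (snd e))^2 * (1 / (rate e)^2)
      + 2 * (f (fst e) * g (snd e) / (rate e)^2)" .
  qed
  then show ?thesis
    unfolding sum_offdiag_rows[of "\<lambda>e. (f (fst e))^2 * (1 / (rate e)^2)"]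
      sum_offdiag_columns[of "\<lambda>e. (g (snd e))^2 * (1 / (rate e)^2)"]
    by (simp add: row_info_def col_info_def rate_def sum_distrib_left)
qed

lemma lin_dev_tail:
  assumes "0 < \<sigma>" "(\<Sum>e\<in>offdiag n. ((f (fst e) + g (snd e)) / rate e)^2) \<le> \<sigma>^2"
  shows "prob {A \<in> space M. \<tau> * \<sigma> < \<bar>lin_dev f g A\<bar>} \<le> 2 * exp (1/2 - \<tau> / 2)"
  unfolding lin_dev_eq M_eq using assms rate_pos by (intro exp_product_chernoff) auto

lemma inv_sq_bounds:
  "i \<in> {1..n} \<Longrightarrow> j \<in> {1..n} \<Longrightarrow> i \<noteq> j \<Longrightarrow> 1 / Q^2 \<le> 1 / (\<alpha> i + \<beta> j)^2 \<and> 1 / (\<alpha> i + \<beta> j)^2 \<le> 1 / q^2"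
  using bounds[of i j] q0 by (auto intro!: frac_le power_mono)

lemma card_delete: "i \<in> {1..n} \<Longrightarrow> real (card ({1..n} - {i})) = real n - 1"
  using n3 by (simp add: of_nat_diff)

lemma row_info_bounds:
  assumes "i \<in> {1..n}"
  shows "(real n - 1) / Q^2 \<le> row_info i" "row_info i \<le> real n / q^2" "0 < row_info i"
proof -
  show 1: "(real n - 1) / Q^2 \<le> row_info i"
    using sum_bounded_below[of "{1..n} - {i}" "1 / Q^2" "\<lambda>k. 1 / (\<alpha> i + \<beta> k)^2"] inv_sq_bounds assms card_delete[OF assms]
    by (auto simp: row_info_def)
  have "row_info i \<le> (real n - 1) * (1 / q^2)"
    using sum_bounded_above[of "{1..n} - {i}" "\<lambda>k. 1 / (\<alpha> i + \<beta> k)^2" "1 / q^2"] inv_sq_bounds assms card_delete[OF assms]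
    by (auto simp: row_info_def)
  also have "\<dots> \<le> real n * (1 / q^2)" by (intro mult_right_mono) auto
  finally show "row_info i \<le> real n / q^2" by simp
  have "0 < (real n - 1) / Q^2" using n3 Q0 by simp
  then show "0 < row_info i" using 1 by linarith
qed

lemma col_info_bounds:
  assumes "i \<in> {1..n}"
  shows "(real n - 1) / Q^2 \<le> col_info i" "col_info i \<le> real n / q^2" "0 < col_info i"
proof -
  show 1: "(real n - 1) / Q^2 \<le> col_info i"
    using sum_bounded_below[of "{1..n} - {i}" "1 / Q^2" "\<lambda>k. 1 / (\<alpha> k + \<beta> i)^2"] inv_sq_bounds assms card_delete[OF assms]
    by (auto simp: col_info_def)
  have "col_info i \<le> (real n - 1) * (1 / q^2)"
    using sum_bounded_above[of "{1..n} - {i}" "\<lambda>k. 1 / (\<alpha> k + \<beta> i)^2" "1 / q^2"] inv_sq_bounds assms card_delete[OF assms]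
    by (auto simp: col_info_def)
  also have "\<dots> \<le> real n * (1 / q^2)" by (intro mult_right_mono) auto
  finally show "col_info i \<le> real n / q^2" by simp
  have "0 < (real n - 1) / Q^2" using n3 Q0 by simp
  then show "0 < col_info i" using 1 by linarith
qed

text \<open>About n deviations of variance c k enter with weights u k / c k, which decay like 1 / n
  for fixed q and Q. Each term is u k squared over c k, and the number of terms cancels the n in c
  k: averaging gains a factor sqrt n over a single degree.\<close>

lemma averaged_variance_le:
  assumes u: "\<And>k. k \<in> S \<Longrightarrow> 0 \<le> u k \<and> u k \<le> 1 / q^2" and c: "\<And>k. k \<in> S \<Longrightarrow> (real n - 1) / Q^2 \<le> c k"
    and S: "real (card S) = real n - 1"
  shows "(\<Sum>k\<in>S. (u k / c k)^2 * c k) \<le> (2 * Q / q^2)^2"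
proof -
  have N: "0 < (real n - 1) / Q^2" using n3 Q0 by simp
  have "(u k / c k)^2 * c k \<le> (1 / q^2)^2 / ((real n - 1) / Q^2)" if k: "k \<in> S" for k
  proof -
    have c0: "0 < c k" using c[OF k] N by linarith
    have "(u k / c k)^2 * c k = (u k)^2 / c k" using c0 by (simp add: power_divide power2_eq_square)
    also have "\<dots> \<le> (1 / q^2)^2 / ((real n - 1) / Q^2)"
      using u[OF k] c[OF k] N by (intro frac_le power_mono) auto
    finally show ?thesis .
  qed
  from sum_bounded_above[of S "\<lambda>k. (u k / c k)^2 * c k", OF this]
  have "(\<Sum>k\<in>S. (u k / c k)^2 * c k) \<le> (real n - 1) * ((1 / q^2)^2 / ((real n - 1) / Q^2))"
    unfolding S .
  also have "\<dots> = (Q / q^2)^2" using n3 Q0 q0 by (simp add: field_simps)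
  also have "\<dots> \<le> (2 * Q / q^2)^2" using Q0 q0 by (intro power_mono divide_right_mono) auto
  finally show ?thesis .
qed

text \<open>Positive entries ensure that the estimate exists. The thresholds are \<tau> times bounds
  for the standard deviations, of order sqrt n for single degrees and free of n for the averages;
  they supply t1 and t2 of \<open>mle_linearization\<close>.\<close>

definition good :: "real \<Rightarrow> (nat \<times> nat \<Rightarrow> real) \<Rightarrow> bool" where
  "good \<tau> A \<longleftrightarrow> (\<forall>e\<in>offdiag n. 0 < A e) \<and> (\<forall>i\<in>{1..n}.
     \<bar>row_dev A i\<bar> \<le> \<tau> * (sqrt (real n) / q) \<and> \<bar>col_dev A i\<bar> \<le> \<tau> * (sqrt (real n) / q) \<and>
     \<bar>\<Sum>k\<in>{1..n} - {i}. 1 / (\<alpha> i + \<beta> k)^2 * (col_dev A k / col_info k)\<bar> \<le> \<tau> * (2 * Q / q^2) \<and>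
     \<bar>\<Sum>k\<in>{1..n} - {i}. 1 / (\<alpha> k + \<beta> i)^2 * (row_dev A k / row_info k)\<bar> \<le> \<tau> * (2 * Q / q^2))"

lemma sum_delete_of_bool:
  fixes F :: "nat \<Rightarrow> real"
  shows "(\<Sum>k\<in>{1..n}. of_bool (k \<noteq> i) * F k) = (\<Sum>k\<in>{1..n} - {i}. F k)"
proof -
  have "(\<Sum>k\<in>{1..n}. of_bool (k \<noteq> i) * F k) = (\<Sum>k\<in>{1..n}. if k \<in> {1..n} - {i} then F k else 0)"
    by (intro sum.cong) auto
  then show ?thesis by (subst (asm) sum.inter_restrict[symmetric]) (auto simp: Int_absorb1)
qed

lemma good_measurable [measurable]: "{A \<in> space M. good \<tau> A} \<in> sets M"
  unfolding good_def
  by (intro sets.sets_Collect_conj sets.sets_Collect_finite_All' borel_measurable_le borel_measurable_less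
      borel_measurable_const borel_measurable_abs borel_measurable_sum borel_measurable_times
      borel_measurable_divide row_dev_measurable col_dev_measurable component_measurable) (use n3 offdiag_nonempty in auto)

lemma AE_pos: "AE A in M. \<forall>e\<in>offdiag n. 0 < A e"
  unfolding M_eq
proof (rule AE_finite_allI)
  fix e assume e: "e \<in> offdiag n"
  have "AE x in exp_law (rate e). 0 < x"
  proof (subst AE_density)
    show "AE x in lborel. 0 < ennreal (exponential_density (rate e) x) \<longrightarrow> 0 < x"
      using AE_lborel_singleton[of "0::real"] by eventually_elim (auto simp: exponential_density_def split: if_splits)
  qed auto
  then show "AE A in PiM (offdiag n) (\<lambda>e. exp_law (rate e)). 0 < A e"
    using e rate_pos by (intro AE_PiM_component prob_space_exponential_density) auto
qed simp

text \<open>Each vertex contributes four linear statistics, with coefficients p1 to p4 and two-sided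
  tails 2 * exp (1/2 - \<tau> / 2) each; nonpositive entries have probability 0.\<close>

lemma prob_not_good: "prob {A \<in> space M. \<not> good \<tau> A} \<le> 8 * real n * exp (1/2 - \<tau> / 2)"
proof -
  define fs :: "nat \<Rightarrow> (nat \<Rightarrow> real) \<times> (nat \<Rightarrow> real) \<Rightarrow> real \<Rightarrow> (nat \<times> nat \<Rightarrow> real) set" where
    "fs i p \<sigma> = {A \<in> space M. \<tau> * \<sigma> < \<bar>lin_dev (fst p) (snd p) A\<bar>}" for i p \<sigma>
  define p1 p2 p3 p4 :: "nat \<Rightarrow> (nat \<Rightarrow> real) \<times> (nat \<Rightarrow> real)" where
    "p1 i = (\<lambda>j. of_bool (j = i), \<lambda>_. 0)" and "p2 i = (\<lambda>_. 0, \<lambda>j. of_bool (j = i))" and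
    "p3 i = (\<lambda>_. 0, \<lambda>k. of_bool (k \<noteq> i) * (1 / (\<alpha> i + \<beta> k)^2 / col_info k))" and
    "p4 i = (\<lambda>k. of_bool (k \<noteq> i) * (1 / (\<alpha> k + \<beta> i)^2 / row_info k), \<lambda>_. 0)" for i
  define s1 s2 where "s1 = sqrt (real n) / q" and "s2 = 2 * Q / q^2"
  have s: "0 < s1" "0 < s2" using n3 q0 Q0 by (auto simp: s1_def s2_def)
  have s1sq: "s1^2 = real n / q^2" by (simp add: s1_def power_divide)
  have one: "(\<Sum>j\<in>{1..n}. (of_bool (j = i))^2 * F j) = F i" if "i \<in> {1..n}" for i and F :: "nat \<Rightarrow> real"
  proof -
    have "(\<Sum>j\<in>{1..n}. (of_bool (j = i))^2 * F j) = (\<Sum>j\<in>{1..n}. if j = i then F j else 0)"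
      by (intro sum.cong) auto
    then show ?thesis using that by simp
  qed
  have one': "(\<Sum>j\<in>{1..n}. of_bool (j = i) * F j) = F i" if "i \<in> {1..n}" for i and F :: "nat \<Rightarrow> real"
  proof -
    have "(\<Sum>j\<in>{1..n}. of_bool (j = i) * F j) = (\<Sum>j\<in>{1..n}. if j = i then F j else 0)"
      by (intro sum.cong) auto
    then show ?thesis using that by simp
  qed
  have rest: "(\<Sum>k\<in>{1..n}. (of_bool (k \<noteq> i) * G k)^2 * F k) = (\<Sum>k\<in>{1..n} - {i}. (G k)^2 * F k)" for i and F G :: "nat \<Rightarrow> real"
    unfolding sum_delete_of_bool[symmetric] by (intro sum.cong) auto
  have T: "prob (fs i p \<sigma>) \<le> 2 * exp (1/2 - \<tau> / 2)"
    if "0 < \<sigma>" "(\<Sum>e\<in>offdiag n. ((fst p (fst e) + snd p (snd e)) / rate e)^2) \<le> \<sigma>^2" for i p \<sigma>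
    unfolding fs_def using that by (rule lin_dev_tail)
  have P: "prob (fs i (p1 i) s1) \<le> 2 * exp (1/2 - \<tau> / 2)" "prob (fs i (p2 i) s1) \<le> 2 * exp (1/2 - \<tau> / 2)"
    "prob (fs i (p3 i) s2) \<le> 2 * exp (1/2 - \<tau> / 2)" "prob (fs i (p4 i) s2) \<le> 2 * exp (1/2 - \<tau> / 2)"
    if i: "i \<in> {1..n}" for i
  proof -
    have v1: "(\<Sum>e\<in>offdiag n. ((fst (p1 i) (fst e) + snd (p1 i) (snd e)) / rate e)^2) \<le> s1^2"
      unfolding variance_eq unfolding p1_def s1sq using one[OF i] row_info_bounds[OF i] by simp
    have v2: "(\<Sum>e\<in>offdiag n. ((fst (p2 i) (fst e) + snd (p2 i) (snd e)) / rate e)^2) \<le> s1^2"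
      unfolding variance_eq unfolding p2_def s1sq using one[OF i] col_info_bounds[OF i] by simp
    have v3: "(\<Sum>e\<in>offdiag n. ((fst (p3 i) (fst e) + snd (p3 i) (snd e)) / rate e)^2) \<le> s2^2"
      unfolding variance_eq unfolding p3_def s2_def fst_conv snd_conv rest
      using averaged_variance_le[of "{1..n} - {i}" "\<lambda>k. 1 / (\<alpha> i + \<beta> k)^2" col_info] inv_sq_bounds[OF i] col_info_bounds card_delete[OF i]
      by auto
    have v4: "(\<Sum>e\<in>offdiag n. ((fst (p4 i) (fst e) + snd (p4 i) (snd e)) / rate e)^2) \<le> s2^2"
      unfolding variance_eq unfolding p4_def s2_def fst_conv snd_conv rest
      using averaged_variance_le[of "{1..n} - {i}" "\<lambda>k. 1 / (\<alpha> k + \<beta> i)^2" row_info] inv_sq_bounds[OF _ i] row_info_bounds card_delete[OF i]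
      by auto
    show "prob (fs i (p1 i) s1) \<le> 2 * exp (1/2 - \<tau> / 2)" by (rule T[OF s(1) v1])
    show "prob (fs i (p2 i) s1) \<le> 2 * exp (1/2 - \<tau> / 2)" by (rule T[OF s(1) v2])
    show "prob (fs i (p3 i) s2) \<le> 2 * exp (1/2 - \<tau> / 2)" by (rule T[OF s(2) v3])
    show "prob (fs i (p4 i) s2) \<le> 2 * exp (1/2 - \<tau> / 2)" by (rule T[OF s(2) v4])
  qed
  have [measurable]: "fs i p \<sigma> \<in> sets M" for i p \<sigma> unfolding fs_def by measurable
  define B where "B i = fs i (p1 i) s1 \<union> fs i (p2 i) s1 \<union> (fs i (p3 i) s2 \<union> fs i (p4 i) s2)" for i
  have B: "B i \<in> sets M" for i unfolding B_def by measurable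
  have PB: "prob (B i) \<le> 8 * exp (1/2 - \<tau> / 2)" if "i \<in> {1..n}" for i
  proof -
    have "prob (B i) \<le> prob (fs i (p1 i) s1) + prob (fs i (p2 i) s1) + (prob (fs i (p3 i) s2) + prob (fs i (p4 i) s2))"
      unfolding B_def by (intro order_trans[OF measure_Un_le] add_mono order_trans[OF measure_Un_le] order_refl) auto
    then show ?thesis using P[OF that] by simp
  qed
  define N where "N = {A \<in> space M. \<not> (\<forall>e\<in>offdiag n. 0 < A e)}"
  have N: "N \<in> sets M" unfolding N_def
    by (intro sets.sets_Collect_neg sets.sets_Collect_finite_All' borel_measurable_less component_measurable) (use offdiag_nonempty in auto)
  have PN: "prob N = 0"
    using AE_pos AE_iff_measurable[OF N, of "\<lambda>A. \<forall>e\<in>offdiag n. 0 < A e"] by (simp add: N_def measure_def)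
  have l1: "lin_dev (fst (p1 i)) (snd (p1 i)) A = row_dev A i" "lin_dev (fst (p2 i)) (snd (p2 i)) A = col_dev A i"
    "lin_dev (fst (p3 i)) (snd (p3 i)) A = (\<Sum>k\<in>{1..n} - {i}. 1 / (\<alpha> i + \<beta> k)^2 * (col_dev A k / col_info k))"
    "lin_dev (fst (p4 i)) (snd (p4 i)) A = (\<Sum>k\<in>{1..n} - {i}. 1 / (\<alpha> k + \<beta> i)^2 * (row_dev A k / row_info k))"
    if i: "i \<in> {1..n}" for i A
    unfolding lin_dev_def p1_def p2_def p3_def p4_def fst_conv snd_conv sum_delete_of_bool[symmetric]
    using one'[OF i] by (simp_all add: mult.assoc)
  have "{A \<in> space M. \<not> good \<tau> A} \<subseteq> N \<union> (\<Union>i\<in>{1..n}. B i)"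
    unfolding good_def N_def B_def fs_def using l1 by (auto simp: s1_def s2_def not_le)
  then have "prob {A \<in> space M. \<not> good \<tau> A} \<le> prob (N \<union> (\<Union>i\<in>{1..n}. B i))"
    using N B by (intro finite_measure_mono) auto
  also have "\<dots> \<le> prob N + prob (\<Union>i\<in>{1..n}. B i)" using N B by (intro measure_Un_le) auto
  also have "prob (\<Union>i\<in>{1..n}. B i) \<le> (\<Sum>i\<in>{1..n}. prob (B i))"
    using B by (intro finite_measure_subadditive_finite) auto
  also have "\<dots> \<le> (\<Sum>i\<in>{1..n}. 8 * exp (1/2 - \<tau> / 2))" using PB by (intro sum_mono) auto
  finally show ?thesis using PN by simp
qed

text \<open>On the good event, q * omega is the precision W of the consistency step and q * kappa
  the final error of \<open>mle_linearization\<close>. Both functions depend on q and Q only through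
  Q / q; the 640 is 5 * 2 * 8^2.\<close>

definition omega :: "real \<Rightarrow> real" where
  "omega \<tau> = 640 * \<tau> * sqrt (real n) * real n * (Q / q)^4 / (real n - 2)^2"

definition kappa :: "real \<Rightarrow> real" where
  "kappa \<tau> = 10 * (real n * (omega \<tau>)^2 + \<tau> * (Q / q)) * real n * (Q / q)^4 / (real n - 2)^2"

lemma mle_error:
  assumes \<tau>: "0 \<le> \<tau>" "2 * (Q / q) * \<tau> * sqrt (real n) \<le> real n - 1" "8 * (Q / q) < real n - 1" "omega \<tau> \<le> 1/2"
    and A: "good \<tau> A" and i: "i \<in> {1..n}"
  shows "\<bar>fst (mle n A) i - \<alpha> i + row_dev A i / row_info i + col_dev A n / col_info n\<bar> \<le> q * kappa \<tau>"
proof -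
  define a b where "a = fst (mle n A)" and "b = snd (mle n A)"
  have "\<exists>\<alpha>' \<beta>'. is_mle n A \<alpha>' \<beta>'" using A n3 by (intro mle_exists) (auto simp: good_def)
  then have ab: "is_mle n A a b" unfolding a_def b_def using is_mle_mle by blast
  have total: "(\<Sum>i\<in>{1..n}. out_deg n A i) = (\<Sum>j\<in>{1..n}. in_deg n A j)"
    unfolding out_deg_def in_deg_def
    using sum_offdiag_rows[of A n] sum_offdiag_columns[of A n] by simp
  have ab_row: "out_deg n A i = (\<Sum>k\<in>{1..n} - {i}. 1 / (a i + b k))" if "i \<in> {1..n}" for i
    using ab that by (simp add: is_mle_def)
  have ab_col: "in_deg n A j = (\<Sum>k\<in>{1..n} - {j}. 1 / (a k + b j))" if "j \<in> {1..n}" for j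
  proof (cases "j = n")
    case False
    then have "j \<in> {1..n-1}" using that by auto
    then show ?thesis using ab by (simp add: is_mle_def)
  next
    case True
    \<comment> \<open>Out-degrees and in-degrees have the same total, for the data as for the fitted
      means, so the equation of column n follows from all the others.\<close>
    have "(\<Sum>i\<in>{1..n}. \<Sum>k\<in>{1..n} - {i}. 1 / (a i + b k)) = (\<Sum>j\<in>{1..n}. \<Sum>k\<in>{1..n} - {j}. 1 / (a k + b j))"
      using sum_offdiag_rows[of "\<lambda>e. 1 / (a (fst e) + b (snd e))" n]
        sum_offdiag_columns[of "\<lambda>e. 1 / (a (fst e) + b (snd e))" n] by simp
    then have eq: "(\<Sum>j\<in>{1..n}. in_deg n A j) = (\<Sum>j\<in>{1..n}. \<Sum>k\<in>{1..n} - {j}. 1 / (a k + b j))"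
      using total ab_row by simp
    have split: "{1..n} = insert n {1..n-1}" "n \<notin> {1..n-1}" using n3 by auto
    have "(\<Sum>j\<in>{1..n-1}. in_deg n A j) = (\<Sum>j\<in>{1..n-1}. \<Sum>k\<in>{1..n} - {j}. 1 / (a k + b j))"
      using ab by (simp add: is_mle_def)
    moreover have "(\<Sum>j\<in>{1..n}. F j) = F n + (\<Sum>j\<in>{1..n-1}. F j)" for F :: "nat \<Rightarrow> real"
      unfolding split(1) using split(2) by simp
    ultimately show ?thesis using eq True by simp
  qed
  have devs: "row_dev A i = out_deg n A i - (\<Sum>k\<in>{1..n} - {i}. 1 / (\<alpha> i + \<beta> k))"
    "col_dev A i = in_deg n A i - (\<Sum>k\<in>{1..n} - {i}. 1 / (\<alpha> k + \<beta> i))" for i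
    by (simp_all add: row_dev_def col_dev_def out_deg_def in_deg_def sum_subtractf)
  define r where "r = Q / q"
  have Qr: "Q = r * q" using q0 by (simp add: r_def)
  have r: "0 < r" using q0 Q0 by (simp add: r_def)
  define t1 where "t1 = \<tau> * (sqrt (real n) / q)"
  define t2 where "t2 = \<tau> * (2 * Q / q^2)"
  define W where "W = 5 * t1 * (2 * real (card {1..n}) / q^2) / (real (card {1..n} - 2) * (1 / (8 * Q^2)))^2"
  have n2: "real (n - 2) = real n - 2" "real (n - 1) = real n - 1" "0 < real n - 2" using n3 by auto
  have W: "W = q * omega \<tau>"
    unfolding W_def t1_def omega_def r_def[symmetric] card_atLeastAtMost diff_Suc_1 n2
    unfolding Qr using q0 r n2(3)
    by (simp add: field_simps power2_eq_square power4_eq_xxxx)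
  have "\<bar>a i - \<alpha> i + row_dev A i / row_info i + col_dev A n / col_info n\<bar>
    \<le> 5 * (2 * real (card {1..n}) * W^2 / q^3 + t2) * (real (card {1..n}) / q^2) / (real (card {1..n} - 2) * (1 / Q^2))^2"
  proof (rule mle_linearization[where \<alpha> = \<alpha> and \<beta> = \<beta> and a = a and b = b and q = q and Q = Q and V = "{1..n}"
        and \<delta> = "row_dev A" and \<epsilon> = "col_dev A" and v = row_info and c = col_info and W = W and ?t1.0 = t1 and ?t2.0 = t2])
    show "t1 \<le> real (card {1..n} - 1) / (2 * Q)"
    proof -
      have "t1 * (2 * Q) = 2 * (Q / q) * \<tau> * sqrt (real n)" by (simp add: t1_def)
      then show ?thesis using \<tau>(2) Q0 n3 by (simp add: pos_le_divide_eq of_nat_diff)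
    qed
    show "8 * Q < real (card {1..n} - 1) * q"
      using \<tau>(3) q0 n3 by (simp add: field_simps of_nat_diff)
    show "W \<le> q / 2" unfolding W using \<tau>(4) q0 by simp
    show "b n = \<beta> n" using ab beta_n by (simp add: is_mle_def)
    show "0 < a i + b k" if "i \<in> {1..n}" "k \<in> {1..n}" "i \<noteq> k" for i k
      using ab that by (simp add: is_mle_def)
    show "(\<Sum>k\<in>{1..n} - {i}. 1 / (a i + b k)) = (\<Sum>k\<in>{1..n} - {i}. 1 / (\<alpha> i + \<beta> k)) + row_dev A i"
      if "i \<in> {1..n}" for i using ab_row[OF that] devs(1)[of i] by linarith
    show "(\<Sum>i\<in>{1..n} - {k}. 1 / (a i + b k)) = (\<Sum>i\<in>{1..n} - {k}. 1 / (\<alpha> i + \<beta> k)) + col_dev A k"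
      if "k \<in> {1..n}" for k using ab_col[OF that] devs(2)[of k] by linarith
    show "\<bar>row_dev A i\<bar> \<le> t1" "\<bar>col_dev A i\<bar> \<le> t1"
      "\<bar>\<Sum>k\<in>{1..n} - {i}. 1 / (\<alpha> i + \<beta> k)^2 * (col_dev A k / col_info k)\<bar> \<le> t2"
      "\<bar>\<Sum>k\<in>{1..n} - {i}. 1 / (\<alpha> k + \<beta> i)^2 * (row_dev A k / row_info k)\<bar> \<le> t2"
      if "i \<in> {1..n}" for i using A that unfolding good_def t1_def t2_def by blast+
  qed (use n3 q0 qQ bounds i W_def in \<open>simp_all add: row_info_def col_info_def\<close>)
  also have "\<dots> = q * kappa \<tau>"
  proof -
    obtain o' m where o': "omega \<tau> = o'" "real n - 2 = m" by blast
    have m: "0 < m" using n2(3) o'(2) by simp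
    show ?thesis
    unfolding W t2_def kappa_def r_def[symmetric] card_atLeastAtMost diff_Suc_1 n2 o'
    unfolding Qr using q0 r m
    by (simp add: field_simps power2_eq_square power3_eq_cube power4_eq_xxxx)
  qed
  finally show ?thesis unfolding a_def .
qed

lemma degree_map_measurable: "degree_map n \<in> borel_measurable M"
proof -
  have "(\<lambda>A. (\<lambda>i. if i \<in> {1..n} then out_deg n A i else 0)) \<in> borel_measurable M"
  proof (rule measurable_coordinatewise_then_product)
    fix i show "(\<lambda>A. if i \<in> {1..n} then out_deg n A i else 0) \<in> borel_measurable M"
      unfolding out_deg_def
      by (cases "i \<in> {1..n}") (auto intro!: borel_measurable_sum component_measurable simp: mem_offdiag)
  qed
  moreover have "(\<lambda>A. (\<lambda>j. if j \<in> {1..n-1} then in_deg n A j else 0)) \<in> borel_measurable M"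
  proof (rule measurable_coordinatewise_then_product)
    fix j show "(\<lambda>A. if j \<in> {1..n-1} then in_deg n A j else 0) \<in> borel_measurable M"
      unfolding in_deg_def
      by (cases "j \<in> {1..n-1}") (auto intro!: borel_measurable_sum component_measurable simp: mem_offdiag)
  qed
  ultimately show ?thesis unfolding degree_map_def by (rule borel_measurable_Pair)
qed

lemma fisher_v_diag: "l \<le> n \<Longrightarrow> fisher_v n \<alpha> \<beta> l l = row_info l"
  by (simp add: fisher_v_def row_info_def)

text \<open>Row l <= n of the Fisher matrix lacks the entry of column n, as \<beta> at n is not a
  parameter, and this entry is its defect from the diagonal; rows of \<beta> parameters have no
  defect. The defects add up to the variance of b at n.\<close>

lemma fisher_v_lastlast_eq: "fisher_v_lastlast n \<alpha> \<beta> = col_info n"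
proof -
  have shift: "(\<Sum>j\<in>{n+1..2*n-1}. F j) = (\<Sum>m\<in>{1..n-1}. F (n + m))" for F :: "nat \<Rightarrow> real"
    by (rule sum.reindex_bij_witness[of _ "\<lambda>m. n + m" "\<lambda>j. j - n"]) (use n3 in auto)
  have split: "{1..2*n-1} = {1..n} \<union> {n+1..2*n-1}" "{1..n} \<inter> {n+1..2*n-1} = {}" using n3 by auto
  have split_sum: "(\<Sum>j\<in>{1..2*n-1}. F j) = (\<Sum>j\<in>{1..n}. F j) + (\<Sum>m\<in>{1..n-1}. F (n + m))" for F :: "nat \<Rightarrow> real"
    unfolding split(1) shift[symmetric] using split(2) by (intro sum.union_disjoint) auto
  have del: "(\<Sum>j\<in>{1..2*n-1} - {l}. F j) = (\<Sum>j\<in>{1..2*n-1}. of_bool (j \<noteq> l) * F j)" for F :: "nat \<Rightarrow> real" and l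
  proof -
    have "(\<Sum>j\<in>{1..2*n-1}. of_bool (j \<noteq> l) * F j) = (\<Sum>j\<in>{1..2*n-1}. if j \<in> {1..2*n-1} - {l} then F j else 0)"
      by (intro sum.cong) auto
    then show ?thesis by (subst (asm) sum.inter_restrict[symmetric]) (auto simp: Int_absorb1)
  qed
  have top: "(\<Sum>j\<in>{1..n}. F j) = F n + (\<Sum>j\<in>{1..n-1}. F j)" for F :: "nat \<Rightarrow> real"
  proof -
    have "{1..n} = insert n {1..n-1}" "n \<notin> {1..n-1}" using n3 by auto
    then show ?thesis by simp
  qed
  have 1: "fisher_v_last n \<alpha> \<beta> l = of_bool (n \<noteq> l) * (1 / (\<alpha> l + \<beta> n)^2)" if l: "l \<in> {1..n}" for l
  proof -
    have "(\<Sum>j\<in>{1..2*n-1} - {l}. fisher_v n \<alpha> \<beta> l j) =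
        (\<Sum>j\<in>{1..n}. of_bool (j \<noteq> l) * fisher_v n \<alpha> \<beta> l j) + (\<Sum>m\<in>{1..n-1}. of_bool (n + m \<noteq> l) * fisher_v n \<alpha> \<beta> l (n + m))"
      unfolding del split_sum ..
    also have "(\<Sum>j\<in>{1..n}. of_bool (j \<noteq> l) * fisher_v n \<alpha> \<beta> l j) = 0"
      using l by (intro sum.neutral) (auto simp: fisher_v_def)
    also have "(\<Sum>m\<in>{1..n-1}. of_bool (n + m \<noteq> l) * fisher_v n \<alpha> \<beta> l (n + m)) =
        (\<Sum>m\<in>{1..n-1}. of_bool (m \<noteq> l) * (1 / (\<alpha> l + \<beta> m)^2))"
      using l by (intro sum.cong) (auto simp: fisher_v_def)
    finally have s: "(\<Sum>j\<in>{1..2*n-1} - {l}. fisher_v n \<alpha> \<beta> l j) = (\<Sum>m\<in>{1..n-1}. of_bool (m \<noteq> l) * (1 / (\<alpha> l + \<beta> m)^2))"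
      by simp
    have "row_info l = (\<Sum>m\<in>{1..n}. of_bool (m \<noteq> l) * (1 / (\<alpha> l + \<beta> m)^2))"
      unfolding row_info_def sum_delete_of_bool ..
    then show ?thesis unfolding fisher_v_last_def s top using fisher_v_diag[of l] l by simp
  qed
  have 2: "fisher_v_last n \<alpha> \<beta> (n + j) = 0" if j: "j \<in> {1..n-1}" for j
  proof -
    have "(\<Sum>m\<in>{1..2*n-1} - {n + j}. fisher_v n \<alpha> \<beta> (n + j) m) =
        (\<Sum>m\<in>{1..n}. of_bool (m \<noteq> n + j) * fisher_v n \<alpha> \<beta> (n + j) m)
        + (\<Sum>m\<in>{1..n-1}. of_bool (n + m \<noteq> n + j) * fisher_v n \<alpha> \<beta> (n + j) (n + m))"
      unfolding del split_sum ..
    also have "(\<Sum>m\<in>{1..n-1}. of_bool (n + m \<noteq> n + j) * fisher_v n \<alpha> \<beta> (n + j) (n + m)) = 0"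
      using j by (intro sum.neutral) (auto simp: fisher_v_def)
    also have "(\<Sum>m\<in>{1..n}. of_bool (m \<noteq> n + j) * fisher_v n \<alpha> \<beta> (n + j) m) =
        (\<Sum>m\<in>{1..n}. of_bool (m \<noteq> j) * (1 / (\<alpha> m + \<beta> j)^2))"
      using j by (intro sum.cong) (auto simp: fisher_v_def)
    also have "\<dots> = fisher_v n \<alpha> \<beta> (n + j) (n + j)"
      unfolding sum_delete_of_bool using j by (simp add: fisher_v_def)
    finally show ?thesis by (simp add: fisher_v_last_def)
  qed
  have "fisher_v_lastlast n \<alpha> \<beta> = (\<Sum>l\<in>{1..n}. of_bool (n \<noteq> l) * (1 / (\<alpha> l + \<beta> n)^2))"
    unfolding fisher_v_lastlast_def split_sum using 1 2 by simp
  also have "\<dots> = (\<Sum>l\<in>{1..n}. of_bool (l \<noteq> n) * (1 / (\<alpha> l + \<beta> n)^2))"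
    by (intro sum.cong) auto
  also have "\<dots> = col_info n" unfolding sum_delete_of_bool by (simp add: col_info_def)
  finally show ?thesis .
qed

end

section \<open>The standardised error of the first k coordinates\<close>

locale cw_bounded_block = cw_bounded +
  fixes k :: nat
  assumes k1: "1 \<le> k" and kn: "k \<le> n"
begin

definition std_mat :: "nat \<Rightarrow> nat \<Rightarrow> real" where
  "std_mat = inv_sqrt_mat k (\<lambda>a b. S_mat n \<alpha> \<beta> (a + 1) (b + 1))"

text \<open>The matrix is symmetric, so these are the coefficients of the unstandardised errors in
  the linear form of \<open>std_error\<close> given by t.\<close>

definition wvec :: "(nat \<Rightarrow> real) \<Rightarrow> nat \<Rightarrow> real" where
  "wvec t i = (\<Sum>j<k. std_mat i j * t j)"

definition std_error :: "(nat \<times> nat \<Rightarrow> real) \<Rightarrow> nat \<Rightarrow> real" where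
  "std_error A = (\<lambda>i. if i < k then
     (\<Sum>l<k. std_mat i l * (theta_coord n (fst (mle n A)) (snd (mle n A)) (l + 1) - theta_coord n \<alpha> \<beta> (l + 1)))
     else undefined)"

text \<open>With \<open>colc\<close>, the coefficients of the degree deviations in the leading term
  of that linear form. Block index l < k is vertex l + 1, hence the shift.\<close>

definition rowc :: "(nat \<Rightarrow> real) \<Rightarrow> nat \<Rightarrow> real" where
  "rowc t i = (if i \<in> {1..k} then - (wvec t (i - 1) / row_info i) else 0)"

definition colc :: "(nat \<Rightarrow> real) \<Rightarrow> nat \<Rightarrow> real" where
  "colc t j = (if j = n then - ((\<Sum>l<k. wvec t l) / col_info n) else 0)"

definition nrm :: "(nat \<Rightarrow> real) \<Rightarrow> real" where
  "nrm t = sqrt (\<Sum>i<k. (t i)^2)"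

lemma nrm: "0 \<le> nrm t" "(nrm t)^2 = (\<Sum>i<k. (t i)^2)"
  by (simp_all add: nrm_def sum_nonneg)

lemma n_mem: "n \<in> {1..n}" using n3 by simp

text \<open>As k <= n, the block of S is diagonal plus the constant 1 / col_info n. The second claim
  normalises the variance: the quadratic form of S at its inverse square root applied to t is the
  squared norm of t.\<close>

lemma std_mat:
  shows "std_mat i j = std_mat j i"
    and "(\<Sum>i<k. (wvec t i)^2 / row_info (i + 1)) + (\<Sum>i<k. wvec t i)^2 / col_info n = (nrm t)^2"
proof -
  have S: "S_mat n \<alpha> \<beta> (a + 1) (b + 1) = (if a = b then 1 / row_info (a + 1) else 0) + 1 / col_info n"
    if "a < k" "b < k" for a b
    using that kn by (auto simp: S_mat_def fisher_v_diag fisher_v_lastlast_eq)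
  have v: "0 < row_info (a + 1)" if "a < k" for a
    using that kn by (intro row_info_bounds) auto
  have c: "0 < 1 / col_info n" using col_info_bounds(3)[OF n_mem] by simp
  have k: "0 < k" using k1 by simp
  note F = inv_sqrt_mat_diag_plus_const[where k = k and v = "\<lambda>i. row_info (i + 1)" and c = "1 / col_info n", OF S v c k]
  show "std_mat i j = std_mat j i" unfolding std_mat_def by (rule F(1))
  show "(\<Sum>i<k. (wvec t i)^2 / row_info (i + 1)) + (\<Sum>i<k. wvec t i)^2 / col_info n = (nrm t)^2"
    using F(2)[of t] unfolding std_mat_def[symmetric] wvec_def[symmetric] nrm by simp
qed

text \<open>Each bound keeps one of the nonnegative summands of the variance identity.\<close>

lemma wvec_le: "i < k \<Longrightarrow> \<bar>wvec t i\<bar> \<le> nrm t * sqrt (row_info (i + 1))"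
  and sum_wvec_le: "\<bar>\<Sum>i<k. wvec t i\<bar> \<le> nrm t * sqrt (col_info n)"
proof -
  have pos: "0 < row_info (i + 1)" if "i < k" for i
    using that kn by (intro row_info_bounds) auto
  have cpos: "0 < col_info n" using col_info_bounds(3)[OF n_mem] .
  have key: "\<bar>x\<bar> \<le> nrm t * sqrt y" if "x^2 / y \<le> (nrm t)^2" "0 < y" for x y
  proof (rule power2_le_imp_le)
    show "\<bar>x\<bar>^2 \<le> (nrm t * sqrt y)^2" using that by (simp add: power_mult_distrib field_simps)
  qed (use nrm that in auto)
  have S: "0 \<le> (\<Sum>i<k. (wvec t i)^2 / row_info (i + 1))"
    using pos by (intro sum_nonneg divide_nonneg_pos) auto
  show "\<bar>\<Sum>i<k. wvec t i\<bar> \<le> nrm t * sqrt (col_info n)"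
    using std_mat(2)[of t] S cpos by (intro key) auto
  assume i: "i < k"
  have "(wvec t i)^2 / row_info (i + 1) \<le> (\<Sum>i<k. (wvec t i)^2 / row_info (i + 1))"
    using pos i by (intro member_le_sum) (auto intro!: divide_nonneg_pos)
  moreover have "0 \<le> (\<Sum>i<k. wvec t i)^2 / col_info n" using cpos by simp
  ultimately show "\<bar>wvec t i\<bar> \<le> nrm t * sqrt (row_info (i + 1))"
    using std_mat(2)[of t] pos[OF i] by (intro key) auto
qed

lemma std_error_linear: "(\<Sum>i<k. t i * std_error A i) = (\<Sum>l<k. wvec t l * (fst (mle n A) (l + 1) - \<alpha> (l + 1)))"
proof -
  have "(\<Sum>i<k. t i * std_error A i) = (\<Sum>i<k. \<Sum>l<k. std_mat l i * t i * (fst (mle n A) (l + 1) - \<alpha> (l + 1)))"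
    using kn by (intro sum.cong) (auto simp: std_error_def theta_coord_def sum_distrib_left mult_ac std_mat(1)[of _ "_ :: nat"] intro!: sum.cong)
  then show ?thesis unfolding wvec_def sum_distrib_right by (subst sum.swap) simp
qed

lemma shift_sum: "(\<Sum>i\<in>{1..n}. if i \<in> {1..k} then F i else 0) = (\<Sum>l<k. F (l + 1))" for F :: "nat \<Rightarrow> real"
proof -
  have "(\<Sum>i\<in>{1..n}. if i \<in> {1..k} then F i else 0) = (\<Sum>i\<in>{1..n} \<inter> {1..k}. F i)"
    by (rule sum.inter_restrict[symmetric]) simp
  also have "{1..n} \<inter> {1..k} = {1..k}" using kn by auto
  also have "(\<Sum>i\<in>{1..k}. F i) = (\<Sum>l<k. F (l + 1))"
    by (rule sum.reindex_bij_witness[of _ "\<lambda>l. l + 1" "\<lambda>i. i - 1"]) auto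
  finally show ?thesis .
qed

lemma lin_dev_coeffs:
  "lin_dev (rowc t) (colc t) A = - (\<Sum>l<k. wvec t l * (row_dev A (l + 1) / row_info (l + 1) + col_dev A n / col_info n))"
proof -
  have "(\<Sum>i\<in>{1..n}. rowc t i * row_dev A i) = (\<Sum>i\<in>{1..n}. if i \<in> {1..k} then - (wvec t (i - 1) / row_info i) * row_dev A i else 0)"
    by (intro sum.cong) (auto simp: rowc_def)
  also have "\<dots> = (\<Sum>l<k. - (wvec t l / row_info (l + 1)) * row_dev A (l + 1))"
    unfolding shift_sum by simp
  finally have 1: "(\<Sum>i\<in>{1..n}. rowc t i * row_dev A i) = (\<Sum>l<k. - (wvec t l / row_info (l + 1)) * row_dev A (l + 1))" .
  have "(\<Sum>j\<in>{1..n}. colc t j * col_dev A j) = (\<Sum>j\<in>{1..n}. if j = n then - ((\<Sum>l<k. wvec t l) / col_info n) * col_dev A n else 0)"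
    by (intro sum.cong) (auto simp: colc_def)
  also have "\<dots> = - ((\<Sum>l<k. wvec t l) / col_info n) * col_dev A n"
    using n3 by simp
  finally have 2: "(\<Sum>j\<in>{1..n}. colc t j * col_dev A j) = - (\<Sum>l<k. wvec t l * (col_dev A n / col_info n))"
    by (simp add: sum_distrib_right sum_divide_distrib)
  show ?thesis unfolding lin_dev_def 1 2
    by (simp add: distrib_left sum.distrib sum_negf[symmetric] sum_subtractf)
qed

text \<open>An entry of \<open>wvec\<close> is at most nrm t * sqrt n / q, the remainder in the
  corresponding coordinate at most q * kappa, and q cancels.\<close>

lemma std_error_approx:
  assumes \<tau>: "0 \<le> \<tau>" "2 * (Q / q) * \<tau> * sqrt (real n) \<le> real n - 1" "8 * (Q / q) < real n - 1" "omega \<tau> \<le> 1/2"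
    and A: "good \<tau> A"
  shows "\<bar>(\<Sum>i<k. t i * std_error A i) - lin_dev (rowc t) (colc t) A\<bar> \<le> real k * nrm t * (sqrt (real n) * kappa \<tau>)"
proof -
  define E where "E l = fst (mle n A) (l + 1) - \<alpha> (l + 1) + row_dev A (l + 1) / row_info (l + 1) + col_dev A n / col_info n" for l
  have "(\<Sum>i<k. t i * std_error A i) - lin_dev (rowc t) (colc t) A = (\<Sum>l<k. wvec t l * E l)"
    unfolding std_error_linear lin_dev_coeffs E_def
    by (simp add: sum.distrib[symmetric] algebra_simps)
  also have "\<bar>\<dots>\<bar> \<le> (\<Sum>l<k. nrm t * (sqrt (real n) * kappa \<tau>))"
  proof (rule order_trans[OF sum_abs sum_mono])
    fix l assume l: "l \<in> {..<k}"
    then have lm: "l + 1 \<in> {1..n}" using kn by auto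
    have e: "\<bar>E l\<bar> \<le> q * kappa \<tau>" unfolding E_def by (rule mle_error[OF \<tau> A lm])
    have "sqrt (row_info (l + 1)) \<le> sqrt (real n / q^2)"
      using row_info_bounds(2)[OF lm] by simp
    also have "\<dots> = sqrt (real n) / q" using q0 by (simp add: real_sqrt_divide)
    finally have "nrm t * sqrt (row_info (l + 1)) \<le> nrm t * (sqrt (real n) / q)"
      using nrm by (intro mult_left_mono) auto
    then have w: "\<bar>wvec t l\<bar> \<le> nrm t * (sqrt (real n) / q)" using wvec_le[of l t] l by auto
    have "\<bar>wvec t l * E l\<bar> \<le> (nrm t * (sqrt (real n) / q)) * (q * kappa \<tau>)"
      unfolding abs_mult using w e nrm q0 by (intro mult_mono) auto
    then show "\<bar>wvec t l * E l\<bar> \<le> nrm t * (sqrt (real n) * kappa \<tau>)" using q0 by simp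
  qed
  finally show ?thesis by simp
qed

text \<open>For nrm t = 1 this bounds the standardised influence of one matrix entry through its row
  or through column n, the small parameter of the central limit theorem.\<close>

definition rho :: real where "rho = (Q / q) / sqrt (real n - 1)"

lemma rho: "0 \<le> rho" "rho^2 = (Q / q)^2 / (real n - 1)"
  using Q0 q0 n3 by (simp_all add: rho_def power_divide power_mult_distrib)

lemma coeff_le:
  assumes e: "e \<in> offdiag n"
  shows "\<bar>rowc t (fst e) / rate e\<bar> \<le> nrm t * rho" "\<bar>colc t (snd e) / rate e\<bar> \<le> nrm t * rho"
proof -
  have n1: "0 < real n - 1" using n3 by simp
  \<comment> \<open>A number of size at most nrm t * sqrt v, divided by v, has size at most nrm t /
    sqrt v, and v is at least (n - 1) / Q^2.\<close>
  have key: "\<bar>- (x / v) / rate e\<bar> \<le> nrm t * rho" if x: "\<bar>x\<bar> \<le> nrm t * sqrt v" and v: "(real n - 1) / Q^2 \<le> v" for x v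
  proof -
    have v0: "0 < v" using v n1 Q0 by (smt (verit) divide_pos_pos zero_less_power)
    have "\<bar>x\<bar> / v \<le> nrm t * sqrt v / v" using x v0 by (intro divide_right_mono) auto
    also have "\<dots> = nrm t / sqrt v" using v0 by (simp add: field_simps flip: real_sqrt_mult)
    also have "\<dots> \<le> nrm t / sqrt ((real n - 1) / Q^2)"
      using v v0 n1 Q0 nrm(1) by (intro divide_left_mono mult_pos_pos) auto
    also have "\<dots> = nrm t * Q / sqrt (real n - 1)" using Q0 by (simp add: real_sqrt_divide)
    finally have b: "\<bar>x\<bar> / v \<le> nrm t * Q / sqrt (real n - 1)" .
    have "\<bar>- (x / v) / rate e\<bar> = (\<bar>x\<bar> / v) / rate e" using v0 rate_pos[OF e] by simp
    also have "\<dots> \<le> (nrm t * Q / sqrt (real n - 1)) / q"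
    proof -
      have "0 \<le> \<bar>x\<bar> / v" using v0 by simp
      then show ?thesis
        using frac_le[OF order_trans[OF _ b] b q0] rate_bounds[OF e] by blast
    qed
    finally show ?thesis by (simp add: rho_def mult.commute)
  qed
  have z: "0 \<le> nrm t * rho" using nrm rho by simp
  show "\<bar>rowc t (fst e) / rate e\<bar> \<le> nrm t * rho"
  proof (cases "fst e \<in> {1..k}")
    case True
    then have "\<bar>wvec t (fst e - 1)\<bar> \<le> nrm t * sqrt (row_info (fst e))"
      using wvec_le[of "fst e - 1" t] by auto
    moreover have "fst e \<in> {1..n}" using True kn by auto
    ultimately show ?thesis using True row_info_bounds(1)[of "fst e"] key unfolding rowc_def by auto
  qed (use z in \<open>auto simp: rowc_def\<close>)
  show "\<bar>colc t (snd e) / rate e\<bar> \<le> nrm t * rho"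
  proof (cases "snd e = n")
    case True
    then show ?thesis using key[OF sum_wvec_le col_info_bounds(1)[OF n_mem]] by (simp add: colc_def)
  qed (use z in \<open>simp add: colc_def\<close>)
qed

text \<open>The squares of the coefficients reproduce (nrm t)^2 exactly. What is left is the cross
  sum, and only the at most k entries (i, n) with i <= k carry both a row and a column
  coefficient.\<close>

lemma variance_approx:
  "\<bar>(\<Sum>e\<in>offdiag n. ((rowc t (fst e) + colc t (snd e)) / rate e)^2) - (nrm t)^2\<bar> \<le> 2 * real k * (nrm t * rho)^2"
proof -
  have "(\<Sum>i\<in>{1..n}. (rowc t i)^2 * row_info i) = (\<Sum>i\<in>{1..n}. if i \<in> {1..k} then (wvec t (i - 1))^2 / row_info i else 0)"
  proof (intro sum.cong refl)
    fix i assume "i \<in> {1..n}"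
    then have "0 < row_info i" by (rule row_info_bounds)
    then show "(rowc t i)^2 * row_info i = (if i \<in> {1..k} then (wvec t (i - 1))^2 / row_info i else 0)"
      by (auto simp: rowc_def power2_eq_square)
  qed
  also have "\<dots> = (\<Sum>l<k. (wvec t l)^2 / row_info (l + 1))" unfolding shift_sum by simp
  finally have 1: "(\<Sum>i\<in>{1..n}. (rowc t i)^2 * row_info i) = (\<Sum>l<k. (wvec t l)^2 / row_info (l + 1))" .
  have "(\<Sum>j\<in>{1..n}. (colc t j)^2 * col_info j) = (\<Sum>j\<in>{1..n}. if j = n then (\<Sum>l<k. wvec t l)^2 / col_info n else 0)"
    using col_info_bounds(3)[OF n_mem] by (intro sum.cong) (auto simp: colc_def power2_eq_square)
  also have "\<dots> = (\<Sum>l<k. wvec t l)^2 / col_info n" using n3 by simp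
  finally have 2: "(\<Sum>j\<in>{1..n}. (colc t j)^2 * col_info j) = (\<Sum>l<k. wvec t l)^2 / col_info n" .
  define c where "c e = rowc t (fst e) * colc t (snd e) / (rate e)^2" for e
  have c_le: "\<bar>c e\<bar> \<le> (nrm t * rho)^2" if e: "e \<in> offdiag n" for e
  proof -
    have "\<bar>c e\<bar> = \<bar>rowc t (fst e) / rate e\<bar> * \<bar>colc t (snd e) / rate e\<bar>"
      by (simp add: c_def abs_mult power2_eq_square)
    also have "\<dots> \<le> (nrm t * rho) * (nrm t * rho)"
      using coeff_le[OF e] nrm(1)[of t] rho(1) by (intro mult_mono) auto
    finally show ?thesis by (simp add: power2_eq_square)
  qed
  have "\<bar>\<Sum>e\<in>offdiag n. c e\<bar> = \<bar>\<Sum>e\<in>(\<lambda>i. (i, n)) ` {1..k} \<inter> offdiag n. c e\<bar>"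
  proof -
    have "(\<Sum>e\<in>(\<lambda>i. (i, n)) ` {1..k} \<inter> offdiag n. c e) = (\<Sum>e\<in>offdiag n. c e)"
    proof (rule sum.mono_neutral_left, simp, simp, rule ballI)
      fix e assume e: "e \<in> offdiag n - (\<lambda>i. (i, n)) ` {1..k} \<inter> offdiag n"
      have "\<not> (fst e \<in> {1..k} \<and> snd e = n)"
      proof
        assume "fst e \<in> {1..k} \<and> snd e = n"
        then have "e \<in> (\<lambda>i. (i, n)) ` {1..k}" by (intro image_eqI[of _ _ "fst e"]) auto
        then show False using e by blast
      qed
      then show "c e = 0" by (auto simp: c_def rowc_def colc_def)
    qed
    then show ?thesis by simp
  qed
  also have "\<dots> \<le> (\<Sum>e\<in>(\<lambda>i. (i, n)) ` {1..k} \<inter> offdiag n. (nrm t * rho)^2)"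
    using c_le by (intro order_trans[OF sum_abs sum_mono]) auto
  also have "\<dots> = real (card ((\<lambda>i. (i, n)) ` {1..k} \<inter> offdiag n)) * (nrm t * rho)^2" by simp
  also have "\<dots> \<le> real k * (nrm t * rho)^2"
  proof (intro mult_right_mono)
    have "card ((\<lambda>i. (i, n)) ` {1..k} \<inter> offdiag n) \<le> card ((\<lambda>i. (i, n)) ` {1..k})"
      by (intro card_mono) auto
    also have "\<dots> \<le> k" using card_image_le[of "{1..k}" "\<lambda>i. (i, n)"] by simp
    finally show "real (card ((\<lambda>i. (i, n)) ` {1..k} \<inter> offdiag n)) \<le> real k" by simp
  qed simp
  finally have cs: "\<bar>\<Sum>e\<in>offdiag n. c e\<bar> \<le> real k * (nrm t * rho)^2" .
  have "(\<Sum>e\<in>offdiag n. ((rowc t (fst e) + colc t (snd e)) / rate e)^2) - (nrm t)^2 = 2 * (\<Sum>e\<in>offdiag n. c e)"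
    unfolding variance_eq 1 2 std_mat(2)[of t, symmetric] c_def by simp
  then show ?thesis using cs by simp
qed

lemma std_error_measurable: "(\<lambda>A. std_error A) \<in> borel_measurable M"
proof (rule measurable_coordinatewise_then_product)
  fix i
  have "(\<lambda>A. fst (mle n A) (l + 1)) \<in> borel_measurable M" if "l < k" for l
    using that kn n3 degree_map_measurable by (intro mle_measurable) auto
  then show "(\<lambda>A. std_error A i) \<in> borel_measurable M"
    using kn by (cases "i < k") (auto simp: std_error_def theta_coord_def intro!: borel_measurable_sum borel_measurable_times borel_measurable_diff)
qed

lemma norm_iexp_diff: "norm (iexp x - iexp y) \<le> \<bar>x - y\<bar>"
proof -
  have "iexp x - iexp y = iexp y * (iexp (x - y) - 1)"
  proof -
    have "iexp y * iexp (x - y) = iexp x"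
      by (simp only: mult_exp_exp distrib_left[symmetric] of_real_add[symmetric]) simp
    then show ?thesis by (simp only: right_diff_distrib mult_1_right)
  qed
  then have "norm (iexp x - iexp y) = norm (iexp (x - y) - 1)" by (simp add: norm_mult del: of_real_diff)
  also have "\<dots> \<le> \<bar>x - y\<bar>" using iexp_approx1[of "x - y" 0] by simp
  finally show ?thesis .
qed

text \<open>The four terms are the linearisation error on the good event, the bad event, where two
  numbers of modulus 1 differ by at most 2, the third moments in the Gaussian replacement, and the
  gap between the variance of the leading term and (nrm t)^2.\<close>

lemma char_bound:
  assumes \<tau>: "0 \<le> \<tau>" "2 * (Q / q) * \<tau> * sqrt (real n) \<le> real n - 1" "8 * (Q / q) < real n - 1" "omega \<tau> \<le> 1/2"
    and small: "2 * (nrm t * rho) \<le> 1"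
  shows "norm ((\<integral>A. iexp (\<Sum>i<k. t i * std_error A i) \<partial>M) - exp (- ((nrm t)^2) / 2))
    \<le> real k * nrm t * (sqrt (real n) * kappa \<tau>) + 16 * real n * exp (1/2 - \<tau> / 2)
      + 2 * (nrm t * rho) * ((nrm t)^2 + 2 * real k * (nrm t * rho)^2) + real k * (nrm t * rho)^2"
proof -
  define X where "X A = (\<Sum>i<k. t i * std_error A i)" for A
  define Y where "Y = lin_dev (rowc t) (colc t)"
  have [measurable]: "(\<lambda>A. std_error A i) \<in> borel_measurable M" for i
    using std_error_measurable by (rule measurable_product_then_coordinatewise)
  have [measurable]: "X \<in> borel_measurable M" unfolding X_def by measurable
  have [measurable]: "Y \<in> borel_measurable M" unfolding Y_def by measurable
  have iX: "integrable M (\<lambda>A. iexp (X A))" and iY: "integrable M (\<lambda>A. iexp (Y A))"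
    by (intro integrable_iexp; simp)+
  define K where "K = real k * nrm t * (sqrt (real n) * kappa \<tau>)"
  define N where "N = {A \<in> space M. \<not> good \<tau> A}"
  have "N = space M - {A \<in> space M. good \<tau> A}" by (auto simp: N_def)
  then have N: "N \<in> sets M" by simp
  have iN: "integrable M (\<lambda>A. 2 * indicator N A :: real)"
    using N by (intro integrable_mult_right integrable_real_indicator) (auto simp: less_top[symmetric])
  have K: "\<bar>X A - Y A\<bar> \<le> K" if "good \<tau> A" for A
    unfolding X_def Y_def K_def by (rule std_error_approx[OF \<tau> that])
  have K0: "0 \<le> K"
    unfolding K_def kappa_def using nrm \<tau>(1) Q0 q0 by simp
  have "norm ((\<integral>A. iexp (X A) \<partial>M) - (\<integral>A. iexp (Y A) \<partial>M)) = norm (\<integral>A. iexp (X A) - iexp (Y A) \<partial>M)"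
    using iX iY by simp
  also have "\<dots> \<le> (\<integral>A. norm (iexp (X A) - iexp (Y A)) \<partial>M)" by (rule integral_norm_bound)
  also have "\<dots> \<le> (\<integral>A. K + 2 * indicator N A \<partial>M)"
  proof (rule integral_mono)
    show "integrable M (\<lambda>A. norm (iexp (X A) - iexp (Y A)))" using iX iY by (intro integrable_norm Bochner_Integration.integrable_diff)
    show "integrable M (\<lambda>A. K + 2 * indicator N A)" using iN by (intro Bochner_Integration.integrable_add) auto
    fix A assume A: "A \<in> space M"
    show "norm (iexp (X A) - iexp (Y A)) \<le> K + 2 * indicator N A"
    proof (cases "good \<tau> A")
      case True
      then show ?thesis using K[OF True] norm_iexp_diff[of "X A" "Y A"] by (simp add: N_def)
    next
      case False
      have "norm (iexp (X A) - iexp (Y A)) \<le> norm (iexp (X A)) + norm (iexp (Y A))" by (rule norm_triangle_ineq4)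
      then show ?thesis using False A K0 by (simp add: N_def)
    qed
  qed
  also have "\<dots> = K + 2 * prob N" using iN N by (simp add: prob_space)
  also have "\<dots> \<le> K + 2 * (8 * real n * exp (1/2 - \<tau> / 2))"
    unfolding N_def by (intro add_left_mono mult_left_mono prob_not_good) auto
  finally have 1: "norm ((\<integral>A. iexp (X A) \<partial>M) - (\<integral>A. iexp (Y A) \<partial>M)) \<le> K + 16 * real n * exp (1/2 - \<tau> / 2)" by simp
  define h where "h e = (rowc t (fst e) + colc t (snd e)) / rate e" for e
  define \<sigma>2 where "\<sigma>2 = (\<Sum>e\<in>offdiag n. (h e)^2)"
  have h: "\<bar>h e\<bar> \<le> 2 * (nrm t * rho)" if e: "e \<in> offdiag n" for e
    using coeff_le[OF e, of t] unfolding h_def add_divide_distrib by linarith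
  have \<sigma>2: "\<bar>\<sigma>2 - (nrm t)^2\<bar> \<le> 2 * real k * (nrm t * rho)^2"
    unfolding \<sigma>2_def h_def by (rule variance_approx)
  have "norm ((\<integral>A. iexp (Y A) \<partial>M) - exp (- \<sigma>2 / 2)) \<le> (\<Sum>e\<in>offdiag n. \<bar>h e\<bar>^3)"
    unfolding Y_def lin_dev_eq M_eq \<sigma>2_def h_def using h small rate_pos
    by (intro exp_product_char_gaussian_approx) (auto simp: h_def intro: order_trans)
  also have "\<dots> \<le> (\<Sum>e\<in>offdiag n. 2 * (nrm t * rho) * (h e)^2)"
  proof (rule sum_mono)
    fix e assume e: "e \<in> offdiag n"
    have "\<bar>h e\<bar>^3 = \<bar>h e\<bar> * (h e)^2" by (simp add: power3_eq_cube power2_eq_square)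
    also have "\<dots> \<le> 2 * (nrm t * rho) * (h e)^2" using h[OF e] by (intro mult_right_mono) auto
    finally show "\<bar>h e\<bar>^3 \<le> 2 * (nrm t * rho) * (h e)^2" .
  qed
  also have "\<dots> = 2 * (nrm t * rho) * \<sigma>2" by (simp add: \<sigma>2_def sum_distrib_left)
  also have "\<dots> \<le> 2 * (nrm t * rho) * ((nrm t)^2 + 2 * real k * (nrm t * rho)^2)"
    using \<sigma>2 nrm rho by (intro mult_left_mono) auto
  finally have 2: "norm ((\<integral>A. iexp (Y A) \<partial>M) - exp (- \<sigma>2 / 2)) \<le> 2 * (nrm t * rho) * ((nrm t)^2 + 2 * real k * (nrm t * rho)^2)" .
  have lip: "exp (- a / 2) - exp (- b / 2) \<le> \<bar>a - b\<bar> / 2" if "0 \<le> a" for a b :: real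
  proof -
    have "exp (- a / 2) * (1 + (a - b) / 2) \<le> exp (- a / 2) * exp ((a - b) / 2)"
      by (intro mult_left_mono exp_ge_add_one_self) auto
    also have "\<dots> = exp (- b / 2)" by (simp add: mult_exp_exp diff_divide_distrib)
    finally have "exp (- a / 2) - exp (- b / 2) \<le> exp (- a / 2) * ((b - a) / 2)" by (simp add: algebra_simps diff_divide_distrib)
    also have "\<dots> \<le> exp (- a / 2) * (\<bar>a - b\<bar> / 2)"
    proof (rule mult_left_mono)
      show "(b - a) / 2 \<le> \<bar>a - b\<bar> / 2" using abs_ge_minus_self[of "a - b"] by simp
    qed simp
    also have "\<dots> \<le> 1 * (\<bar>a - b\<bar> / 2)" using that by (intro mult_right_mono) auto
    finally show ?thesis by simp
  qed
  have "0 \<le> \<sigma>2" by (simp add: \<sigma>2_def sum_nonneg)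
  then have "\<bar>exp (- \<sigma>2 / 2) - exp (- ((nrm t)^2) / 2)\<bar> \<le> \<bar>\<sigma>2 - (nrm t)^2\<bar> / 2"
    using lip[of \<sigma>2 "(nrm t)^2"] lip[of "(nrm t)^2" \<sigma>2] abs_minus_commute[of \<sigma>2 "(nrm t)^2"]
    by (intro abs_leI) simp_all
  then have 3: "\<bar>exp (- \<sigma>2 / 2) - exp (- ((nrm t)^2) / 2)\<bar> \<le> real k * (nrm t * rho)^2"
    by (rule order_trans) (use \<sigma>2 in simp)
  have "norm (complex_of_real (exp (- \<sigma>2 / 2)) - complex_of_real (exp (- ((nrm t)^2) / 2))) = \<bar>exp (- \<sigma>2 / 2) - exp (- ((nrm t)^2) / 2)\<bar>"
    by (simp only: of_real_diff[symmetric] norm_of_real)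
  then have gauss: "norm (complex_of_real (exp (- \<sigma>2 / 2)) - complex_of_real (exp (- ((nrm t)^2) / 2))) \<le> real k * (nrm t * rho)^2"
    using 3 by simp
  have "norm ((\<integral>A. iexp (X A) \<partial>M) - exp (- ((nrm t)^2) / 2)) \<le>
      norm ((\<integral>A. iexp (X A) \<partial>M) - (\<integral>A. iexp (Y A) \<partial>M)) + norm ((\<integral>A. iexp (Y A) \<partial>M) - exp (- \<sigma>2 / 2))
      + norm (complex_of_real (exp (- \<sigma>2 / 2)) - complex_of_real (exp (- ((nrm t)^2) / 2)))"
    by (rule norm_diff_triangle_le[OF norm_diff_triangle_le[OF order_refl order_refl] order_refl])
  then show ?thesis using 1 2 gauss unfolding X_def K_def by linarith
qed

text \<open>For a unit vector t the smallness conditions give variance at most 1 + 3 = 2^2 and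
  linearisation error at most 1. So an excess over K on the good event makes the leading term exceed
  K - 1, which is (K - 1) / 2 times the bound 2 for its standard deviation.\<close>

lemma tail_bound:
  assumes \<tau>: "0 \<le> \<tau>" "2 * (Q / q) * \<tau> * sqrt (real n) \<le> real n - 1" "8 * (Q / q) < real n - 1" "omega \<tau> \<le> 1/2"
    and small: "2 * real k * rho^2 \<le> 3" "real k * (sqrt (real n) * kappa \<tau>) \<le> 1"
  shows "prob {A \<in> space M. \<exists>i<k. K < \<bar>std_error A i\<bar>}
    \<le> 8 * real n * exp (1/2 - \<tau> / 2) + real k * (2 * exp (1/2 - ((K - 1) / 2) / 2))"
proof -
  define t :: "nat \<Rightarrow> nat \<Rightarrow> real" where "t i j = (if j = i then 1 else 0)" for i j
  have nt: "nrm (t i) = 1" if "i < k" for i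
  proof -
    have "(\<Sum>j<k. (t i j)^2) = (\<Sum>j<k. if j = i then 1 else 0)" by (intro sum.cong) (auto simp: t_def)
    then show ?thesis using that by (simp add: nrm_def)
  qed
  have X: "(\<Sum>j<k. t i j * std_error A j) = std_error A i" if "i < k" for i A
  proof -
    have "(\<Sum>j<k. t i j * std_error A j) = (\<Sum>j<k. if j = i then std_error A j else 0)"
      by (intro sum.cong) (auto simp: t_def)
    then show ?thesis using that by simp
  qed
  define N where "N = {A \<in> space M. \<not> good \<tau> A}"
  have "N = space M - {A \<in> space M. good \<tau> A}" by (auto simp: N_def)
  then have N: "N \<in> sets M" by simp
  define T where "T i = {A \<in> space M. (K - 1) / 2 * 2 < \<bar>lin_dev (rowc (t i)) (colc (t i)) A\<bar>}" for i
  have T: "T i \<in> sets M" for i unfolding T_def by measurable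
  have PT: "prob (T i) \<le> 2 * exp (1/2 - ((K - 1) / 2) / 2)" if i: "i < k" for i
    unfolding T_def
  proof (rule lin_dev_tail)
    show "(\<Sum>e\<in>offdiag n. ((rowc (t i) (fst e) + colc (t i) (snd e)) / rate e)^2) \<le> 2^2"
      using variance_approx[of "t i"] small(1) nt[OF i] by (simp add: abs_le_iff)
  qed simp
  have "{A \<in> space M. \<exists>i<k. K < \<bar>std_error A i\<bar>} \<subseteq> N \<union> (\<Union>i<k. T i)"
  proof
    fix A assume "A \<in> {A \<in> space M. \<exists>i<k. K < \<bar>std_error A i\<bar>}"
    then obtain i where i: "A \<in> space M" "i < k" "K < \<bar>std_error A i\<bar>" by auto
    show "A \<in> N \<union> (\<Union>i<k. T i)"
    proof (cases "good \<tau> A")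
      case True
      have "\<bar>std_error A i - lin_dev (rowc (t i)) (colc (t i)) A\<bar> \<le> 1"
        using std_error_approx[OF \<tau> True, of "t i"] small(2) nt[OF i(2)] unfolding X[OF i(2)] by simp
      then have "A \<in> T i" using i unfolding T_def by auto
      then show ?thesis using i by auto
    qed (use i in \<open>simp add: N_def\<close>)
  qed
  then have "prob {A \<in> space M. \<exists>i<k. K < \<bar>std_error A i\<bar>} \<le> prob (N \<union> (\<Union>i<k. T i))"
    using N T by (intro finite_measure_mono) auto
  also have "\<dots> \<le> prob N + prob (\<Union>i<k. T i)" using N T by (intro measure_Un_le) auto
  also have "prob (\<Union>i<k. T i) \<le> (\<Sum>i<k. prob (T i))"
    using T by (intro finite_measure_subadditive_finite) auto
  also have "\<dots> \<le> (\<Sum>i<k. 2 * exp (1/2 - ((K - 1) / 2) / 2))" using PT by (intro sum_mono) auto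
  finally show ?thesis using prob_not_good[of \<tau>] unfolding N_def by simp
qed

end

section \<open>The limit theorem\<close>

context cw_bounded
begin

lemma omega_le:
  assumes "0 \<le> \<tau>" "Q / q \<le> R"
  shows "omega \<tau> \<le> 640 * \<tau> * sqrt (real n) * real n * R^4 / (real n - 2)^2"
proof -
  have "(Q / q)^4 \<le> R^4" using assms(2) Q0 q0 by (intro power_mono) auto
  then show ?thesis unfolding omega_def using assms(1)
    by (intro divide_right_mono mult_left_mono) auto
qed

lemma kappa_nonneg: "0 \<le> \<tau> \<Longrightarrow> 0 \<le> kappa \<tau>"
  unfolding kappa_def using Q0 q0 by simp

lemma kappa_le:
  assumes "0 \<le> \<tau>" "Q / q \<le> R"
  shows "kappa \<tau> \<le> 10 * (real n * (640 * \<tau> * sqrt (real n) * real n * R^4 / (real n - 2)^2)^2 + \<tau> * R) * real n * R^4 / (real n - 2)^2"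
proof -
  have r: "0 \<le> Q / q" using Q0 q0 by simp
  have "(Q / q)^4 \<le> R^4" using assms(2) r by (intro power_mono) auto
  moreover have "0 \<le> omega \<tau>" unfolding omega_def using assms(1) r by simp
  moreover have "0 \<le> R" using assms(2) r by linarith
  moreover have "0 \<le> \<tau> * Q / q" using mult_nonneg_nonneg[OF assms(1) r] by simp
  ultimately show ?thesis unfolding kappa_def using assms omega_le[OF assms] r
    by (intro divide_right_mono mult_mono add_mono power_mono) auto
qed

end

section \<open>The Gaussian limit law\<close>

lemma std_normal_prob: "prob_space (std_normal_vec k)"
  unfolding std_normal_vec_def using real_dist_normal_dist
  by (intro prob_space_PiM) (simp add: real_distribution_def)

lemma std_normal_char:
  "(\<integral>x. iexp (\<Sum>i<k. t i * x i) \<partial>std_normal_vec k) = exp (- (\<Sum>i<k. (t i)^2) / 2)"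
proof -
  interpret N: real_distribution std_normal_distribution by (rule real_dist_normal_dist)
  interpret P: product_sigma_finite "\<lambda>_::nat. std_normal_distribution"
    by (intro product_sigma_finite.intro) (rule N.sigma_finite_measure_axioms)
  have int: "integrable std_normal_distribution (\<lambda>x. iexp (c * x))" for c
    by (rule N.integrable_iexp) auto
  have "(\<integral>x. iexp (\<Sum>i<k. t i * x i) \<partial>std_normal_vec k) = (\<integral>x. (\<Prod>i<k. iexp (t i * x i)) \<partial>std_normal_vec k)"
    by (simp add: exp_sum sum_distrib_left)
  also have "\<dots> = (\<Prod>i<k. \<integral>x. iexp (t i * x) \<partial>std_normal_distribution)"
    unfolding std_normal_vec_def using int by (intro P.product_integral_prod) auto
  also have "\<dots> = (\<Prod>i<k. complex_of_real (exp (- ((t i)^2) / 2)))"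
    using char_std_normal_distribution by (intro prod.cong) (auto simp: char_def fun_eq_iff)
  also have "\<dots> = exp (\<Sum>i<k. - ((t i)^2) / 2)"
    by (simp add: exp_sum)
  finally show ?thesis by (simp add: sum_negf sum_divide_distrib)
qed

lemma std_normal_id_measurable: "(\<lambda>x. x) \<in> borel_measurable (std_normal_vec k)"
proof (rule measurable_coordinatewise_then_product)
  fix i
  show "(\<lambda>x. x i) \<in> borel_measurable (std_normal_vec k)"
  proof (cases "i < k")
    case True
    then have "(\<lambda>x. x i) \<in> measurable (std_normal_vec k) std_normal_distribution"
      unfolding std_normal_vec_def by (intro measurable_component_singleton) auto
    then show ?thesis by (simp cong: measurable_cong_sets)
  next
    case False
    then have "x i = undefined" if "x \<in> space (std_normal_vec k)" for x
      using that by (auto simp: std_normal_vec_def space_PiM PiE_def extensional_def)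
    then show ?thesis by (subst measurable_cong[of _ _ "\<lambda>_. undefined"]) auto
  qed
qed

lemma (in prob_space) coordinates_tight:
  fixes X :: "'a \<Rightarrow> nat \<Rightarrow> real"
  assumes X: "X \<in> borel_measurable M"
  shows "(\<lambda>m. prob {\<omega> \<in> space M. \<exists>i<k. real m < \<bar>X \<omega> i\<bar>}) \<longlonglongrightarrow> 0"
proof -
  define A where "A m = {\<omega> \<in> space M. \<exists>i<k. real m < \<bar>X \<omega> i\<bar>}" for m
  have [measurable]: "(\<lambda>\<omega>. X \<omega> i) \<in> borel_measurable M" for i
    using X by (rule measurable_product_then_coordinatewise)
  have "A m \<in> sets M" for m unfolding A_def by measurable
  moreover have "decseq A" unfolding A_def decseq_def
    by (auto intro: le_less_trans[OF of_nat_mono])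
  ultimately have "(\<lambda>m. prob (A m)) \<longlonglongrightarrow> prob (\<Inter>m. A m)"
    by (intro finite_Lim_measure_decseq) auto
  moreover have "(\<Inter>m. A m) = {}"
  proof -
    have "\<exists>m. \<omega> \<notin> A m" for \<omega>
    proof -
      obtain m where "(\<Sum>i<k. \<bar>X \<omega> i\<bar>) \<le> real m" using real_arch_simple by blast
      moreover have "\<bar>X \<omega> i\<bar> \<le> (\<Sum>i<k. \<bar>X \<omega> i\<bar>)" if "i < k" for i
        using that by (intro member_le_sum) auto
      ultimately show ?thesis by (intro exI[of _ m]) (fastforce simp: A_def not_less)
    qed
    then show ?thesis by blast
  qed
  ultimately show ?thesis by (simp add: A_def)
qed

theorem theorem4:
  fixes \<alpha>s \<beta>s :: "nat \<Rightarrow> nat \<Rightarrow> real" and q Q :: "nat \<Rightarrow> real" and k :: nat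
  assumes beta_last: "\<And>n. \<beta>s n n = 0"
    and q_pos: "\<And>n. 0 < q n" and qQ: "\<And>n. q n \<le> Q n"
    and bounds: "\<And>n i j. i \<in> {1..n} \<Longrightarrow> j \<in> {1..n} \<Longrightarrow> i \<noteq> j \<Longrightarrow>
                   q n \<le> \<alpha>s n i + \<beta>s n j \<and> \<alpha>s n i + \<beta>s n j \<le> Q n"
    and ratio: "(\<lambda>n. Q n / q n) \<in> o(\<lambda>n. real n powr (1/50) / ln (real n) powr (1/25))"
    and k: "1 \<le> k"
  shows "conv_in_distr (\<lambda>n. cw_model n (\<alpha>s n) (\<beta>s n))
           (\<lambda>n A. \<lambda>i. if i < k then
              (\<Sum>l<k. inv_sqrt_mat k (\<lambda>a b. S_mat n (\<alpha>s n) (\<beta>s n) (a + 1) (b + 1)) i l *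
                 (theta_coord n (fst (mle n A)) (snd (mle n A)) (l + 1)
                  - theta_coord n (\<alpha>s n) (\<beta>s n) (l + 1)))
            else undefined)
           (std_normal_vec k)"
proof -
  define X where "X n A = (\<lambda>i. if i < k then
              (\<Sum>l<k. inv_sqrt_mat k (\<lambda>a b. S_mat n (\<alpha>s n) (\<beta>s n) (a + 1) (b + 1)) i l *
                 (theta_coord n (fst (mle n A)) (snd (mle n A)) (l + 1)
                  - theta_coord n (\<alpha>s n) (\<beta>s n) (l + 1)))
            else undefined)" for n A
  \<comment> \<open>For large n, R n bounds Q n / q n, and om, ka, rh bound omega, kappa, rho. The
    power \<tau> n makes n * exp (- \<tau> n / 2) vanish, while sqrt n * ka n is of order \<tau>^2 *
    R^12 / sqrt n, that is n powr (- 4/25).\<close>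
  define R \<tau> om ka rh where "R n = real n powr (1/50)" and "\<tau> n = real n powr (1/20)"
    and "om n = 640 * \<tau> n * sqrt (real n) * real n * R n^4 / (real n - 2)^2"
    and "ka n = 10 * (real n * (om n)^2 + \<tau> n * R n) * real n * R n^4 / (real n - 2)^2"
    and "rh n = R n / sqrt (real n - 1)" for n :: nat
  have loc: "cw_bounded_block n (\<alpha>s n) (\<beta>s n) (q n) (Q n) k" if "3 \<le> n" "k \<le> n" for n
    using that beta_last q_pos qQ bounds k
    by (intro cw_bounded_block.intro cw_bounded.intro cw_bounded_block_axioms.intro) auto
  have r_ev: "\<forall>\<^sub>F n in sequentially. Q n / q n \<le> R n"
  proof -
    have "\<forall>\<^sub>F n in sequentially. norm (Q n / q n) \<le> 1 * norm (real n powr (1/50) / ln (real n) powr (1/25))"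
      using landau_o.smallD[OF ratio, of 1] by simp
    moreover have "\<forall>\<^sub>F n in sequentially. 1 \<le> ln (real n) powr (1/25)" by real_asymp
    ultimately show ?thesis
    proof eventually_elim
      case (elim n)
      have "Q n / q n \<le> norm (Q n / q n)" unfolding real_norm_def by (rule abs_ge_self)
      also have "\<dots> \<le> 1 * norm (real n powr (1/50) / ln (real n) powr (1/25))" by (rule elim(1))
      also have "\<dots> = real n powr (1/50) / ln (real n) powr (1/25)" by simp
      also have "\<dots> \<le> real n powr (1/50) / 1"
        using elim(2) by (intro divide_left_mono) auto
      finally show ?case by (simp add: R_def)
    qed
  qed
  have ev1: "\<forall>\<^sub>F n in sequentially. 2 * R n * \<tau> n * sqrt (real n) \<le> real n - 1"
    unfolding R_def \<tau>_def by real_asymp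
  have ev2: "\<forall>\<^sub>F n in sequentially. 8 * R n < real n - 1"
    unfolding R_def by real_asymp
  have ev3: "\<forall>\<^sub>F n in sequentially. om n \<le> 1/2"
    unfolding om_def R_def \<tau>_def by real_asymp
  have lim1: "(\<lambda>n. sqrt (real n) * ka n) \<longlonglongrightarrow> 0"
    unfolding ka_def om_def R_def \<tau>_def by real_asymp
  have lim2: "(\<lambda>n. real n * exp (1/2 - \<tau> n / 2)) \<longlonglongrightarrow> 0"
    unfolding \<tau>_def by real_asymp
  have lim3: "rh \<longlonglongrightarrow> 0"
    unfolding rh_def R_def by real_asymp
  have \<tau>0: "0 \<le> \<tau> n" for n by (simp add: \<tau>_def)
  define ok where "ok n \<longleftrightarrow> 3 \<le> n \<and> k \<le> n \<and> Q n / q n \<le> R n \<and> 2 * R n * \<tau> n * sqrt (real n) \<le> real n - 1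
    \<and> 8 * R n < real n - 1 \<and> om n \<le> 1/2" for n
  have ok_ev: "\<forall>\<^sub>F n in sequentially. ok n"
    unfolding ok_def using r_ev ev1 ev2 ev3 by (intro eventually_conj eventually_ge_at_top)
  have ok: "cw_bounded_block n (\<alpha>s n) (\<beta>s n) (q n) (Q n) k"
    "2 * (Q n / q n) * \<tau> n * sqrt (real n) \<le> real n - 1" "8 * (Q n / q n) < real n - 1"
    "cw_bounded.omega n (q n) (Q n) (\<tau> n) \<le> 1/2" "cw_bounded.kappa n (q n) (Q n) (\<tau> n) \<le> ka n"
    "cw_bounded_block.rho n (q n) (Q n) \<le> rh n" "0 \<le> cw_bounded_block.rho n (q n) (Q n)"
    "X n = cw_bounded_block.std_error n (\<alpha>s n) (\<beta>s n) k"
    if n: "ok n" for n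
  proof -
    show l: "cw_bounded_block n (\<alpha>s n) (\<beta>s n) (q n) (Q n) k" using n loc by (simp add: ok_def)
    interpret cw_bounded_block n "\<alpha>s n" "\<beta>s n" "q n" "Q n" k by (rule l)
    have r: "Q n / q n \<le> R n" using n by (simp add: ok_def)
    have "2 * (Q n / q n) * \<tau> n * sqrt (real n) \<le> 2 * R n * \<tau> n * sqrt (real n)"
      using r \<tau>0 by (intro mult_right_mono mult_left_mono) auto
    then show "2 * (Q n / q n) * \<tau> n * sqrt (real n) \<le> real n - 1" using n by (simp add: ok_def)
    show "8 * (Q n / q n) < real n - 1" using n r by (simp add: ok_def)
    show "omega (\<tau> n) \<le> 1/2"
    proof -
      have "omega (\<tau> n) \<le> om n" unfolding om_def by (rule omega_le[OF \<tau>0 r])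
      then show ?thesis using n by (simp add: ok_def)
    qed
    show "kappa (\<tau> n) \<le> ka n" unfolding ka_def om_def by (rule kappa_le[OF \<tau>0 r])
    show "rho \<le> rh n" unfolding rho_def rh_def using r n by (intro divide_right_mono) (auto simp: ok_def)
    show "0 \<le> rho" by (rule rho(1))
    show "X n = std_error"
      by (intro ext) (simp add: X_def std_error_def std_mat_def)
  qed
  have "conv_in_distr (\<lambda>n. cw_model n (\<alpha>s n) (\<beta>s n)) X (std_normal_vec k)"
  proof (rule conv_in_distr_of_char)
    show "\<forall>\<^sub>F n in sequentially. prob_space (cw_model n (\<alpha>s n) (\<beta>s n)) \<and> X n \<in> borel_measurable (cw_model n (\<alpha>s n) (\<beta>s n))"
      using ok_ev
    proof eventually_elim
      case (elim n)
      interpret cw_bounded_block n "\<alpha>s n" "\<beta>s n" "q n" "Q n" k by (rule ok(1)[OF elim])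
      show ?case using std_error_measurable prob_space_axioms by (simp add: ok(8)[OF elim])
    qed
    show "X n \<omega> i = undefined" if "k \<le> i" for n \<omega> i using that by (simp add: X_def)
    show "prob_space (std_normal_vec k)" by (rule std_normal_prob)
    show "(\<lambda>x. x) \<in> borel_measurable (std_normal_vec k)" by (rule std_normal_id_measurable)
    show "x i = undefined" if "x \<in> space (std_normal_vec k)" "k \<le> i" for x i
      using that by (auto simp: std_normal_vec_def space_PiM PiE_def extensional_def)
  next
    fix t :: "nat \<Rightarrow> real"
    define T where "T = sqrt (\<Sum>i<k. (t i)^2)"
    have T: "0 \<le> T" "T^2 = (\<Sum>i<k. (t i)^2)" by (simp_all add: T_def sum_nonneg)
    define E where "E n = real k * T * (sqrt (real n) * ka n) + 16 * (real n * exp (1/2 - \<tau> n / 2))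
        + 2 * (T * rh n) * (T^2 + 2 * real k * (T * rh n)^2) + real k * (T * rh n)^2" for n
    have "E \<longlonglongrightarrow> real k * T * 0 + 16 * 0 + 2 * (T * 0) * (T^2 + 2 * real k * (T * 0)^2) + real k * (T * 0)^2"
      unfolding E_def by (intro tendsto_intros lim1 lim2 lim3)
    then have E: "E \<longlonglongrightarrow> 0" by simp
    have small: "\<forall>\<^sub>F n in sequentially. 2 * (T * rh n) \<le> 1"
    proof -
      have "(\<lambda>n. 2 * (T * rh n)) \<longlonglongrightarrow> 2 * (T * 0)" by (intro tendsto_intros lim3)
      then have "\<forall>\<^sub>F n in sequentially. 2 * (T * rh n) < 1" by (rule order_tendstoD) simp
      then show ?thesis by (rule eventually_mono) simp
    qed
    have bound: "\<forall>\<^sub>F n in sequentially. norm ((\<integral>\<omega>. iexp (\<Sum>i<k. t i * X n \<omega> i) \<partial>cw_model n (\<alpha>s n) (\<beta>s n))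
        - exp (- (T^2) / 2)) \<le> E n"
      using ok_ev small
    proof eventually_elim
      case (elim n)
      note o = ok[OF elim(1)]
      interpret cw_bounded_block n "\<alpha>s n" "\<beta>s n" "q n" "Q n" k by (rule o(1))
      have nt: "nrm t = T" by (simp add: nrm_def T_def)
      have Tr: "T * rho \<le> T * rh n" "0 \<le> T * rho" using o(6,7) T(1) by (auto intro: mult_left_mono)
      then have "2 * (nrm t * rho) \<le> 1" using elim(2) unfolding nt by linarith
      note char_bound[OF \<tau>0 o(2-4) this, unfolded nt]
      also have "real k * T * (sqrt (real n) * kappa (\<tau> n)) + 16 * real n * exp (1/2 - \<tau> n / 2)
          + 2 * (T * rho) * (T^2 + 2 * real k * (T * rho)^2) + real k * (T * rho)^2 \<le> E n"
        unfolding E_def mult.assoc[of 16] using Tr T(1) o(5-7) kappa_nonneg[OF \<tau>0]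
        by (intro add_mono mult_mono power_mono order_refl) auto
      finally show ?case unfolding o(8) .
    qed
    have "(\<lambda>n. (\<integral>\<omega>. iexp (\<Sum>i<k. t i * X n \<omega> i) \<partial>cw_model n (\<alpha>s n) (\<beta>s n)) - exp (- (T^2) / 2)) \<longlonglongrightarrow> 0"
      by (rule Lim_null_comparison[OF bound E])
    then show "(\<lambda>n. \<integral>\<omega>. iexp (\<Sum>i<k. t i * X n \<omega> i) \<partial>cw_model n (\<alpha>s n) (\<beta>s n))
        \<longlonglongrightarrow> (\<integral>x. iexp (\<Sum>i<k. t i * x i) \<partial>std_normal_vec k)"
      unfolding std_normal_char T(2) by (rule LIM_zero_cancel)
  next
    fix \<eta> :: real assume \<eta>: "0 < \<eta>"
    have "\<forall>\<^sub>F m in sequentially. measure (std_normal_vec k) {x \<in> space (std_normal_vec k). \<exists>i<k. real m < \<bar>x i\<bar>} < \<eta>"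
      by (rule order_tendstoD(2)[OF prob_space.coordinates_tight[OF std_normal_prob std_normal_id_measurable] \<eta>])
    moreover have "\<forall>\<^sub>F m in sequentially. real k * (2 * exp (1/2 - ((real m - 1) / 2) / 2)) < \<eta> / 2"
    proof -
      have "(\<lambda>m. real k * (2 * exp (1/2 - ((real m - 1) / 2) / 2))) \<longlonglongrightarrow> 0" by real_asymp
      then show ?thesis using \<eta> by (intro order_tendstoD(2)) auto
    qed
    moreover have "\<forall>\<^sub>F m in sequentially. 1 \<le> (m :: nat)" by (rule eventually_ge_at_top)
    ultimately have "\<forall>\<^sub>F m in sequentially. measure (std_normal_vec k) {x \<in> space (std_normal_vec k). \<exists>i<k. real m < \<bar>x i\<bar>} < \<eta>
        \<and> real k * (2 * exp (1/2 - ((real m - 1) / 2) / 2)) < \<eta> / 2 \<and> 1 \<le> m"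
      by (intro eventually_conj)
    from eventually_happens'[OF sequentially_bot this] obtain m :: nat where m: "measure (std_normal_vec k) {x \<in> space (std_normal_vec k). \<exists>i<k. real m < \<bar>x i\<bar>} < \<eta>"
      "real k * (2 * exp (1/2 - ((real m - 1) / 2) / 2)) < \<eta> / 2" "1 \<le> m"
      by blast
    have s1: "\<forall>\<^sub>F n in sequentially. 2 * real k * (rh n)^2 \<le> 3"
    proof -
      have "(\<lambda>n. 2 * real k * (rh n)^2) \<longlonglongrightarrow> 2 * real k * 0^2" by (intro tendsto_intros lim3)
      then have "\<forall>\<^sub>F n in sequentially. 2 * real k * (rh n)^2 < 3" by (rule order_tendstoD) simp
      then show ?thesis by (rule eventually_mono) simp
    qed
    have s2: "\<forall>\<^sub>F n in sequentially. real k * (sqrt (real n) * ka n) \<le> 1"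
    proof -
      have "(\<lambda>n. real k * (sqrt (real n) * ka n)) \<longlonglongrightarrow> real k * 0" by (intro tendsto_intros lim1)
      then have "\<forall>\<^sub>F n in sequentially. real k * (sqrt (real n) * ka n) < 1" by (rule order_tendstoD) simp
      then show ?thesis by (rule eventually_mono) simp
    qed
    \<comment> \<open>The bad event enters \<open>tail_bound\<close> with the factor 8 and so uses
      half of \<eta>; the choice of m covers the other half.\<close>
    have s3: "\<forall>\<^sub>F n in sequentially. real n * exp (1/2 - \<tau> n / 2) < \<eta> / 16"
      using \<eta> by (intro order_tendstoD(2)[OF lim2]) simp
    have "\<forall>\<^sub>F n in sequentially. measure (cw_model n (\<alpha>s n) (\<beta>s n))
        {\<omega> \<in> space (cw_model n (\<alpha>s n) (\<beta>s n)). \<exists>i<k. real m < \<bar>X n \<omega> i\<bar>} \<le> \<eta>"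
      using ok_ev s1 s2 s3
    proof eventually_elim
      case (elim n)
      note o = ok[OF elim(1)]
      interpret cw_bounded_block n "\<alpha>s n" "\<beta>s n" "q n" "Q n" k by (rule o(1))
      have "2 * real k * rho^2 \<le> 2 * real k * (rh n)^2"
        using o(6,7) by (intro mult_left_mono power_mono) auto
      then have 1: "2 * real k * rho^2 \<le> 3" using elim(2) by linarith
      have "real k * (sqrt (real n) * kappa (\<tau> n)) \<le> real k * (sqrt (real n) * ka n)"
        using o(5) by (intro mult_left_mono) auto
      then have 2: "real k * (sqrt (real n) * kappa (\<tau> n)) \<le> 1" using elim(3) by linarith
      show ?case using tail_bound[OF \<tau>0 o(2-4) 1 2, of "real m"] elim(4) m(2) unfolding o(8) by simp
    qed
    then show "\<exists>K>0. (\<forall>\<^sub>F n in sequentially. measure (cw_model n (\<alpha>s n) (\<beta>s n))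
        {\<omega> \<in> space (cw_model n (\<alpha>s n) (\<beta>s n)). \<exists>i<k. K < \<bar>X n \<omega> i\<bar>} \<le> \<eta>)
        \<and> measure (std_normal_vec k) {x \<in> space (std_normal_vec k). \<exists>i<k. K < \<bar>x i\<bar>} \<le> \<eta>"
      using m(1,3) by (intro exI[of _ "real m"]) auto
  qed
  then show ?thesis unfolding X_def .
qed

end
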